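(* Let $T,\mu>0$, $\xi\in H^2$ (nonrandom) and $Q^{1/2}\in\mathcal L_2^1$. For $\varepsilon\in(0,1)$ let $u$ be the mild solution of the stochastic KdV equation with noise amplitude $\varepsilon$ and $u(0)=\xi$, let $\psi$ be the solution of the deterministic KdV equation with $\psi(0)=\xi$, let $u^\varepsilon=\varepsilon^{-1}(u-\psi)$, and let $\chi$ be the solution of the linearized fluctuation equation (all as defined in the context). Then for every $p\in\mathbb N=\{1,2,\dots\}$ there exists a constant $C>0$, depending on $p$, $T$, $\|Q^{1/2}\|_{\mathcal L_2^1}$, $\sup_{t\in[0,T]}\|\partial_x\psi(t)\|_{L^\infty}$, $\sup_{t\in[0,T]}\|\chi(t)\|_{L^{4p}(\Omega;H^1)}$ and $\sup_{\varepsilon\in(0,1)}\sup_{t\in[0,T]}\|u^\varepsilon(t)\|_{L^{8p}(\Omega;H^1)}$ (and independent of $\varepsilon$), such that for every $\varepsilon\in(0,1)$ $$\sup_{t\in[0,T]}\|u^\varepsilon(t)-\chi(t)\|_{L^{2p}(\Omega;L^2)}\le C\varepsilon .$$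
   Context: $\mathbb T=[-\pi,\pi]$ with periodic boundary conditions; $L^2=L^2(\mathbb T;\mathbb R)$ with norm $\|\cdot\|$; $H^s=H^s(\mathbb T;\mathbb R)$ with $\|f\|_{H^s}^2=\sum_{\ell\in\mathbb Z}(1+\ell^2)^s|\hat f_\ell|^2$, where $f=\frac1{\sqrt{2\pi}}\sum_\ell\hat f_\ell e^{i\ell x}$. $\mathcal L_2^\sigma$ is the space of Hilbert--Schmidt operators from $L^2$ to $H^\sigma$ with its Hilbert--Schmidt norm. $\|Y\|_{L^p(\Omega;X)}=(\mathbb E\|Y\|_X^p)^{1/p}$. $W=\sum_k\beta_k e_k$ is a cylindrical Wiener process on $L^2$ on a complete filtered probability space ($\beta_k$ independent standard Brownian motions, $\{e_k\}$ an orthonormal basis of $L^2$); $Q^{1/2}$ is the square root of a covariance (nonnegative self-adjoint) operator $Q$ on $L^2$. $S(t)=e^{-t\partial_x^3}$ is the Airy group. Stochastic KdV: $du=-\partial_x^3u\,dt+\mu\partial_x(u^2)\,dt+\varepsilon Q^{1/2}dW$, $u(0)=\xi$; its mild solution is the unique process with $u\in C([0,T];H^1)$ a.s. and $u(t)=S(t)\xi+\mu\int_0^tS(t-s)\partial_x(u(s)^2)ds+\varepsilon\int_0^tS(t-s)Q^{1/2}dW(s)$. Deterministic KdV: $\dot\psi=-\partial_x^3\psi+\mu\partial_x(\psi^2)$, $\psi(0)=\xi$; for $\xi\in H^\sigma$, $\sigma\in\mathbb N$, it has a unique solution $\psi\in C([0,T];H^\sigma)$. Linearized fluctuation equation: $d\chi=(-\partial_x^3\chi+2\mu\partial_x(\psi\chi))dt+Q^{1/2}dW$,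 $\chi(0)=0$, understood in mild form $\chi(t)=2\mu\int_0^tS(t-s)\partial_x(\psi(s)\chi(s))ds+\int_0^tS(t-s)Q^{1/2}dW(s)$, with $\chi\in C([0,T];H^1)$ a.s. *)

theory Defs
  imports "HOL-Probability.Probability"
begin

section \<open>The Hilbert space of square-integrable real functions on the torus\<close>

definition torus :: "real measure" where
  "torus = restrict_space lborel {-pi..pi}"

definition square_int :: "(real \<Rightarrow> real) \<Rightarrow> bool" where
  "square_int f \<longleftrightarrow> f \<in> borel_measurable torus \<and> integrable torus (\<lambda>x. (f x)\<^sup>2)"

lemma finite_measure_torus: "finite_measure torus"
proof
  have "emeasure torus (space torus) = emeasure lborel {-pi..pi}"
    by (simp add: torus_def emeasure_restrict_space space_restrict_space)
  then show "emeasure torus (space torus) \<noteq> \<infinity>" by simp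
qed

lemma square_int_measurable: "square_int f \<Longrightarrow> f \<in> borel_measurable torus"
  by (simp add: square_int_def)

lemma square_int_zero: "square_int (\<lambda>x. 0)"
  by (simp add: square_int_def)

lemma square_int_scale: "square_int f \<Longrightarrow> square_int (\<lambda>x. c * f x)"
  by (auto simp: square_int_def power_mult_distrib)

lemma square_int_mult: 
  assumes "square_int f" "square_int g" shows "integrable torus (\<lambda>x. f x * g x)"
proof (rule Bochner_Integration.integrable_bound)
  show "integrable torus (\<lambda>x. (f x)\<^sup>2 + (g x)\<^sup>2)" 
    using assms by (auto simp: square_int_def)
  show "(\<lambda>x. f x * g x) \<in> borel_measurable torus" 
    using assms by (auto simp: square_int_def)
  have "\<bar>a * b\<bar> \<le> a\<^sup>2 + b\<^sup>2" for a b :: real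
    using sum_squares_bound[of "\<bar>a\<bar>" "\<bar>b\<bar>"] zero_le_power2[of a] zero_le_power2[of b] 
    unfolding abs_mult power2_abs by linarith
  then show "AE x in torus. norm (f x * g x) \<le> norm ((f x)\<^sup>2 + (g x)\<^sup>2)"
    by simp
qed

lemma square_int_add: 
  assumes "square_int f" "square_int g" shows "square_int (\<lambda>x. f x + g x)"
proof -
  have "integrable torus (\<lambda>x. (f x)\<^sup>2 + (g x)\<^sup>2 + 2 * (f x * g x))"
    using assms square_int_mult[OF assms] by (auto simp: square_int_def)
  moreover have "(\<lambda>x. (f x)\<^sup>2 + (g x)\<^sup>2 + 2 * (f x * g x)) = (\<lambda>x. (f x + g x)\<^sup>2)"
    by (auto simp: power2_sum)
  ultimately show ?thesis using assms by (auto simp: square_int_def)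
qed

lemma square_int_uminus: "square_int f \<Longrightarrow> square_int (\<lambda>x. - f x)"
  using square_int_scale[of f "-1"] by simp

lemma square_int_diff: "square_int f \<Longrightarrow> square_int g \<Longrightarrow> square_int (\<lambda>x. f x - g x)"
  using square_int_add[OF _ square_int_uminus, of f g] by simp

lemma square_int_integrable: "square_int f \<Longrightarrow> integrable torus f"
  unfolding square_int_def
  by (blast intro: finite_measure.square_integrable_imp_integrable[OF finite_measure_torus])

quotient_type torus_L2 = "real \<Rightarrow> real" / 
  partial: "\<lambda>f g. square_int f \<and> square_int g \<and> (AE x in torus. f x = g x)"
proof (rule part_equivpI)
  show "\<exists>f. square_int f \<and> square_int f \<and> (AE x in torus. f x = f x)"
    using square_int_zero by auto
  show "symp (\<lambda>f g. square_int f \<and> square_int g \<and> (AE x in torus. f x = g x))"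
    by (intro sympI conjI) (simp_all add: eq_commute)
  show "transp (\<lambda>f g. square_int f \<and> square_int g \<and> (AE x in torus. f x = g x))"
  proof (intro transpI conjI; elim conjE)
    fix f g h :: "real \<Rightarrow> real"
    assume "AE x in torus. f x = g x" "AE x in torus. g x = h x"
    then show "AE x in torus. f x = h x" by eventually_elim simp
  qed
qed

instantiation torus_L2 :: real_inner
begin

lift_definition zero_torus_L2 :: torus_L2 is "\<lambda>x. 0"
  by (simp add: square_int_zero)

lift_definition plus_torus_L2 :: "torus_L2 \<Rightarrow> torus_L2 \<Rightarrow> torus_L2" is "\<lambda>f g x. f x + g x"
  by (auto intro: square_int_add)

lift_definition minus_torus_L2 :: "torus_L2 \<Rightarrow> torus_L2 \<Rightarrow> torus_L2" is "\<lambda>f g x. f x - g x"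
  by (auto intro: square_int_diff)

lift_definition uminus_torus_L2 :: "torus_L2 \<Rightarrow> torus_L2" is "\<lambda>f x. - f x"
  by (auto intro: square_int_uminus)

lift_definition scaleR_torus_L2 :: "real \<Rightarrow> torus_L2 \<Rightarrow> torus_L2" is "\<lambda>c f x. c * f x"
  by (auto intro: square_int_scale)

lift_definition inner_torus_L2 :: "torus_L2 \<Rightarrow> torus_L2 \<Rightarrow> real" is
  "\<lambda>f g. \<integral>x. f x * g x \<partial>torus"
  by (rule integral_cong_AE) (auto simp: square_int_def)

definition norm_torus_L2 :: "torus_L2 \<Rightarrow> real" where
  "norm_torus_L2 f = sqrt (inner f f)"

definition sgn_torus_L2 :: "torus_L2 \<Rightarrow> torus_L2" where
  "sgn_torus_L2 f = inverse (norm f) *\<^sub>R f"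

definition dist_torus_L2 :: "torus_L2 \<Rightarrow> torus_L2 \<Rightarrow> real" where
  "dist_torus_L2 f g = norm (f - g)"

definition uniformity_torus_L2 :: "(torus_L2 \<times> torus_L2) filter" where
  "uniformity_torus_L2 = (INF e\<in>{0<..}. principal {(x, y). dist x y < e})"

definition open_torus_L2 :: "torus_L2 set \<Rightarrow> bool" where
  "open_torus_L2 U \<longleftrightarrow> (\<forall>x\<in>U. \<forall>\<^sub>F (x', y) in uniformity. x' = x \<longrightarrow> y \<in> U)"

instance
proof
  fix f g h :: torus_L2 and a b :: real
  show "f + g + h = f + (g + h)" by transfer (auto simp: add.assoc intro: square_int_add)
  show "f + g = g + f" by transfer (auto simp: add.commute intro: square_int_add)
  show "0 + f = f" by transfer auto
  show "- f + f = 0" by transfer (auto intro: square_int_zero)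
  show "f - g = f + - g" by transfer (auto intro: square_int_diff)
  show "a *\<^sub>R (f + g) = a *\<^sub>R f + a *\<^sub>R g"
    by transfer (auto simp: algebra_simps intro!: square_int_add square_int_scale)
  show "(a + b) *\<^sub>R f = a *\<^sub>R f + b *\<^sub>R f"
    by transfer (auto simp: algebra_simps intro!: square_int_add square_int_scale)
  show "a *\<^sub>R b *\<^sub>R f = (a * b) *\<^sub>R f"
    by transfer (auto simp: algebra_simps intro: square_int_scale)
  show "1 *\<^sub>R f = f" by transfer auto
  show "inner f g = inner g f" by transfer (simp add: mult.commute)
  show "inner (f + g) h = inner f h + inner g h"
    by transfer (simp add: distrib_right square_int_mult)
  show "inner (a *\<^sub>R f) g = a * inner f g"
    by transfer (simp add: mult.assoc)
  show "0 \<le> inner f f" by transfer simp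
  show "inner f f = 0 \<longleftrightarrow> f = 0"
    by transfer (auto simp: square_int_zero integral_nonneg_eq_0_iff_AE square_int_mult)
  show "norm f = sqrt (inner f f)" by (rule norm_torus_L2_def)
  show "sgn f = inverse (norm f) *\<^sub>R f" by (rule sgn_torus_L2_def)
  show "dist f g = norm (f - g)" by (rule dist_torus_L2_def)
  show "(uniformity :: (torus_L2 \<times> torus_L2) filter) = (INF e\<in>{0<..}. principal {(x, y). dist x y < e})"
    by (rule uniformity_torus_L2_def)
  show "open U \<longleftrightarrow> (\<forall>x\<in>U. \<forall>\<^sub>F (x', y) in uniformity. x' = x \<longrightarrow> y \<in> U)" for U :: "torus_L2 set"
    by (rule open_torus_L2_def)
qed

end

lemma square_int_rep: "square_int (rep_torus_L2 F)"
  using Quotient_rep_reflp[OF Quotient_torus_L2] by blast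

lemma abs_rep_torus_L2: "abs_torus_L2 (rep_torus_L2 F) = F"
  by (rule Quotient_abs_rep[OF Quotient_torus_L2])

lemma diff_abs_torus_L2:
  "square_int f \<Longrightarrow> square_int g \<Longrightarrow>
    abs_torus_L2 f - abs_torus_L2 g = abs_torus_L2 (\<lambda>x. f x - g x)"
  by (simp add: minus_torus_L2.abs_eq)

lemma inner_abs_torus_L2:
  "square_int f \<Longrightarrow> square_int g \<Longrightarrow>
    inner (abs_torus_L2 f) (abs_torus_L2 g) = (\<integral>x. f x * g x \<partial>torus)"
  by (simp add: inner_torus_L2.abs_eq)

lemma norm_abs_torus_L2:
  assumes "square_int f"
  shows "ennreal ((norm (abs_torus_L2 f))\<^sup>2) = (\<integral>\<^sup>+x. ennreal ((f x)\<^sup>2) \<partial>torus)"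
proof -
  have "(norm (abs_torus_L2 f))\<^sup>2 = (\<integral>x. (f x)\<^sup>2 \<partial>torus)"
    unfolding power2_norm_eq_inner inner_abs_torus_L2[OF assms assms] by (simp add: power2_eq_square)
  moreover have "integrable torus (\<lambda>x. (f x)\<^sup>2)"
    using assms by (simp add: square_int_def)
  ultimately show ?thesis by (simp add: nn_integral_eq_integral)
qed

lemma L1_le_norm_torus_L2:
  assumes "square_int f"
  shows "(\<integral>x. \<bar>f x\<bar> \<partial>torus) \<le> norm (abs_torus_L2 f) * norm (abs_torus_L2 (\<lambda>x. 1))"
proof -
  have 1: "square_int (\<lambda>x. 1)"
    using finite_measure.integrable_const[OF finite_measure_torus, of "1::real"]
    by (simp add: square_int_def)
  have a: "square_int (\<lambda>x. \<bar>f x\<bar>)"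
    using assms unfolding square_int_def by (auto intro: borel_measurable_abs)
  have "(norm (abs_torus_L2 (\<lambda>x. \<bar>f x\<bar>)))\<^sup>2 = (norm (abs_torus_L2 f))\<^sup>2"
    using a assms by (simp add: power2_norm_eq_inner inner_abs_torus_L2)
  then have "norm (abs_torus_L2 (\<lambda>x. \<bar>f x\<bar>)) = norm (abs_torus_L2 f)" by simp
  moreover have "(\<integral>x. \<bar>f x\<bar> \<partial>torus) = inner (abs_torus_L2 (\<lambda>x. \<bar>f x\<bar>)) (abs_torus_L2 (\<lambda>x. 1))"
    using a 1 by (simp add: inner_abs_torus_L2)
  ultimately show ?thesis by (metis norm_cauchy_schwarz)
qed

instance torus_L2 :: complete_space
proof
  fix X :: "nat \<Rightarrow> torus_L2" assume X: "Cauchy X"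
  have "\<exists>N. \<forall>m\<ge>N. \<forall>n\<ge>N. norm (X m - X n) < (1/2)^k" for k :: nat
    using X by (auto simp: Cauchy_iff)
  then obtain N where N: "\<And>k m n. m \<ge> N k \<Longrightarrow> n \<ge> N k \<Longrightarrow> norm (X m - X n) < (1/2)^k"
    by metis
  define r where "r = (\<lambda>k. \<Sum>i\<le>k. N i)"
  have rN: "N k \<le> r k" for k unfolding r_def by (rule member_le_sum) auto
  have rmono: "mono r" unfolding r_def by (intro monoI sum_mono2) auto
  have rN': "N k \<le> r m" if "k \<le> m" for k m
    using rN[of k] monoD[OF rmono that] by simp
  define f where "f = (\<lambda>k. rep_torus_L2 (X (r k)))"
  have sf: "square_int (f k)" for k by (simp add: f_def square_int_rep)
  have [measurable]: "f k \<in> borel_measurable torus" for k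
    by (rule square_int_measurable[OF sf])
  have absf: "abs_torus_L2 (f k) = X (r k)" for k by (simp add: f_def abs_rep_torus_L2)
  have sfd: "square_int (\<lambda>x. f m x - f k x)" for m k
    by (rule square_int_diff[OF sf sf])
  have nd: "norm (abs_torus_L2 (\<lambda>x. f m x - f k x)) < (1/2)^j" if "j \<le> m" "j \<le> k" for j m k
    using N[OF rN' rN', OF that] by (simp add: diff_abs_torus_L2[OF sf sf, symmetric] absf)
  define K where "K = norm (abs_torus_L2 (\<lambda>x. 1))"
  define D where "D = (\<lambda>k x. \<bar>f (Suc k) x - f k x\<bar>)"
  have [measurable]: "D k \<in> borel_measurable torus" for k unfolding D_def by measurable
  have intD: "integrable torus (D k)" for k
    unfolding D_def by (intro integrable_abs square_int_integrable sfd)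
  have LD: "(\<integral>x. D k x \<partial>torus) \<le> (1/2)^k * K" for k
  proof -
    have "(\<integral>x. D k x \<partial>torus) \<le> norm (abs_torus_L2 (\<lambda>x. f (Suc k) x - f k x)) * K"
      unfolding D_def K_def by (rule L1_le_norm_torus_L2[OF sfd])
    also have "\<dots> \<le> (1/2)^k * K"
      by (intro mult_right_mono less_imp_le[OF nd]) (auto simp: K_def)
    finally show ?thesis .
  qed
  have "(\<integral>\<^sup>+x. (\<Sum>k. ennreal (D k x)) \<partial>torus) = (\<Sum>k. \<integral>\<^sup>+x. ennreal (D k x) \<partial>torus)"
    by (rule nn_integral_suminf) measurable
  also have "\<dots> = (\<Sum>k. ennreal (\<integral>x. D k x \<partial>torus))"
    by (intro suminf_cong nn_integral_eq_integral intD) (simp add: D_def)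
  also have "\<dots> \<le> (\<Sum>k. ennreal ((1/2)^k * K))"
    by (intro suminf_le ennreal_leI LD) auto
  also have "\<dots> = ennreal (\<Sum>k. (1/2)^k * K)"
    by (intro suminf_ennreal2 summable_mult2 summable_geometric) (auto simp: K_def)
  also have "\<dots> < \<infinity>" by simp
  finally have "(\<integral>\<^sup>+x. (\<Sum>k. ennreal (D k x)) \<partial>torus) \<noteq> \<infinity>" by simp
  then have "AE x in torus. (\<Sum>k. ennreal (D k x)) \<noteq> \<infinity>"
    by (intro nn_integral_PInf_AE) measurable
  then have lim: "AE x in torus. (\<lambda>k. f k x) \<longlonglongrightarrow> lim (\<lambda>k. f k x)"
  proof eventually_elim
    case (elim x)
    have "summable (\<lambda>k. D k x)"
      by (rule summable_suminf_not_top) (use elim in \<open>auto simp: D_def\<close>)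
    then have "summable (\<lambda>k. f (Suc k) x - f k x)"
      unfolding D_def by (rule summable_rabs_cancel)
    then have "convergent (\<lambda>n. \<Sum>k<n. f (Suc k) x - f k x)"
      by (simp add: summable_iff_convergent)
    then have "convergent (\<lambda>n. f n x - f 0 x)"
      by (simp add: sum_lessThan_telescope[of "\<lambda>k. f k x"])
    then have "convergent (\<lambda>n. (f n x - f 0 x) + f 0 x)"
      by (intro convergent_add convergent_const)
    then show ?case by (simp add: convergent_LIMSEQ_iff)
  qed
  define g where "g = (\<lambda>x. lim (\<lambda>k. f k x))"
  have [measurable]: "g \<in> borel_measurable torus" unfolding g_def by measurable
  have gb: "(\<integral>\<^sup>+x. ennreal ((g x - f k x)\<^sup>2) \<partial>torus) \<le> ennreal (((1/2)^k)\<^sup>2)" for k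
  proof -
    have "(\<integral>\<^sup>+x. ennreal ((g x - f k x)\<^sup>2) \<partial>torus)
        = (\<integral>\<^sup>+x. liminf (\<lambda>m. ennreal ((f m x - f k x)\<^sup>2)) \<partial>torus)"
    proof (rule nn_integral_cong_AE)
      show "AE x in torus. ennreal ((g x - f k x)\<^sup>2) = liminf (\<lambda>m. ennreal ((f m x - f k x)\<^sup>2))"
        using lim
      proof eventually_elim
        case (elim x)
        then have "(\<lambda>m. ennreal ((f m x - f k x)\<^sup>2)) \<longlonglongrightarrow> ennreal ((g x - f k x)\<^sup>2)"
          unfolding g_def by (intro tendsto_ennrealI tendsto_intros)
        then show ?case by (intro lim_imp_Liminf[symmetric]) auto
      qed
    qed
    also have "\<dots> \<le> liminf (\<lambda>m. \<integral>\<^sup>+x. ennreal ((f m x - f k x)\<^sup>2) \<partial>torus)"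
      by (rule nn_integral_liminf) measurable
    also have "\<dots> \<le> ennreal (((1/2)^k)\<^sup>2)"
    proof (rule Liminf_le)
      show "\<forall>\<^sub>F m in sequentially.
          (\<integral>\<^sup>+x. ennreal ((f m x - f k x)\<^sup>2) \<partial>torus) \<le> ennreal (((1/2)^k)\<^sup>2)"
        using eventually_ge_at_top[of k]
      proof eventually_elim
        case (elim m)
        have "(norm (abs_torus_L2 (\<lambda>x. f m x - f k x)))\<^sup>2 \<le> ((1/2)^k)\<^sup>2"
          using nd[of k m k] elim by (intro power_mono) auto
        then show ?case by (simp add: norm_abs_torus_L2[OF sfd, symmetric] ennreal_leI)
      qed
    qed simp
    finally show ?thesis .
  qed
  have sgf: "square_int (\<lambda>x. g x - f k x)" for k
    unfolding square_int_def
  proof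
    show "integrable torus (\<lambda>x. (g x - f k x)\<^sup>2)"
      using gb[of k] by (intro integrableI_bounded) (auto simp: le_less_trans)
  qed measurable
  have sg: "square_int g" using square_int_add[OF sgf[of 0] sf[of 0]] by simp
  have dist: "norm (abs_torus_L2 g - X (r k)) \<le> (1/2)^k" for k
  proof -
    have "ennreal ((norm (abs_torus_L2 g - X (r k)))\<^sup>2) \<le> ennreal (((1/2)^k)\<^sup>2)"
      using gb[of k] by (simp add: norm_abs_torus_L2[OF sgf, symmetric]
          diff_abs_torus_L2[OF sg sf, symmetric] absf)
    then have "(norm (abs_torus_L2 g - X (r k)))\<^sup>2 \<le> ((1/2)^k)\<^sup>2"
      by (subst (asm) ennreal_le_iff) auto
    then show ?thesis by (rule power2_le_imp_le) auto
  qed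
  have "X \<longlonglongrightarrow> abs_torus_L2 g"
  proof (rule LIMSEQ_I)
    fix e :: real assume "e > 0"
    then obtain k where k: "(1/2)^k < e / 2"
      using real_arch_pow_inv[of "e/2" "1/2"] by auto
    have "norm (X n - abs_torus_L2 g) < e" if "n \<ge> N k" for n
    proof -
      have "norm (X n - abs_torus_L2 g) \<le> norm (X n - X (r k)) + norm (abs_torus_L2 g - X (r k))"
        using norm_triangle_ineq4[of "X n - X (r k)" "abs_torus_L2 g - X (r k)"] by simp
      also have "\<dots> < e" using N[OF that rN[of k]] dist[of k] k by simp
      finally show ?thesis .
    qed
    then show "\<exists>no. \<forall>n\<ge>no. norm (X n - abs_torus_L2 g) < e" by blast
  qed
  then show "convergent X" by (auto simp: convergent_def)
qed


section \<open>Sobolev spaces, Fourier multipliers and pointwise operations\<close>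

lift_definition fourier :: "torus_L2 \<Rightarrow> int \<Rightarrow> complex" is
  "\<lambda>f l. complex_of_real (1 / sqrt (2 * pi)) *
     (\<integral>x. complex_of_real (f x) * exp (- (\<i> * of_int l * complex_of_real x)) \<partial>torus)"
proof (intro ext arg_cong2[where f = "(*)"] refl integral_cong_AE; elim conjE)
  fix f g :: "real \<Rightarrow> real" and l :: int
  assume *: "square_int f" "square_int g" "AE x in torus. f x = g x"
  have e: "(\<lambda>x. exp (- (\<i> * of_int l * complex_of_real x))) \<in> borel_measurable torus"
    unfolding torus_def
    by (intro measurable_restrict_space1 borel_measurable_continuous_onI continuous_intros) simp
  note [measurable] = e square_int_measurable[OF *(1)] square_int_measurable[OF *(2)]
  show "(\<lambda>x. complex_of_real (f x) * exp (- (\<i> * of_int l * complex_of_real x)))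
      \<in> borel_measurable torus"
    "(\<lambda>x. complex_of_real (g x) * exp (- (\<i> * of_int l * complex_of_real x)))
      \<in> borel_measurable torus"
    by measurable
  show "AE x in torus. complex_of_real (f x) * exp (- (\<i> * of_int l * complex_of_real x)) =
      complex_of_real (g x) * exp (- (\<i> * of_int l * complex_of_real x))"
    using *(3) by eventually_elim simp
qed

text \<open>The Sobolev spaces below are meant for \<open>s \<ge> 0\<close>, where they are subspaces of \<open>L\<^sup>2\<close>.\<close>

definition sobolev :: "real \<Rightarrow> torus_L2 set" where
  "sobolev s = {f. (\<lambda>l. (1 + (real_of_int l)\<^sup>2) powr s * (cmod (fourier f l))\<^sup>2) summable_on UNIV}"

definition sobolev_norm :: "real \<Rightarrow> torus_L2 \<Rightarrow> real" where
  "sobolev_norm s f =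
     sqrt (\<Sum>\<^sub>\<infinity>l. (1 + (real_of_int l)\<^sup>2) powr s * (cmod (fourier f l))\<^sup>2)"

text \<open>The spatial derivative of an element of \<open>sobolev 1\<close>; unspecified outside that space.\<close>

definition deriv_x :: "torus_L2 \<Rightarrow> torus_L2" where
  "deriv_x f = (THE g. \<forall>l. fourier g l = \<i> * of_int l * fourier f l)"

text \<open>The group generated by \<open>-\<partial>\<^sub>x\<^sup>3\<close>: the Fourier symbol of the generator is
  \<open>-(\<i> l)\<^sup>3 = \<i> l\<^sup>3\<close>.\<close>

definition airy :: "real \<Rightarrow> torus_L2 \<Rightarrow> torus_L2" where
  "airy t f =
     (THE g. \<forall>l. fourier g l = exp (\<i> * complex_of_real (t * (real_of_int l) ^ 3)) * fourier f l)"

text \<open>The pointwise product, with value \<open>0\<close> if it is not square-integrable; it is only applied to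
  pairs of elements of \<open>sobolev 1\<close>, whose product is again in \<open>sobolev 1\<close>.\<close>

lift_definition mult_L2 :: "torus_L2 \<Rightarrow> torus_L2 \<Rightarrow> torus_L2" (infixl "\<odot>" 70) is
  "\<lambda>f g. if square_int (\<lambda>x. f x * g x) then (\<lambda>x. f x * g x) else (\<lambda>x. 0)"
proof (elim conjE)
  fix f f' g g' :: "real \<Rightarrow> real"
  assume *: "square_int f" "square_int f'" "AE x in torus. f x = f' x"
    "square_int g" "square_int g'" "AE x in torus. g x = g' x"
  note [measurable] = *(1,2,4,5)[THEN square_int_measurable]
  have ae: "AE x in torus. f x * g x = f' x * g' x"
    using *(3,6) by eventually_elim simp
  have "integrable torus (\<lambda>x. (f x * g x)\<^sup>2) \<longleftrightarrow> integrable torus (\<lambda>x. (f' x * g' x)\<^sup>2)"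
    using ae by (intro integrable_cong_AE) (auto elim!: eventually_mono)
  then have "square_int (\<lambda>x. f x * g x) \<longleftrightarrow> square_int (\<lambda>x. f' x * g' x)"
    by (simp add: square_int_def)
  with ae show "square_int (if square_int (\<lambda>x. f x * g x) then \<lambda>x. f x * g x else (\<lambda>x. 0)) \<and>
      square_int (if square_int (\<lambda>x. f' x * g' x) then \<lambda>x. f' x * g' x else (\<lambda>x. 0)) \<and>
      (AE x in torus. (if square_int (\<lambda>x. f x * g x) then \<lambda>x. f x * g x else (\<lambda>x. 0)) x =
        (if square_int (\<lambda>x. f' x * g' x) then \<lambda>x. f' x * g' x else (\<lambda>x. 0)) x)"
    by (simp add: square_int_zero)
qed

lift_definition linf_norm :: "torus_L2 \<Rightarrow> ennreal" is
  "\<lambda>f. esssup torus (\<lambda>x. ennreal \<bar>f x\<bar>)"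
  by (rule esssup_AE_cong) (auto simp: square_int_def elim!: eventually_mono)

text \<open>\<open>f \<in> C([0,T]; H\<^sup>s)\<close>\<close>

definition sobolev_continuous :: "real \<Rightarrow> real \<Rightarrow> (real \<Rightarrow> torus_L2) \<Rightarrow> bool" where
  "sobolev_continuous s T f \<longleftrightarrow>
     (\<forall>t\<in>{0..T}. f t \<in> sobolev s \<and>
        ((\<lambda>r. sobolev_norm s (f r - f t)) \<longlongrightarrow> 0) (at t within {0..T}))"


section \<open>Operators\<close>

definition orthonormal_basis :: "(nat \<Rightarrow> 'h::real_inner) \<Rightarrow> bool" where
  "orthonormal_basis e \<longleftrightarrow>
     (\<forall>i j. inner (e i) (e j) = (if i = j then 1 else 0)) \<and> closure (span (range e)) = UNIV"

text \<open>Hilbert--Schmidt operators from \<open>L\<^sup>2\<close> to \<open>H\<^sup>s\<close>. Neither the class nor the norm depends on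
  the orthonormal basis \<open>e\<close>.\<close>

definition hilbert_schmidt ::
  "(nat \<Rightarrow> torus_L2) \<Rightarrow> real \<Rightarrow> (torus_L2 \<Rightarrow> torus_L2) \<Rightarrow> bool" where
  "hilbert_schmidt e s A \<longleftrightarrow> linear A \<and>
     (\<exists>K. \<forall>f. A f \<in> sobolev s \<and> sobolev_norm s (A f) \<le> K * norm f) \<and>
     summable (\<lambda>k. (sobolev_norm s (A (e k)))\<^sup>2)"

definition hs_norm :: "(nat \<Rightarrow> torus_L2) \<Rightarrow> real \<Rightarrow> (torus_L2 \<Rightarrow> torus_L2) \<Rightarrow> real" where
  "hs_norm e s A = sqrt (\<Sum>k. (sobolev_norm s (A (e k)))\<^sup>2)"

definition nonneg_selfadjoint :: "('h::real_inner \<Rightarrow> 'h) \<Rightarrow> bool" where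
  "nonneg_selfadjoint A \<longleftrightarrow> bounded_linear A \<and>
     (\<forall>f g. inner (A f) g = inner f (A g)) \<and> (\<forall>f. 0 \<le> inner (A f) f)"

definition is_operator_sqrt :: "('h::real_inner \<Rightarrow> 'h) \<Rightarrow> ('h \<Rightarrow> 'h) \<Rightarrow> bool" where
  "is_operator_sqrt R Q \<longleftrightarrow> nonneg_selfadjoint R \<and> R \<circ> R = Q"


section \<open>Cylindrical Wiener processes and stochastic integrals of deterministic integrands\<close>

text \<open>The index set of the library's filtrations is a whole type; only the members with index
  \<open>\<ge> 0\<close> are relevant here.\<close>

definition complete_filtered_prob_space :: "'w measure \<Rightarrow> (real \<Rightarrow> 'w measure) \<Rightarrow> bool" where
  "complete_filtered_prob_space M F \<longleftrightarrow>
     prob_space M \<and> complete_measure M \<and> filtration (space M) F \<and>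
     (\<forall>t. sets (F t) \<subseteq> sets M) \<and> null_sets M \<subseteq> sets (F 0)"

text \<open>\<open>\<beta> k\<close> are the coordinates of \<open>W = \<Sum>\<^sub>k \<beta>\<^sub>k e\<^sub>k\<close>. Independence from the past is
  required of the whole sequence of increments and not only of each coordinate.\<close>

definition cylindrical_wiener ::
  "'w measure \<Rightarrow> (real \<Rightarrow> 'w measure) \<Rightarrow> (nat \<Rightarrow> real \<Rightarrow> 'w \<Rightarrow> real) \<Rightarrow> bool" where
  "cylindrical_wiener M F \<beta> \<longleftrightarrow>
     (\<forall>k. \<forall>t\<ge>0. \<beta> k t \<in> borel_measurable (F t)) \<and>
     (\<forall>k. AE \<omega> in M. \<beta> k 0 \<omega> = 0 \<and> continuous_on {0..} (\<lambda>t. \<beta> k t \<omega>)) \<and>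
     (\<forall>k s t. 0 \<le> s \<longrightarrow> s < t \<longrightarrow>
        distributed M lborel (\<lambda>\<omega>. \<beta> k t \<omega> - \<beta> k s \<omega>) (normal_density 0 (sqrt (t - s)))) \<and>
     (\<forall>s t. 0 \<le> s \<longrightarrow> s \<le> t \<longrightarrow>
        prob_space.indep_set M (sets (F s))
          {(\<lambda>\<omega> k. \<beta> k t \<omega> - \<beta> k s \<omega>) -` B \<inter> space M |B. B \<in> sets (\<Pi>\<^sub>M k\<in>UNIV. borel)}) \<and>
     prob_space.indep_vars M (\<lambda>k. \<Pi>\<^sub>M t\<in>{0..}. borel) (\<lambda>k \<omega>. \<lambda>t\<in>{0..}. \<beta> k t \<omega>) UNIV"

text \<open>\<open>X = A (W b - W a) = \<Sum>\<^sub>k (\<beta>\<^sub>k b - \<beta>\<^sub>k a) A e\<^sub>k\<close>, the series converging in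
  \<open>L\<^sup>2(\<Omega>; L\<^sup>2)\<close>.\<close>

definition is_noise_increment ::
  "'w measure \<Rightarrow> (nat \<Rightarrow> real \<Rightarrow> 'w \<Rightarrow> real) \<Rightarrow> (nat \<Rightarrow> torus_L2) \<Rightarrow> (torus_L2 \<Rightarrow> torus_L2) \<Rightarrow>
    real \<Rightarrow> real \<Rightarrow> ('w \<Rightarrow> torus_L2) \<Rightarrow> bool" where
  "is_noise_increment M \<beta> e A a b X \<longleftrightarrow> X \<in> borel_measurable M \<and>
     (\<lambda>N. \<integral>\<^sup>+\<omega>. ennreal ((norm (X \<omega> - (\<Sum>k<N. (\<beta> k b \<omega> - \<beta> k a \<omega>) *\<^sub>R A (e k))))\<^sup>2) \<partial>M)
       \<longlonglongrightarrow> 0"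

text \<open>The step integrand with value \<open>A j\<close> on \<open>(\<tau> j, \<tau> (j+1)]\<close> for \<open>j < m\<close>, and its integral
  \<open>\<Sum>\<^sub>j A\<^sub>j (W (\<tau> (j+1)) - W (\<tau> j))\<close>.\<close>

definition step_integrand ::
  "nat \<Rightarrow> (nat \<Rightarrow> real) \<Rightarrow> (nat \<Rightarrow> torus_L2 \<Rightarrow> torus_L2) \<Rightarrow> real \<Rightarrow> torus_L2 \<Rightarrow> torus_L2" where
  "step_integrand m \<tau> A s f = (\<Sum>j<m. indicator {\<tau> j<..\<tau> (Suc j)} s *\<^sub>R A j f)"

definition is_step_integral ::
  "'w measure \<Rightarrow> (nat \<Rightarrow> real \<Rightarrow> 'w \<Rightarrow> real) \<Rightarrow> (nat \<Rightarrow> torus_L2) \<Rightarrow>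
    nat \<Rightarrow> (nat \<Rightarrow> real) \<Rightarrow> (nat \<Rightarrow> torus_L2 \<Rightarrow> torus_L2) \<Rightarrow> ('w \<Rightarrow> torus_L2) \<Rightarrow> bool" where
  "is_step_integral M \<beta> e m \<tau> A Y \<longleftrightarrow>
     (\<exists>X. (\<forall>j<m. is_noise_increment M \<beta> e (A j) (\<tau> j) (\<tau> (Suc j)) (X j)) \<and>
          Y = (\<lambda>\<omega>. \<Sum>j<m. X j \<omega>))"

text \<open>\<open>Z = \<integral>\<^sub>0\<^sup>t \<Phi> s dW s\<close> for a deterministic \<open>\<Phi>\<close> with values in the Hilbert--Schmidt operators
  on \<open>L\<^sup>2\<close>: the \<open>L\<^sup>2(\<Omega>; L\<^sup>2)\<close>-limit of the integrals of step integrands that approximate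
  \<open>\<Phi>\<close> in \<open>L\<^sup>2\<close> of \<open>[0,t]\<close> with respect to the Hilbert--Schmidt norm. By the Ito isometry it does
  not depend, up to null sets, on the approximating sequence.\<close>

definition is_stoch_integral ::
  "'w measure \<Rightarrow> (nat \<Rightarrow> real \<Rightarrow> 'w \<Rightarrow> real) \<Rightarrow> (nat \<Rightarrow> torus_L2) \<Rightarrow> real \<Rightarrow>
    (real \<Rightarrow> torus_L2 \<Rightarrow> torus_L2) \<Rightarrow> ('w \<Rightarrow> torus_L2) \<Rightarrow> bool" where
  "is_stoch_integral M \<beta> e t \<Phi> Z \<longleftrightarrow>
     Z \<in> borel_measurable M \<and>
     (\<forall>s\<in>{0..t}. hilbert_schmidt e 0 (\<Phi> s)) \<and>
     (\<exists>(m :: nat \<Rightarrow> nat) \<tau> A Y.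
        (\<forall>n. \<tau> n 0 = 0 \<and> \<tau> n (m n) = t \<and>
             (\<forall>j<m n. \<tau> n j \<le> \<tau> n (Suc j) \<and> hilbert_schmidt e 0 (A n j)) \<and>
             is_step_integral M \<beta> e (m n) (\<tau> n) (A n) (Y n)) \<and>
        (\<lambda>n. \<integral>\<^sup>+s\<in>{0..t}.
           ennreal ((hs_norm e 0 (\<lambda>f. \<Phi> s f - step_integrand (m n) (\<tau> n) (A n) s f))\<^sup>2)
           \<partial>lborel) \<longlonglongrightarrow> 0 \<and>
        (\<lambda>n. \<integral>\<^sup>+\<omega>. ennreal ((norm (Z \<omega> - Y n \<omega>))\<^sup>2) \<partial>M) \<longlonglongrightarrow> 0)"

text \<open>An arbitrary but fixed version of the integral; the equations below only use it up to null
  sets.\<close>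

definition stoch_integral ::
  "'w measure \<Rightarrow> (nat \<Rightarrow> real \<Rightarrow> 'w \<Rightarrow> real) \<Rightarrow> (nat \<Rightarrow> torus_L2) \<Rightarrow> real \<Rightarrow>
    (real \<Rightarrow> torus_L2 \<Rightarrow> torus_L2) \<Rightarrow> 'w \<Rightarrow> torus_L2" where
  "stoch_integral M \<beta> e t \<Phi> = (SOME Z. is_stoch_integral M \<beta> e t \<Phi> Z)"


section \<open>The equations\<close>

text \<open>The integrals in time are Henstock--Kurzweil integrals with values in the Hilbert space
  \<open>torus_L2\<close>; their integrands are continuous (almost surely) on \<open>[0,t]\<close>.\<close>

definition kdv_solution ::
  "real \<Rightarrow> real \<Rightarrow> real \<Rightarrow> torus_L2 \<Rightarrow> (real \<Rightarrow> torus_L2) \<Rightarrow> bool" where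
  "kdv_solution \<sigma> T \<mu> \<xi> \<psi> \<longleftrightarrow> sobolev_continuous \<sigma> T \<psi> \<and>
     (\<forall>t\<in>{0..T}. \<psi> t = airy t \<xi> +
        \<mu> *\<^sub>R integral {0..t} (\<lambda>s. airy (t - s) (deriv_x (\<psi> s \<odot> \<psi> s))))"

definition stoch_kdv_mild_solution ::
  "'w measure \<Rightarrow> (real \<Rightarrow> 'w measure) \<Rightarrow> (nat \<Rightarrow> real \<Rightarrow> 'w \<Rightarrow> real) \<Rightarrow> (nat \<Rightarrow> torus_L2) \<Rightarrow>
    (torus_L2 \<Rightarrow> torus_L2) \<Rightarrow> real \<Rightarrow> real \<Rightarrow> real \<Rightarrow> torus_L2 \<Rightarrow>
    (real \<Rightarrow> 'w \<Rightarrow> torus_L2) \<Rightarrow> bool" where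
  "stoch_kdv_mild_solution M F \<beta> e R T \<mu> \<epsilon> \<xi> u \<longleftrightarrow>
     (\<forall>t\<in>{0..T}. u t \<in> borel_measurable (F t)) \<and>
     (AE \<omega> in M. sobolev_continuous 1 T (\<lambda>t. u t \<omega>)) \<and>
     (\<forall>t\<in>{0..T}. AE \<omega> in M. u t \<omega> = airy t \<xi> +
        \<mu> *\<^sub>R integral {0..t} (\<lambda>s. airy (t - s) (deriv_x (u s \<omega> \<odot> u s \<omega>))) +
        \<epsilon> *\<^sub>R stoch_integral M \<beta> e t (\<lambda>s f. airy (t - s) (R f)) \<omega>)"

definition linearized_mild_solution ::
  "'w measure \<Rightarrow> (real \<Rightarrow> 'w measure) \<Rightarrow> (nat \<Rightarrow> real \<Rightarrow> 'w \<Rightarrow> real) \<Rightarrow> (nat \<Rightarrow> torus_L2) \<Rightarrow>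
    (torus_L2 \<Rightarrow> torus_L2) \<Rightarrow> real \<Rightarrow> real \<Rightarrow> (real \<Rightarrow> torus_L2) \<Rightarrow>
    (real \<Rightarrow> 'w \<Rightarrow> torus_L2) \<Rightarrow> bool" where
  "linearized_mild_solution M F \<beta> e R T \<mu> \<psi> chi \<longleftrightarrow>
     (\<forall>t\<in>{0..T}. chi t \<in> borel_measurable (F t)) \<and>
     (AE \<omega> in M. sobolev_continuous 1 T (\<lambda>t. chi t \<omega>)) \<and>
     (\<forall>t\<in>{0..T}. AE \<omega> in M. chi t \<omega> =
        (2 * \<mu>) *\<^sub>R integral {0..t} (\<lambda>s. airy (t - s) (deriv_x (\<psi> s \<odot> chi s \<omega>))) +
        stoch_integral M \<beta> e t (\<lambda>s f. airy (t - s) (R f)) \<omega>)"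

definition fluctuation ::
  "real \<Rightarrow> (real \<Rightarrow> 'w \<Rightarrow> torus_L2) \<Rightarrow> (real \<Rightarrow> torus_L2) \<Rightarrow> real \<Rightarrow> 'w \<Rightarrow> torus_L2" where
  "fluctuation \<epsilon> u \<psi> t \<omega> = (1 / \<epsilon>) *\<^sub>R (u t \<omega> - \<psi> t)"

text \<open>\<open>\<parallel>Y\<parallel>\<close> in \<open>L\<^sup>p(\<Omega>; X)\<close> with values in \<open>[0,\<infinity>]\<close>, where \<open>N\<close> is the norm of \<open>X\<close>.\<close>

definition Lp_norm :: "'w measure \<Rightarrow> nat \<Rightarrow> ('x \<Rightarrow> real) \<Rightarrow> ('w \<Rightarrow> 'x) \<Rightarrow> ennreal" where
  "Lp_norm M p N Y =
     (let I = \<integral>\<^sup>+\<omega>. ennreal (N (Y \<omega>) ^ p) \<partial>M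
      in if I = \<infinity> then \<infinity> else ennreal (root p (enn2real I)))"

end

theory Submission
  imports Defs
begin

text \<open>The stochastic integral is a version chosen separately for each time: it carries no path
  continuity, and the exceptional null set of a mild equation depends on the time. Only after the
  noise has cancelled do both sides consist of continuous terms, so the passage to all times has to
  come after the subtraction. The energy identity is not computed on v, whose third derivative need
  not lie in L^2, but on \<open>airy (- t) (v t)\<close>. This path is differentiable in L^2 with
  derivative \<open>airy (- t) (g t)\<close>, where g collects the first-order terms, and these lie
  in L^2 because H^1 is an algebra. The H^2 regularity of psi bounds psi_x through the embedding of
  H^1 into bounded functions. Constants: the sum of 1/(1 + l^2) is at most 5 <= 3^2, giving the
  embedding constant 3; the two terms of the product rule give 6; Young's inequality gives 36 = 6^2
  and adds 1 to the Gronwall rate. Since \<open>deriv_x\<close> and \<open>airy\<close> are definite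
  descriptions in terms of Fourier coefficients, every computation with them rests on uniqueness of
  coefficients and on the existence of functions with prescribed ones.\<close>

text \<open>The difference \<open>v = u\<^sup>\<epsilon> - \<chi>\<close> contains no stochastic integral: almost surely it is the mild
  solution of \<open>v' = - v\<^sub>x\<^sub>x\<^sub>x + 2 \<mu> (\<psi> v)\<^sub>x + \<mu> \<epsilon> ((u\<^sup>\<epsilon>)\<^sup>2)\<^sub>x\<close>, first for a countable dense set of times
  and then, by continuity, for all times. The Airy group is isometric, and integration by parts
  gives \<open>2 \<langle>v, (\<psi> v)\<^sub>x\<rangle> = \<langle>v, \<psi>\<^sub>x v\<rangle>\<close>. So \<open>\<parallel>v\<parallel>\<^sup>2\<close> satisfies a Gronwall inequality whose source term is a
  multiple of \<open>\<mu>\<^sup>2 \<epsilon>\<^sup>2 \<parallel>u\<^sup>\<epsilon>\<parallel>\<^sup>4\<close> in the \<open>H\<^sup>1\<close> norm, because \<open>H\<^sup>1\<close> is an algebra. The \<open>p\<close>-th moment of the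
  resulting bound is controlled by the moments of order \<open>8 p\<close> of \<open>u\<^sup>\<epsilon>\<close>.\<close>

section \<open>Uniqueness of Fourier coefficients\<close>

text \<open>Completeness makes continuous \<open>torus_L2\<close>-valued functions integrable over
  intervals, as the mild formulations require.\<close>

instance torus_L2 :: banach ..

lemma space_torus [simp]: "space torus = {-pi..pi}"
  by (simp add: torus_def space_restrict_space)

lemma borel_measurable_torus: "f \<in> borel_measurable borel \<Longrightarrow> f \<in> borel_measurable torus"
  unfolding torus_def by (rule measurable_restrict_space1) simp

lemma borel_measurable_torus_continuous:
  fixes f :: "real \<Rightarrow> 'a::topological_space"
  shows "continuous_on UNIV f \<Longrightarrow> f \<in> borel_measurable torus"
  by (intro borel_measurable_torus borel_measurable_continuous_onI)

lemma integrable_torus_mult_bounded: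
  fixes f g :: "real \<Rightarrow> 'a::{real_normed_algebra, banach, second_countable_topology}"
  assumes "integrable torus f" and "g \<in> borel_measurable torus" and "AE x in torus. norm (g x) \<le> K"
  shows "integrable torus (\<lambda>x. f x * g x)"
proof (rule Bochner_Integration.integrable_bound[of _ "\<lambda>x. norm (f x) * K"])
  show "AE x in torus. norm (f x * g x) \<le> norm (norm (f x) * K)"
    using assms(3)
  proof eventually_elim
    case (elim x)
    have "norm (f x * g x) \<le> norm (f x) * norm (g x)" by (rule norm_mult_ineq)
    also have "\<dots> \<le> norm (f x) * K" using elim by (intro mult_left_mono) auto
    finally show ?case by (simp add: order_trans[OF _ abs_ge_self])
  qed
qed (use assms in auto)

text \<open>The unnormalised coefficient of a representative. It makes sense for every integrable
  function, and integrability is all that the uniqueness argument uses.\<close>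

definition fourier_integral :: "(real \<Rightarrow> real) \<Rightarrow> int \<Rightarrow> complex" where
  "fourier_integral f l = (\<integral>x. complex_of_real (f x) * exp (- (\<i> * of_int l * complex_of_real x)) \<partial>torus)"

lemma integrable_fourier_integral:
  assumes "integrable torus f"
  shows "integrable torus (\<lambda>x. complex_of_real (f x) * exp (- (\<i> * of_int l * complex_of_real x)))"
proof (rule integrable_torus_mult_bounded[where K = 1])
  show "integrable torus (\<lambda>x. complex_of_real (f x))" using assms by simp
  show "(\<lambda>x. exp (- (\<i> * of_int l * complex_of_real x))) \<in> borel_measurable torus"
    by (intro borel_measurable_torus_continuous continuous_intros)
qed simp

lemma integrable_torus_mult_continuous:
  fixes f g :: "real \<Rightarrow> real"
  assumes "integrable torus f" "continuous_on UNIV g"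
  shows "integrable torus (\<lambda>x. f x * g x)"
proof -
  have "compact (g ` {-pi..pi})"
    by (intro compact_continuous_image continuous_on_subset[OF assms(2)]) auto
  then obtain K where K: "\<And>x. x \<in> {-pi..pi} \<Longrightarrow> norm (g x) \<le> K"
    using compact_imp_bounded bounded_iff by (metis image_eqI)
  show ?thesis
    by (rule integrable_torus_mult_bounded[OF assms(1), of _ K])
      (use K in \<open>auto intro!: borel_measurable_torus_continuous assms AE_I2\<close>)
qed

text \<open>Euler's formula turns the factor into two shifts of the frequency, so the vanishing of
  all coefficients survives multiplication by cosine and, in the next lemma, by sine.\<close>

lemma fourier_integral_mult_cos:
  assumes "integrable torus f"
  shows "fourier_integral (\<lambda>x. f x * cos x) l = (fourier_integral f (l - 1) + fourier_integral f (l + 1)) / 2"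
proof -
  have *: "complex_of_real (f x * cos x) * exp (- (\<i> * of_int l * complex_of_real x)) =
     (complex_of_real (f x) * exp (- (\<i> * of_int (l - 1) * complex_of_real x)) +
      complex_of_real (f x) * exp (- (\<i> * of_int (l + 1) * complex_of_real x))) / 2" for x
    by (simp add: cos_of_real[symmetric] cos_exp_eq algebra_simps exp_add[symmetric] exp_diff)
  show ?thesis
    unfolding fourier_integral_def *
    using integrable_fourier_integral[OF assms, of "l - 1"] integrable_fourier_integral[OF assms, of "l + 1"]
    by simp
qed

lemma fourier_integral_mult_sin:
  assumes "integrable torus f"
  shows "fourier_integral (\<lambda>x. f x * sin x) l = (fourier_integral f (l - 1) - fourier_integral f (l + 1)) / (2 * \<i>)"
proof -
  have *: "complex_of_real (f x * sin x) * exp (- (\<i> * of_int l * complex_of_real x)) =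
     (complex_of_real (f x) * exp (- (\<i> * of_int (l - 1) * complex_of_real x)) -
      complex_of_real (f x) * exp (- (\<i> * of_int (l + 1) * complex_of_real x))) / (2 * \<i>)" for x
    by (simp add: sin_of_real[symmetric] sin_exp_eq algebra_simps exp_add[symmetric] exp_diff)
  show ?thesis
    unfolding fourier_integral_def *
    using integrable_fourier_integral[OF assms, of "l - 1"] integrable_fourier_integral[OF assms, of "l + 1"]
    by simp
qed

text \<open>The functions \<open>f\<close> without Fourier coefficients form a module over the polynomials in
  \<open>cos x\<close> and \<open>sin x\<close>, which reduces uniqueness to the Stone--Weierstrass theorem on the circle.\<close>

lemma fourier_integral_mult_polynomial:
  assumes "real_polynomial_function p" "integrable torus f" "\<And>l. fourier_integral f l = 0"
  shows "integrable torus (\<lambda>x. f x * p (cis x)) \<and> (\<forall>l. fourier_integral (\<lambda>x. f x * p (cis x)) l = 0)"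
  using assms
proof (induction p arbitrary: f rule: real_polynomial_function.induct)
  case (linear p)
  interpret p: bounded_linear p by fact
  \<comment> \<open>A real-linear functional on the plane is determined by its values at 1 and
    \<open>\<i>\<close>, so along the circle it is a combination of cosine and sine.\<close>
  have eq: "f x * p (cis x) = (f x * cos x) * p 1 + (f x * sin x) * p \<i>" for x
  proof -
    have "p (cis x) = p (cos x *\<^sub>R 1 + sin x *\<^sub>R \<i>)"
      by (rule arg_cong[of _ _ p]) (simp add: complex_eq_iff)
    then show ?thesis by (simp add: p.add p.scaleR algebra_simps)
  qed
  have int: "integrable torus (\<lambda>x. f x * cos x)" "integrable torus (\<lambda>x. f x * sin x)"
    by (intro integrable_torus_mult_continuous linear continuous_intros)+
  have "fourier_integral (\<lambda>x. f x * p (cis x)) l = 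
     fourier_integral (\<lambda>x. f x * cos x) l * p 1 + fourier_integral (\<lambda>x. f x * sin x) l * p \<i>" for l
  proof -
    have "complex_of_real (f x * p (cis x)) * exp (- (\<i> * of_int l * complex_of_real x)) = 
      complex_of_real (f x * cos x) * exp (- (\<i> * of_int l * complex_of_real x)) * p 1 +
      complex_of_real (f x * sin x) * exp (- (\<i> * of_int l * complex_of_real x)) * p \<i>" for x
      unfolding eq by (simp add: algebra_simps)
    then show ?thesis
      unfolding fourier_integral_def
      using integrable_fourier_integral[OF int(1)] integrable_fourier_integral[OF int(2)]
      by (simp del: of_real_mult)
  qed
  then show ?case
    using int linear by (auto simp: eq fourier_integral_mult_cos fourier_integral_mult_sin)
next
  case (const c)
  have "fourier_integral (\<lambda>x. f x * c) l = fourier_integral f l * c" for l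
  proof -
    have *: "complex_of_real (f x * c) * exp (- (\<i> * of_int l * complex_of_real x)) = 
      complex_of_real (f x) * exp (- (\<i> * of_int l * complex_of_real x)) * c" for x by simp
    show ?thesis unfolding fourier_integral_def * by (rule integral_mult_left_zero)
  qed
  with const show ?case by auto
next
  case (add p q)
  note int = add.IH(1)[OF add.prems, THEN conjunct1] add.IH(2)[OF add.prems, THEN conjunct1]
  have "fourier_integral (\<lambda>x. f x * (p (cis x) + q (cis x))) l = 
     fourier_integral (\<lambda>x. f x * p (cis x)) l + fourier_integral (\<lambda>x. f x * q (cis x)) l" for l
  proof -
    have "complex_of_real (f x * (p (cis x) + q (cis x))) * exp (- (\<i> * of_int l * complex_of_real x)) = 
      complex_of_real (f x * p (cis x)) * exp (- (\<i> * of_int l * complex_of_real x)) +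
      complex_of_real (f x * q (cis x)) * exp (- (\<i> * of_int l * complex_of_real x))" for x
      by (simp add: algebra_simps)
    then show ?thesis
      unfolding fourier_integral_def
      using integrable_fourier_integral[OF int(1)] integrable_fourier_integral[OF int(2)]
      by (simp del: of_real_mult)
  qed
  with add.IH(1)[OF add.prems] add.IH(2)[OF add.prems] show ?case 
    by (auto simp: distrib_left)
next
  case (mult p q)
  \<comment> \<open>The hypothesis for \<open>q\<close> is applied to \<open>f x * p (cis x)\<close>
    in place of \<open>f\<close>; this is why the induction generalizes over
    \<open>f\<close>.\<close>
  have "integrable torus (\<lambda>x. f x * p (cis x))" "fourier_integral (\<lambda>x. f x * p (cis x)) l = 0" for l
    using mult.IH(1)[OF mult.prems] by auto
  from mult.IH(2)[OF this] show ?case by (simp add: mult.assoc)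
qed

text \<open>Against a polynomial the integral is a coefficient of index 0 and vanishes; a polynomial
  uniformly close to \<open>\<phi>\<close> on the circle changes the integral only by a small
  multiple of the L^1 norm of \<open>f\<close>.\<close>

lemma integral_torus_mult_circle_eq_0:
  fixes \<phi> :: "complex \<Rightarrow> real"
  assumes f: "integrable torus f" "\<And>l. fourier_integral f l = 0" and \<phi>: "continuous_on UNIV \<phi>"
  shows "(\<integral>x. f x * \<phi> (cis x) \<partial>torus) = 0"
proof (rule ccontr)
  define I where "I = (\<integral>x. f x * \<phi> (cis x) \<partial>torus)"
  define N where "N = (\<integral>x. \<bar>f x\<bar> \<partial>torus)"
  assume "(\<integral>x. f x * \<phi> (cis x) \<partial>torus) \<noteq> 0"
  then have I: "\<bar>I\<bar> > 0" by (simp add: I_def)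
  have N: "N \<ge> 0" by (simp add: N_def)
  \<comment> \<open>Chosen so that the approximation error \<open>e * N\<close> is at most half of
    the supposedly nonzero integral; the summand 1 covers \<open>N = 0\<close>.\<close>
  define e where "e = \<bar>I\<bar> / (2 * (N + 1))"
  have e: "e > 0" using I N by (simp add: e_def)
  have "compact (sphere (0::complex) 1)" by simp
  from Stone_Weierstrass_real_polynomial_function[OF this _ e, of \<phi>] \<phi>
  obtain g where g: "real_polynomial_function g" "\<And>x. x \<in> sphere 0 1 \<Longrightarrow> \<bar>\<phi> x - g x\<bar> < e"
    by (metis continuous_on_subset subset_UNIV)
  note * = fourier_integral_mult_polynomial[OF g(1) f]
  have "complex_of_real (\<integral>x. f x * g (cis x) \<partial>torus) = fourier_integral (\<lambda>x. f x * g (cis x)) 0"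
    by (simp add: fourier_integral_def flip: of_real_mult)
  then have 0: "(\<integral>x. f x * g (cis x) \<partial>torus) = 0" using * by simp
  have int: "integrable torus (\<lambda>x. f x * \<phi> (cis x))"
    by (intro integrable_torus_mult_continuous f continuous_on_compose2[OF \<phi>] continuous_intros) auto
  have "I = (\<integral>x. f x * \<phi> (cis x) - f x * g (cis x) \<partial>torus)"
    using int * 0 by (simp add: I_def)
  also have "\<bar>\<dots>\<bar> \<le> (\<integral>x. \<bar>f x * \<phi> (cis x) - f x * g (cis x)\<bar> \<partial>torus)"
    by (rule integral_abs_bound)
  also have "\<dots> \<le> (\<integral>x. e * \<bar>f x\<bar> \<partial>torus)"
  proof (rule integral_mono)
    fix x
    have "\<bar>\<phi> (cis x) - g (cis x)\<bar> \<le> e" using g(2)[of "cis x"] by simp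
    then have "\<bar>f x\<bar> * \<bar>\<phi> (cis x) - g (cis x)\<bar> \<le> \<bar>f x\<bar> * e" by (intro mult_left_mono) auto
    then show "\<bar>f x * \<phi> (cis x) - f x * g (cis x)\<bar> \<le> e * \<bar>f x\<bar>"
      by (simp add: abs_mult[symmetric] algebra_simps)
  qed (use int * f in auto)
  also have "\<dots> = e * N" by (simp add: N_def)
  also have "\<dots> \<le> e * (N + 1)" using e by simp
  also have "\<dots> = \<bar>I\<bar> / 2" using N by (simp add: e_def field_simps)
  finally show False using I by simp
qed

text \<open>The endpoints -pi and pi have the same image, so one of the two points must be
  interior.\<close>

lemma cis_inj_on_torus: "cis x = cis y \<Longrightarrow> x \<in> {-pi<..<pi} \<Longrightarrow> y \<in> {-pi..pi} \<Longrightarrow> x = y"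
proof -
  assume *: "cis x = cis y" "x \<in> {-pi<..<pi}" "y \<in> {-pi..pi}"
  have "cis (x - y) = 1" using *(1) by (simp add: cis_divide[symmetric])
  then have "cos (x - y) = 1" by (metis cis.sel(1) one_complex.sel(1))
  then obtain n :: int where n: "x - y = n * 2 * pi" by (auto simp: cos_one_2pi_int)
  have "\<bar>x - y\<bar> < 2 * pi" using * by auto
  then have "\<bar>real_of_int n\<bar> < 1" unfolding n by (simp add: abs_mult)
  then have "n = 0" by linarith
  then show "x = y" using n by simp
qed

text \<open>Half-lines are wanted because they determine a measure. Their indicators become, up to
  finitely many points, indicators of closed arcs, which are limits of continuous functions on the
  circle.\<close>

lemma set_integral_torus_greaterThan_eq_0:
  assumes f: "integrable torus f" "\<And>l. fourier_integral f l = 0"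
  shows "(\<integral>x. f x * indicator {y<..} x \<partial>torus) = 0"
proof (cases "y < pi")
  case False
  have "(\<integral>x. f x * indicator {y<..} x \<partial>torus) = (\<integral>x. 0 \<partial>torus)"
    using False by (intro Bochner_Integration.integral_cong) auto
  then show ?thesis by simp
next
  case True
  \<comment> \<open>The maximum handles \<open>y\<close> to the left of the torus, where the arc is
    the whole circle.\<close>
  define C where "C = cis ` {max y (-pi)..pi}"
  have "compact C" unfolding C_def by (intro compact_continuous_image continuous_intros) auto
  then have C: "closed C" "C \<noteq> {}" using True by (auto simp: compact_imp_closed C_def)
  \<comment> \<open>Equal to 1 on the arc and to 0 at distance \<open>1 / n\<close> or more; since
    the arc is closed, the limit is exactly its indicator.\<close>
  define \<phi> where "\<phi> = (\<lambda>n z. max 0 (1 - real n * infdist z C))"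
  have \<phi>: "continuous_on UNIV (\<phi> n)" for n
    unfolding \<phi>_def by (intro continuous_intros)
  have \<phi>b: "\<bar>\<phi> n z\<bar> \<le> 1" for n z
    by (auto simp: \<phi>_def infdist_nonneg)
  have [measurable]: "f \<in> borel_measurable torus" using f by auto
  have [measurable]: "(\<lambda>x. \<phi> n (cis x)) \<in> borel_measurable torus" for n
    by (intro borel_measurable_torus_continuous continuous_on_compose2[OF \<phi>] continuous_intros) auto
  have [measurable]: "(\<lambda>x. indicator {y<..} x :: real) \<in> borel_measurable torus"
    by (intro borel_measurable_torus) simp
  have lim: "(\<lambda>n. \<phi> n z) \<longlonglongrightarrow> indicator C z" for z
  proof (cases "z \<in> C")
    case True
    then show ?thesis by (simp add: \<phi>_def)
  next
    case False
    then have d: "infdist z C > 0" using C by (metis in_closed_iff_infdist_zero infdist_nonneg less_le)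
    obtain N where N: "1 / infdist z C < real N" using reals_Archimedean2 by blast
    have "\<phi> n z = 0" if "n \<ge> N" for n
    proof -
      have "1 / infdist z C < real n" using N that by linarith
      then show ?thesis using d by (simp add: \<phi>_def field_simps)
    qed
    then have "eventually (\<lambda>n. \<phi> n z = 0) sequentially" by (auto simp: eventually_sequentially)
    then show ?thesis using False by (simp add: tendsto_eventually)
  qed
  \<comment> \<open>The excluded points are the two endpoints, which \<open>cis\<close> identifies,
    and \<open>y\<close>, which belongs to the closed arc but not to the open half-line.\<close>
  have "AE x in lborel. x \<notin> {-pi, pi, y}"
    by (rule AE_not_in) (auto intro: finite_imp_null_set_lborel)
  then have ind: "AE x in torus. (indicator C (cis x) :: real) = indicator {y<..} x"
    unfolding torus_def
  proof (subst AE_restrict_space_iff, simp, eventually_elim)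
    case (elim x)
    show ?case
    proof
      assume "x \<in> {-pi..pi}"
      then have x: "x \<in> {-pi<..<pi}" using elim by auto
      have "cis x \<in> C \<longleftrightarrow> y < x"
        unfolding C_def using x elim cis_inj_on_torus[OF _ x] by (auto simp: image_iff)
      then show "(indicator C (cis x) :: real) = indicator {y<..} x" by (simp add: indicator_def)
    qed
  qed
  have "(\<lambda>n. \<integral>x. f x * \<phi> n (cis x) \<partial>torus) \<longlonglongrightarrow> (\<integral>x. f x * indicator {y<..} x \<partial>torus)"
  proof (rule integral_dominated_convergence[where w = "\<lambda>x. \<bar>f x\<bar>"])
    show "AE x in torus. (\<lambda>n. f x * \<phi> n (cis x)) \<longlonglongrightarrow> f x * indicator {y<..} x"
      using ind
    proof eventually_elim
      case (elim x)
      show ?case using tendsto_mult[OF tendsto_const lim[of "cis x"], of "f x"] elim by simp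
    qed
    show "AE x in torus. norm (f x * \<phi> n (cis x)) \<le> \<bar>f x\<bar>" for n
      using \<phi>b mult_left_mono[OF \<phi>b, of "\<bar>f _\<bar>"] by (auto simp: abs_mult)
  qed (use f in auto)
  moreover have "(\<integral>x. f x * \<phi> n (cis x) \<partial>torus) = 0" for n
    by (rule integral_torus_mult_circle_eq_0[OF f \<phi>])
  ultimately show ?thesis by (simp add: LIMSEQ_const_iff)
qed

text \<open>Since \<open>ennreal\<close> cuts negative values to 0, \<open>F\<close> and
  \<open>- F\<close> become the densities of the positive and negative parts. Both measures give
  each half-line the same finite mass, so they coincide, and uniqueness of densities makes the two
  parts equal almost everywhere.\<close>

lemma fourier_integral_eq_0_imp_AE:
  assumes f: "integrable torus f" "\<And>l. fourier_integral f l = 0"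
  shows "AE x in torus. f x = 0"
proof -
  define F where "F = (\<lambda>x. indicator {-pi..pi} x * f x)"
  have F: "integrable lborel F"
    using f(1) unfolding torus_def F_def by (subst (asm) integrable_restrict_space) auto
  have [measurable]: "F \<in> borel_measurable borel" using F by auto
  have half: "(\<integral>x. F x * indicator {y<..} x \<partial>lborel) = 0" for y
    using set_integral_torus_greaterThan_eq_0[OF f, of y] unfolding torus_def F_def 
    by (subst (asm) integral_restrict_space) (auto simp: mult.assoc)
  have int: "integrable lborel (\<lambda>x. F x * indicator {y<..} x)" for y
    using integrable_mult_indicator[OF _ F, of "{y<..}"] by (simp add: mult.commute)
  have fin: "(\<integral>\<^sup>+ x. ennreal (F x * indicator {y<..} x) \<partial>lborel) < \<infinity>"
      "(\<integral>\<^sup>+ x. ennreal (- (F x * indicator {y<..} x)) \<partial>lborel) < \<infinity>" for y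
    using int[of y] by (auto simp: real_integrable_def less_top)
  have eq: "(\<integral>\<^sup>+ x. ennreal (F x * indicator {y<..} x) \<partial>lborel) =
      (\<integral>\<^sup>+ x. ennreal (- (F x * indicator {y<..} x)) \<partial>lborel)" for y
    using half[of y] fin[of y] unfolding real_lebesgue_integral_def[OF int]
    by (metis ennreal_enn2real infinity_ennreal_def eq_iff_diff_eq_0)
  have ind: "ennreal (G x) * indicator A x = ennreal (G x * indicator A x)"
      "ennreal (- G x) * indicator A x = ennreal (- (G x * indicator A x))"
    for G :: "real \<Rightarrow> real" and A x
    by (simp_all add: indicator_def)
  have "density lborel (\<lambda>x. ennreal (F x)) = density lborel (\<lambda>x. ennreal (- F x))"
    by (rule measure_eqI_lessThan) (use fin eq in \<open>simp_all add: emeasure_density ind\<close>)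
  then have "AE x in lborel. ennreal (F x) = ennreal (- F x)"
    by (intro sigma_finite_measure.density_unique[OF sigma_finite_lborel]) auto
  then have "AE x in lborel. x \<in> {-pi..pi} \<longrightarrow> f x = 0"
  proof eventually_elim
    case (elim x)
    then show ?case
      by (cases "f x" "0::real" rule: linorder_cases) (auto simp: F_def ennreal_eq_0_iff ennreal_neg split: split_indicator_asm)
  qed
  then show ?thesis unfolding torus_def by (subst AE_restrict_space_iff) auto
qed

section \<open>Fourier coefficients of classes of functions\<close>

lemma fourier_abs: "square_int f \<Longrightarrow>
    fourier (abs_torus_L2 f) l = complex_of_real (1 / sqrt (2 * pi)) * fourier_integral f l"
  by (simp add: fourier.abs_eq fourier_integral_def)

lemma torus_L2_cases:
  obtains f where "F = abs_torus_L2 f" "square_int f"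
  by (rule that[OF abs_rep_torus_L2[symmetric] square_int_rep])

lemma abs_torus_L2_eq_iff:
  "square_int f \<Longrightarrow> square_int g \<Longrightarrow> abs_torus_L2 f = abs_torus_L2 g \<longleftrightarrow> (AE x in torus. f x = g x)"
  using Quotient_rel[OF Quotient_torus_L2, of f g] by auto

lemma add_abs_torus_L2:
  "square_int f \<Longrightarrow> square_int g \<Longrightarrow>
    abs_torus_L2 f + abs_torus_L2 g = abs_torus_L2 (\<lambda>x. f x + g x)"
  by (simp add: plus_torus_L2.abs_eq)

lemma scaleR_abs_torus_L2:
  "square_int f \<Longrightarrow> c *\<^sub>R abs_torus_L2 f = abs_torus_L2 (\<lambda>x. c * f x)"
  by (simp add: scaleR_torus_L2.abs_eq)

lemma fourier_add: "fourier (F + G) l = fourier F l + fourier G l"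
proof -
  obtain f where f: "F = abs_torus_L2 f" "square_int f" by (rule torus_L2_cases)
  obtain g where g: "G = abs_torus_L2 g" "square_int g" by (rule torus_L2_cases)
  note * = f g
  show ?thesis
    using integrable_fourier_integral[OF square_int_integrable[OF *(2)], of l]
      integrable_fourier_integral[OF square_int_integrable[OF *(4)], of l]
    by (simp add: * add_abs_torus_L2 fourier_abs square_int_add fourier_integral_def distrib_right
        add_divide_distrib)
qed

lemma fourier_scaleR: "fourier (c *\<^sub>R F) l = c *\<^sub>R fourier F l"
proof -
  obtain f where *: "F = abs_torus_L2 f" "square_int f"
    by (rule torus_L2_cases)
  show ?thesis
    by (simp add: * scaleR_abs_torus_L2 fourier_abs square_int_scale fourier_integral_def mult.assoc
        scaleR_conv_of_real)
qed

lemma linear_fourier: "linear (\<lambda>F. fourier F l)"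
  by (intro linearI) (auto simp: fourier_add fourier_scaleR)

lemmas fourier_diff = linear_diff[OF linear_fourier]
  and fourier_sum = linear_sum[OF linear_fourier]

lemma fourier_uminus_index: "fourier F (- l) = cnj (fourier F l)"
proof -
  obtain f where *: "F = abs_torus_L2 f" "square_int f" by (rule torus_L2_cases)
  have "cnj (fourier_integral f l) = fourier_integral f (- l)"
    unfolding fourier_integral_def by (subst Bochner_Integration.integral_cnj[symmetric]) (simp add: exp_cnj)
  then show ?thesis using * by (simp add: fourier_abs)
qed

text \<open>The injectivity behind the definite descriptions \<open>deriv_x\<close> and
  \<open>airy\<close>, and the standard way below to prove identities in
  \<open>torus_L2\<close>.\<close>

lemma fourier_eqI:
  assumes "\<And>l. fourier F l = fourier G l" shows "F = G"
proof -
  obtain f where f: "F - G = abs_torus_L2 f" "square_int f" by (rule torus_L2_cases)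
  have "fourier_integral f l = 0" for l
  proof -
    have "fourier (abs_torus_L2 f) l = 0" unfolding f(1)[symmetric] by (simp add: fourier_diff assms)
    then show ?thesis by (simp add: fourier_abs f)
  qed
  then have "AE x in torus. f x = 0"
    by (intro fourier_integral_eq_0_imp_AE square_int_integrable f)
  then have "abs_torus_L2 f = abs_torus_L2 (\<lambda>x. 0)"
    by (subst abs_torus_L2_eq_iff) (auto simp: f square_int_zero)
  then have "F - G = 0" using f(1) zero_torus_L2_def by simp
  then show ?thesis by simp
qed

section \<open>Fourier modes\<close>

text \<open>Since \<open>torus_L2\<close> contains only real functions, real parts of exponentials
  take the place of the complex orthonormal basis.\<close>

definition mode_fun :: "int \<Rightarrow> complex \<Rightarrow> real \<Rightarrow> real" where
  "mode_fun l c x = Re (c * exp (\<i> * of_int l * complex_of_real x)) / sqrt (2 * pi)"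

definition mode :: "int \<Rightarrow> complex \<Rightarrow> torus_L2" where
  "mode l c = abs_torus_L2 (mode_fun l c)"

lemma continuous_mode_fun: "continuous_on UNIV (mode_fun l c)"
  unfolding mode_fun_def[abs_def] by (intro continuous_intros) auto

lemma square_int_continuous:
  assumes "continuous_on UNIV f" shows "square_int f"
  unfolding square_int_def
proof
  show "f \<in> borel_measurable torus" by (rule borel_measurable_torus_continuous[OF assms])
  have "integrable torus (\<lambda>x. 1 * (f x)\<^sup>2)"
    using finite_measure.integrable_const[OF finite_measure_torus, of "1::real"]
    by (intro integrable_torus_mult_continuous continuous_intros assms)
  then show "integrable torus (\<lambda>x. (f x)\<^sup>2)" by simp
qed

lemma square_int_mode_fun: "square_int (mode_fun l c)"
  by (intro square_int_continuous continuous_mode_fun)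

lemma abs_mode_fun_le: "\<bar>mode_fun l c x\<bar> \<le> cmod c / sqrt (2 * pi)"
proof -
  have "\<bar>Re (c * exp (\<i> * of_int l * complex_of_real x))\<bar> \<le> cmod (c * exp (\<i> * of_int l * complex_of_real x))"
    by (rule abs_Re_le_cmod)
  also have "\<dots> = cmod c" by (simp add: norm_mult)
  finally show ?thesis by (simp add: mode_fun_def divide_right_mono)
qed

lemma inner_mode: "inner F (mode l c) = Re (c * cnj (fourier F l))"
proof -
  obtain f where *: "F = abs_torus_L2 f" "square_int f" by (rule torus_L2_cases)
  note int = integrable_fourier_integral[OF square_int_integrable[OF *(2)]]
  have "inner F (mode l c) = (\<integral>x. f x * mode_fun l c x \<partial>torus)"
    by (simp add: * mode_def inner_abs_torus_L2 square_int_mode_fun)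
  also have "\<dots> = (\<integral>x. Re (c / sqrt (2 * pi) * (complex_of_real (f x) * exp (- (\<i> * of_int (-l) * complex_of_real x)))) \<partial>torus)"
    by (intro Bochner_Integration.integral_cong) (auto simp: mode_fun_def algebra_simps Re_divide_of_real)
  also have "\<dots> = Re (\<integral>x. c / sqrt (2 * pi) * (complex_of_real (f x) * exp (- (\<i> * of_int (-l) * complex_of_real x))) \<partial>torus)"
    by (intro integral_Re integrable_mult_right int)
  also have "\<dots> = Re (c * fourier F (- l))"
    by (simp add: * fourier_abs fourier_integral_def)
  finally show ?thesis by (simp add: fourier_uminus_index)
qed

lemma integral_torus_exp:
  "(\<integral>x. exp (\<i> * of_int l * complex_of_real x) \<partial>torus) = (if l = 0 then complex_of_real (2 * pi) else 0)"
proof (cases "l = 0")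
  case True
  then show ?thesis
    by (simp add: measure_def torus_def emeasure_restrict_space space_restrict_space scaleR_conv_of_real)
next
  case False
  let ?F = "\<lambda>x. exp (\<i> * of_int l * complex_of_real x) / (\<i> * of_int l)"
  have "(\<integral>x. indicator {-pi..pi} x *\<^sub>R exp (\<i> * of_int l * complex_of_real x) \<partial>lborel) = ?F pi - ?F (-pi)"
  proof (rule integral_FTC_Icc)
    show "(?F has_vector_derivative exp (\<i> * of_int l * complex_of_real x)) (at x within {-pi..pi})" for x
    proof -
      have "((\<lambda>z. exp (\<i> * of_int l * z) / (\<i> * of_int l)) has_field_derivative exp (\<i> * of_int l * of_real x)) (at (of_real x))"
        using False by (auto intro!: derivative_eq_intros)
      then show ?thesis by (rule has_vector_derivative_real_field)
    qed
  qed (auto intro!: continuous_intros)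
  also have "\<dots> = (exp (\<i> * of_int l * of_real pi) - exp (- (\<i> * of_int l * of_real pi))) / (\<i> * of_int l)"
    by (simp add: diff_divide_distrib)
  also have "\<dots> = 2 * \<i> * sin (of_int l * of_real pi) / (\<i> * of_int l)"
  proof -
    have "exp (\<i> * z) - exp (- (\<i> * z)) = 2 * \<i> * sin z" for z :: complex
      by (simp add: sin_exp_eq field_simps)
    then show ?thesis by (simp only: mult.assoc)
  qed
  also have "sin (of_int l * complex_of_real pi) = 0"
  proof -
    have "sin (of_int l * complex_of_real pi) = complex_of_real (sin (pi * real_of_int l))"
      by (simp only: sin_of_real[symmetric] of_real_mult of_real_of_int_eq mult.commute)
    then show ?thesis by (simp add: sin_npi_int)
  qed
  finally show ?thesis
    using False unfolding torus_def by (subst integral_restrict_space) auto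
qed

text \<open>Taking the real part splits \<open>c\<close> evenly between the frequencies
  \<open>l\<close> and \<open>- l\<close>. The two conditionals are added, so for
  \<open>l = 0\<close> they combine to the real part of \<open>c\<close>.\<close>

lemma fourier_mode:
  "fourier (mode l c) k = (if k = l then c / 2 else 0) + (if k = - l then cnj c / 2 else 0)"
proof -
  have e: "integrable torus (\<lambda>x. exp (\<i> * of_int j * complex_of_real x))" for j
    using integrable_fourier_integral[of "\<lambda>_. 1" "- j"]
      finite_measure.integrable_const[OF finite_measure_torus, of "1::real"] by simp
  have *: "complex_of_real (mode_fun l c x) * exp (- (\<i> * of_int k * complex_of_real x)) =
     c / (2 * sqrt (2 * pi)) * exp (\<i> * of_int (l - k) * complex_of_real x) +
     cnj c / (2 * sqrt (2 * pi)) * exp (\<i> * of_int (- l - k) * complex_of_real x)" for x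
  proof -
    have Re: "complex_of_real (Re z) = (z + cnj z) / 2" for z
      by (simp add: complex_eq_iff)
    have "complex_of_real (mode_fun l c x) = 
      (c * exp (\<i> * of_int l * complex_of_real x) + cnj c * exp (- (\<i> * of_int l * complex_of_real x))) / (2 * sqrt (2 * pi))"
      unfolding mode_fun_def of_real_divide Re by (simp add: exp_cnj)
    moreover have "exp (\<i> * of_int l * complex_of_real x) * exp (- (\<i> * of_int k * complex_of_real x)) =
        exp (\<i> * of_int (l - k) * complex_of_real x)"
      "exp (- (\<i> * of_int l * complex_of_real x)) * exp (- (\<i> * of_int k * complex_of_real x)) =
        exp (\<i> * of_int (- l - k) * complex_of_real x)"
      unfolding exp_add[symmetric] by (rule arg_cong[of _ _ exp], simp add: algebra_simps)+
    ultimately show ?thesis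
      by (simp only: times_divide_eq_left distrib_right add_divide_distrib mult.assoc)
  qed
  have s: "complex_of_real (sqrt (2 * pi)) * complex_of_real (sqrt (2 * pi)) = complex_of_real (2 * pi)"
    unfolding of_real_mult[symmetric] by simp
  define q where "q = complex_of_real (sqrt (2 * pi))"
  have q: "q \<noteq> 0" by (simp add: q_def)
  have s: "complex_of_real (2 * pi) = q * q"
    unfolding q_def of_real_mult[symmetric] by simp
  have "fourier_integral (mode_fun l c) k = 
     c / (2 * q) * (if l - k = 0 then q * q else 0) +
     cnj c / (2 * q) * (if - l - k = 0 then q * q else 0)"
    unfolding fourier_integral_def * q_def[symmetric] s[symmetric] integral_torus_exp[symmetric]
    using e[of "l - k"] e[of "- l - k"]
    by (subst Bochner_Integration.integral_add) (simp_all add: q_def del: of_int_diff of_int_minus)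
  then have "fourier (mode l c) k = 1 / q * (c / (2 * q) * (if l - k = 0 then q * q else 0) +
     cnj c / (2 * q) * (if - l - k = 0 then q * q else 0))"
    by (simp add: mode_def fourier_abs square_int_mode_fun q_def)
  also have "\<dots> = (if k = l then c / 2 else 0) + (if k = - l then cnj c / 2 else 0)"
    using q by (auto simp: field_simps)
  finally show ?thesis .
qed

section \<open>Parseval's identity and the Riesz--Fischer theorem\<close>

text \<open>The symmetry of the coefficients of real functions; it is what a sequence or a
  multiplier needs to produce an element of \<open>torus_L2\<close>.\<close>

definition hermitian :: "(int \<Rightarrow> complex) \<Rightarrow> bool" where
  "hermitian a \<longleftrightarrow> (\<forall>l. a (- l) = cnj (a l))"

definition trig_sum :: "nat \<Rightarrow> (int \<Rightarrow> complex) \<Rightarrow> torus_L2" where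
  "trig_sum n a = (\<Sum>l\<in>{-int n..int n}. mode l (a l))"

lemma hermitian_fourier: "hermitian (fourier F)"
  by (simp add: hermitian_def fourier_uminus_index)

lemma hermitian_mult: "hermitian a \<Longrightarrow> hermitian b \<Longrightarrow> hermitian (\<lambda>l. a l * b l)"
  by (simp add: hermitian_def)

text \<open>Frequency \<open>k\<close> receives one half from the mode of index \<open>k\<close> and
  one half from that of index \<open>- k\<close>; the symmetry of \<open>a\<close> makes them
  equal.\<close>

lemma fourier_trig_sum:
  assumes "hermitian a"
  shows "fourier (trig_sum n a) k = (if k \<in> {-int n..int n} then a k else 0)"
proof -
  have "fourier (trig_sum n a) k = (\<Sum>l\<in>{-int n..int n}. if k = l then a l / 2 else 0) +
      (\<Sum>l\<in>{-int n..int n}. if - k = l then cnj (a l) / 2 else 0)"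
    unfolding trig_sum_def fourier_sum fourier_mode sum.distrib[symmetric]
    by (intro sum.cong refl arg_cong2[where f = "(+)"] if_cong) auto
  also have "\<dots> = (if k \<in> {-int n..int n} then a k else 0)"
    using assms by (auto simp: hermitian_def)
  finally show ?thesis .
qed

lemma inner_trig_sum: "inner F (trig_sum n a) = (\<Sum>l\<in>{-int n..int n}. Re (a l * cnj (fourier F l)))"
  by (simp add: trig_sum_def inner_sum_right inner_mode)

lemma Re_mult_cnj_self: "Re (z * cnj z) = (cmod z)\<^sup>2"
  unfolding cmod_power2 by (simp add: power2_eq_square)

lemma norm_trig_sum:
  assumes "hermitian a"
  shows "(norm (trig_sum n a))\<^sup>2 = (\<Sum>l\<in>{-int n..int n}. (cmod (a l))\<^sup>2)"
  unfolding power2_norm_eq_inner[of "trig_sum n a"] inner_trig_sum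
  by (intro sum.cong) (auto simp: fourier_trig_sum[OF assms] Re_mult_cnj_self simp del: times_complex.sel)

text \<open>Pythagoras for the orthogonal projection onto the frequencies up to \<open>n\<close>;
  nonnegativity of the left side is Bessel's inequality.\<close>

lemma norm_diff_trig_sum:
  "(norm (F - trig_sum n (fourier F)))\<^sup>2 = (norm F)\<^sup>2 - (\<Sum>l\<in>{-int n..int n}. (cmod (fourier F l))\<^sup>2)"
proof -
  have "inner F (trig_sum n (fourier F)) = (\<Sum>l\<in>{-int n..int n}. (cmod (fourier F l))\<^sup>2)"
    unfolding inner_trig_sum Re_mult_cnj_self ..
  moreover have "(norm (trig_sum n (fourier F)))\<^sup>2 = (\<Sum>l\<in>{-int n..int n}. (cmod (fourier F l))\<^sup>2)"
    by (rule norm_trig_sum[OF hermitian_fourier])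
  ultimately show ?thesis
    by (simp add: power2_norm_eq_inner inner_diff_left inner_diff_right inner_commute)
qed

lemma sum_fourier_le: "(\<Sum>l\<in>{-int n..int n}. (cmod (fourier F l))\<^sup>2) \<le> (norm F)\<^sup>2"
  using norm_diff_trig_sum[of F n] zero_le_power2[of "norm (F - trig_sum n (fourier F))"] by linarith

lemma cmod_fourier_le: "cmod (fourier F l) \<le> norm F"
proof -
  have "(cmod (fourier F l))\<^sup>2 \<le> (\<Sum>l\<in>{-int (nat \<bar>l\<bar>)..int (nat \<bar>l\<bar>)}. (cmod (fourier F l))\<^sup>2)"
    by (rule member_le_sum) auto
  also have "\<dots> \<le> (norm F)\<^sup>2" by (rule sum_fourier_le)
  finally show ?thesis by (rule power2_le_imp_le) simp
qed

lemma bounded_linear_fourier: "bounded_linear (\<lambda>F. fourier F l)"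
  by (rule bounded_linear_intro[where K = 1])
    (auto simp: fourier_add fourier_scaleR cmod_fourier_le)

lemmas tendsto_fourier = bounded_linear.tendsto[OF bounded_linear_fourier]

text \<open>Every finite set of integers is eventually covered by symmetric intervals. This lets the
  unordered sums in \<open>sobolev_norm\<close> be computed as limits of symmetric partial
  sums.\<close>

lemma filterlim_int_intervals:
  "filterlim (\<lambda>n. {-int n..int n}) (finite_subsets_at_top UNIV) sequentially"
  unfolding filterlim_finite_subsets_at_top
proof (intro allI impI)
  fix X :: "int set" assume X: "finite X \<and> X \<subseteq> UNIV"
  define N where "N = nat (Max (insert 0 (abs ` X)))"
  have "X \<subseteq> {-int n..int n}" if "n \<ge> N" for n
  proof
    fix x assume "x \<in> X"
    then have "\<bar>x\<bar> \<le> Max (insert 0 (abs ` X))" using X by (intro Max_ge) auto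
    also have "\<dots> \<le> int n" using that unfolding N_def by linarith
    finally show "x \<in> {-int n..int n}" by auto
  qed
  then show "\<forall>\<^sub>F n in sequentially. finite {-int n..int n} \<and> X \<subseteq> {-int n..int n} \<and> {-int n..int n} \<subseteq> UNIV"
    by (auto simp: eventually_sequentially)
qed

lemma has_sum_imp_LIMSEQ_int:
  "(f has_sum s) UNIV \<Longrightarrow> (\<lambda>n. \<Sum>l\<in>{-int n..int n}. f l) \<longlonglongrightarrow> s"
  unfolding has_sum_def by (rule filterlim_compose[OF _ filterlim_int_intervals])

lemma summable_on_int_bounded:
  fixes f :: "int \<Rightarrow> real"
  assumes nonneg: "\<And>l. f l \<ge> 0" and bounded: "\<And>n. (\<Sum>l\<in>{-int n..int n}. f l) \<le> B"
  shows "f summable_on UNIV"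
proof (rule nonneg_bdd_above_summable_on)
  show "bdd_above (sum f ` {F. F \<subseteq> UNIV \<and> finite F})"
  proof (rule bdd_aboveI2)
    fix X :: "int set" assume "X \<in> {F. F \<subseteq> UNIV \<and> finite F}"
    then have "\<forall>\<^sub>F n in sequentially. X \<subseteq> {-int n..int n}"
      using filterlim_int_intervals unfolding filterlim_finite_subsets_at_top by auto
    then obtain n where "X \<subseteq> {-int n..int n}" by (auto simp: eventually_sequentially)
    then have "sum f X \<le> (\<Sum>l\<in>{-int n..int n}. f l)"
      by (intro sum_mono2) (auto simp: nonneg)
    also have "\<dots> \<le> B" by (rule bounded)
    finally show "sum f X \<le> B" .
  qed
qed (use nonneg in auto)

text \<open>By orthogonality the squared distance of two partial sums is a difference of partial
  sums of the scalar series, so completeness provides a limit; single coefficients are continuous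
  and eventually constant along the sequence.\<close>

lemma riesz_fischer:
  assumes a: "hermitian a" and s: "(\<lambda>l. (cmod (a l))\<^sup>2) summable_on UNIV"
  obtains F where "\<And>l. fourier F l = a l" "(\<lambda>n. trig_sum n a) \<longlonglongrightarrow> F"
proof -
  define S where "S = (\<lambda>n. \<Sum>l\<in>{-int n..int n}. (cmod (a l))\<^sup>2)"
  have "S \<longlonglongrightarrow> infsum (\<lambda>l. (cmod (a l))\<^sup>2) UNIV"
    unfolding S_def by (intro has_sum_imp_LIMSEQ_int has_sum_infsum s)
  then have "Cauchy S" by (rule LIMSEQ_imp_Cauchy)
  have diff: "(norm (trig_sum m a - trig_sum n a))\<^sup>2 = S m - S n" if "n \<le> m" for m n
  proof -
    \<comment> \<open>The tail of \<open>a\<close>: its trigonometric sum is the difference of the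
      two partial sums, whose norm is then explicit.\<close>
    define b where "b = (\<lambda>l. if l \<in> {-int n..int n} then 0 else a l)"
    have b: "hermitian b" using a by (auto simp: hermitian_def b_def)
    have "trig_sum m a - trig_sum n a = trig_sum m b"
      by (rule fourier_eqI) (use that in \<open>auto simp: fourier_diff fourier_trig_sum[OF a] fourier_trig_sum[OF b], auto simp: b_def\<close>)
    then have "(norm (trig_sum m a - trig_sum n a))\<^sup>2 = (\<Sum>l\<in>{-int m..int m}. (cmod (b l))\<^sup>2)"
      by (simp add: norm_trig_sum b)
    also have "\<dots> = (\<Sum>l\<in>{-int m..int m} - {-int n..int n}. (cmod (a l))\<^sup>2)"
      by (rule sum.mono_neutral_cong_right) (auto simp: b_def)
    also have "\<dots> = S m - S n"
      unfolding S_def by (rule sum_diff) (use that in auto)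
    finally show ?thesis .
  qed
  have "Cauchy (\<lambda>n. trig_sum n a)"
  proof (rule metric_CauchyI)
    fix e :: real assume e: "e > 0"
    then obtain N where N: "\<And>m n. m \<ge> N \<Longrightarrow> n \<ge> N \<Longrightarrow> dist (S m) (S n) < e\<^sup>2"
      using metric_CauchyD[OF \<open>Cauchy S\<close>, of "e\<^sup>2"] by auto
    have *: "dist (trig_sum m a) (trig_sum n a) < e" if "m \<ge> N" "n \<ge> N" "n \<le> m" for m n
    proof -
      have "(dist (trig_sum m a) (trig_sum n a))\<^sup>2 < e\<^sup>2"
        using N[OF that(1,2)] diff[OF that(3)] by (simp add: dist_norm)
      then show ?thesis using e by (simp add: power2_less_imp_less)
    qed
    have "dist (trig_sum m a) (trig_sum n a) < e" if "m \<ge> N" "n \<ge> N" for m n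
      using *[of m n] *[of n m] that by (cases "n \<le> m") (auto simp: dist_commute)
    then show "\<exists>M. \<forall>m\<ge>M. \<forall>n\<ge>M. dist (trig_sum m a) (trig_sum n a) < e" by blast
  qed
  then obtain F where F: "(\<lambda>n. trig_sum n a) \<longlonglongrightarrow> F"
    using Cauchy_convergent convergent_def by blast
  have "fourier F l = a l" for l
  proof (rule LIMSEQ_unique)
    show "(\<lambda>n. fourier (trig_sum n a) l) \<longlonglongrightarrow> fourier F l" by (rule tendsto_fourier[OF F])
    have "fourier (trig_sum n a) l = a l" if "n \<ge> nat \<bar>l\<bar>" for n
      using that by (auto simp: fourier_trig_sum[OF a])
    then have "\<forall>\<^sub>F n in sequentially. fourier (trig_sum n a) l = a l"
      unfolding eventually_sequentially by blast
    then show "(\<lambda>n. fourier (trig_sum n a) l) \<longlonglongrightarrow> a l" by (rule tendsto_eventually)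
  qed
  with F show ?thesis using that by blast
qed

lemma summable_fourier: "(\<lambda>l. (cmod (fourier F l))\<^sup>2) summable_on UNIV"
  by (rule summable_on_int_bounded[OF _ sum_fourier_le]) simp

text \<open>Riesz--Fischer supplies some limit with the coefficients of \<open>F\<close>, and
  uniqueness identifies it with \<open>F\<close>. This is the completeness of the trigonometric
  system, from which Parseval's identity follows by continuity.\<close>

lemma trig_sum_fourier_tendsto: "(\<lambda>n. trig_sum n (fourier F)) \<longlonglongrightarrow> F"
proof -
  obtain G where G: "\<And>l. fourier G l = fourier F l" "(\<lambda>n. trig_sum n (fourier F)) \<longlonglongrightarrow> G"
    by (rule riesz_fischer[OF hermitian_fourier[of F] summable_fourier]) blast
  then show ?thesis using fourier_eqI by metis
qed

lemma parseval_inner: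
  "(\<lambda>n. \<Sum>l\<in>{-int n..int n}. Re (fourier G l * cnj (fourier F l))) \<longlonglongrightarrow> inner F G"
  unfolding inner_trig_sum[symmetric] by (intro tendsto_inner tendsto_const trig_sum_fourier_tendsto)

lemma parseval: "infsum (\<lambda>l. (cmod (fourier F l))\<^sup>2) UNIV = (norm F)\<^sup>2"
proof (rule LIMSEQ_unique)
  show "(\<lambda>n. \<Sum>l\<in>{-int n..int n}. (cmod (fourier F l))\<^sup>2) \<longlonglongrightarrow> infsum (\<lambda>l. (cmod (fourier F l))\<^sup>2) UNIV"
    by (intro has_sum_imp_LIMSEQ_int has_sum_infsum summable_fourier)
  show "(\<lambda>n. \<Sum>l\<in>{-int n..int n}. (cmod (fourier F l))\<^sup>2) \<longlonglongrightarrow> (norm F)\<^sup>2"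
    unfolding norm_trig_sum[OF hermitian_fourier, symmetric]
    by (intro tendsto_power tendsto_norm trig_sum_fourier_tendsto)
qed

section \<open>Fourier multipliers\<close>

text \<open>The common form of \<open>deriv_x\<close>, \<open>airy\<close> and the Bessel potential
  below, so that existence and uniqueness are settled once.\<close>

definition multiplier :: "(int \<Rightarrow> complex) \<Rightarrow> torus_L2 \<Rightarrow> torus_L2" where
  "multiplier m F = (THE G. \<forall>l. fourier G l = m l * fourier F l)"

lemma multiplier_eqI:
  assumes "\<And>l. fourier G l = m l * fourier F l" shows "multiplier m F = G"
  unfolding multiplier_def
proof (rule the_equality)
  show "H = G" if "\<forall>l. fourier H l = m l * fourier F l" for H
    by (rule fourier_eqI) (use that assms in simp)
qed (use assms in blast)

lemma fourier_multiplier: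
  assumes "hermitian m" "(\<lambda>l. (cmod (m l * fourier F l))\<^sup>2) summable_on UNIV"
  shows "fourier (multiplier m F) l = m l * fourier F l"
proof -
  obtain G where "\<And>l. fourier G l = m l * fourier F l"
    by (rule riesz_fischer[OF hermitian_mult[OF assms(1) hermitian_fourier] assms(2)]) blast
  then show ?thesis by (simp add: multiplier_eqI[of G])
qed

lemma deriv_x_eq_multiplier: "deriv_x = multiplier (\<lambda>l. \<i> * of_int l)"
  by (simp add: fun_eq_iff deriv_x_def multiplier_def)

lemma airy_eq_multiplier: "airy t = multiplier (\<lambda>l. exp (\<i> * complex_of_real (t * (real_of_int l) ^ 3)))"
  by (simp add: fun_eq_iff airy_def multiplier_def)

section \<open>Sobolev spaces\<close>

definition bessel_weight :: "real \<Rightarrow> int \<Rightarrow> real" where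
  "bessel_weight s l = (1 + (real_of_int l)\<^sup>2) powr (s / 2)"

text \<open>The Bessel potential, the power s/2 of 1 minus the second derivative. It maps H^s
  isometrically into L^2 and so reduces statements about the Sobolev norm to the norm of
  \<open>torus_L2\<close>.\<close>

definition bessel :: "real \<Rightarrow> torus_L2 \<Rightarrow> torus_L2" where
  "bessel s = multiplier (\<lambda>l. complex_of_real (bessel_weight s l))"

lemma one_plus_square_pos: "0 < 1 + (real_of_int l)\<^sup>2"
  using zero_le_power2[of "real_of_int l"] by linarith

lemma bessel_weight_pos: "bessel_weight s l > 0"
  using one_plus_square_pos[of l] by (simp add: bessel_weight_def)

lemma cmod_bessel_weight:
  "(cmod (complex_of_real (bessel_weight s l) * z))\<^sup>2 = (1 + (real_of_int l)\<^sup>2) powr s * (cmod z)\<^sup>2"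
proof -
  have "(bessel_weight s l)\<^sup>2 = (1 + (real_of_int l)\<^sup>2) powr s"
    unfolding bessel_weight_def using one_plus_square_pos[of l]
    by (simp add: power2_eq_square powr_add[symmetric])
  then show ?thesis by (simp add: norm_mult power_mult_distrib)
qed

lemma fourier_bessel:
  assumes "F \<in> sobolev s"
  shows "fourier (bessel s F) l = complex_of_real (bessel_weight s l) * fourier F l"
proof -
  have "hermitian (\<lambda>l. complex_of_real (bessel_weight s l))"
    by (simp add: hermitian_def bessel_weight_def)
  then show ?thesis
    unfolding bessel_def
    by (rule fourier_multiplier) (use assms in \<open>simp add: sobolev_def cmod_bessel_weight\<close>)
qed

lemma norm_bessel: "F \<in> sobolev s \<Longrightarrow> norm (bessel s F) = sobolev_norm s F"
  unfolding sobolev_norm_def cmod_bessel_weight[symmetric] fourier_bessel[symmetric] parseval by simp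

text \<open>An L^2 function has square-summable coefficients, so exhibiting a candidate for the
  Bessel potential proves membership and identifies the potential at once.\<close>

lemma sobolevI:
  assumes "\<And>l. fourier G l = complex_of_real (bessel_weight s l) * fourier F l"
  shows "F \<in> sobolev s" "bessel s F = G"
  using summable_fourier[of G] unfolding assms cmod_bessel_weight
  by (auto simp: sobolev_def bessel_def intro: multiplier_eqI assms)

lemma
  assumes "F \<in> sobolev s" "G \<in> sobolev s"
  shows sobolev_add: "F + G \<in> sobolev s" and bessel_add: "bessel s (F + G) = bessel s F + bessel s G"
    and sobolev_diff: "F - G \<in> sobolev s" and bessel_diff: "bessel s (F - G) = bessel s F - bessel s G"
proof -
  have *: "fourier (bessel s F + bessel s G) l = complex_of_real (bessel_weight s l) * fourier (F + G) l"
    "fourier (bessel s F - bessel s G) l = complex_of_real (bessel_weight s l) * fourier (F - G) l" for l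
    by (simp_all add: fourier_add fourier_diff fourier_bessel assms algebra_simps)
  from *(1) show "F + G \<in> sobolev s" "bessel s (F + G) = bessel s F + bessel s G"
    by (rule sobolevI)+
  from *(2) show "F - G \<in> sobolev s" "bessel s (F - G) = bessel s F - bessel s G"
    by (rule sobolevI)+
qed

lemma
  assumes "F \<in> sobolev s"
  shows sobolev_scaleR: "c *\<^sub>R F \<in> sobolev s" and bessel_scaleR: "bessel s (c *\<^sub>R F) = c *\<^sub>R bessel s F"
proof -
  have "fourier (c *\<^sub>R bessel s F) l = complex_of_real (bessel_weight s l) * fourier (c *\<^sub>R F) l" for l
    by (simp add: fourier_scaleR fourier_bessel assms)
  then show "c *\<^sub>R F \<in> sobolev s" "bessel s (c *\<^sub>R F) = c *\<^sub>R bessel s F"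
    by (rule sobolevI)+
qed

lemma sobolev_norm_nonneg: "sobolev_norm s F \<ge> 0"
  by (simp add: sobolev_norm_def infsum_nonneg)

lemma sobolev_mono:
  assumes "r \<le> s" "F \<in> sobolev s"
  shows "F \<in> sobolev r" "sobolev_norm r F \<le> sobolev_norm s F"
proof -
  have le: "(1 + (real_of_int l)\<^sup>2) powr r * (cmod (fourier F l))\<^sup>2 \<le>
      (1 + (real_of_int l)\<^sup>2) powr s * (cmod (fourier F l))\<^sup>2" for l
    using assms by (intro mult_right_mono powr_mono) auto
  show r: "F \<in> sobolev r"
    using assms(2) unfolding sobolev_def mem_Collect_eq
    by (rule summable_on_comparison_test) (use le in auto)
  show "sobolev_norm r F \<le> sobolev_norm s F"
    unfolding sobolev_norm_def using assms r le
    by (intro real_sqrt_le_mono infsum_mono) (auto simp: sobolev_def)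
qed

lemma sobolev_0 [simp]: "F \<in> sobolev 0" and sobolev_norm_0 [simp]: "sobolev_norm 0 F = norm F"
proof -
  have *: "fourier F l = complex_of_real (bessel_weight 0 l) * fourier F l" for l
    using one_plus_square_pos[of l] by (simp add: bessel_weight_def)
  show "F \<in> sobolev 0" by (rule sobolevI[OF *])
  then show "sobolev_norm 0 F = norm F"
    using sobolevI(2)[OF *] norm_bessel by metis
qed

lemma deriv_x_weight_le:
  "(1 + (real_of_int l)\<^sup>2) powr s * (cmod (\<i> * of_int l * z))\<^sup>2 \<le>
   (1 + (real_of_int l)\<^sup>2) powr (s + 1) * (cmod z)\<^sup>2"
proof -
  have "(1 + (real_of_int l)\<^sup>2) powr s * (real_of_int l)\<^sup>2 \<le> (1 + (real_of_int l)\<^sup>2) powr s * (1 + (real_of_int l)\<^sup>2)"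
    by (intro mult_left_mono) auto
  also have "\<dots> = (1 + (real_of_int l)\<^sup>2) powr (s + 1)"
    using one_plus_square_pos[of l] by (simp add: powr_add)
  finally have "(1 + (real_of_int l)\<^sup>2) powr s * (real_of_int l)\<^sup>2 * (cmod z)\<^sup>2 \<le>
      (1 + (real_of_int l)\<^sup>2) powr (s + 1) * (cmod z)\<^sup>2"
    by (rule mult_right_mono) simp
  then show ?thesis by (simp add: norm_mult power_mult_distrib mult.assoc)
qed

lemma fourier_deriv_x:
  assumes "F \<in> sobolev 1" shows "fourier (deriv_x F) l = \<i> * of_int l * fourier F l"
proof -
  have "(\<lambda>l. (cmod (\<i> * of_int l * fourier F l))\<^sup>2) summable_on UNIV"
    using assms unfolding sobolev_def mem_Collect_eq
  proof (rule summable_on_comparison_test)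
    show "(cmod (\<i> * of_int l * fourier F l))\<^sup>2 \<le> (1 + (real_of_int l)\<^sup>2) powr 1 * (cmod (fourier F l))\<^sup>2" for l
      using deriv_x_weight_le[of l 0 "fourier F l"] one_plus_square_pos[of l] by simp
  qed auto
  then show ?thesis
    unfolding deriv_x_eq_multiplier by (intro fourier_multiplier) (auto simp: hermitian_def)
qed

lemma sobolev_deriv_x:
  assumes "F \<in> sobolev (s + 1)" "0 \<le> s"
  shows "deriv_x F \<in> sobolev s" "sobolev_norm s (deriv_x F) \<le> sobolev_norm (s + 1) F"
proof -
  have F: "F \<in> sobolev 1" using sobolev_mono(1)[OF _ assms(1), of 1] assms by simp
  have le: "(1 + (real_of_int l)\<^sup>2) powr s * (cmod (fourier (deriv_x F) l))\<^sup>2 \<le>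
      (1 + (real_of_int l)\<^sup>2) powr (s + 1) * (cmod (fourier F l))\<^sup>2" for l
    unfolding fourier_deriv_x[OF F] by (rule deriv_x_weight_le)
  show d: "deriv_x F \<in> sobolev s"
    using assms(1) unfolding sobolev_def mem_Collect_eq
    by (rule summable_on_comparison_test) (use le in auto)
  then show "sobolev_norm s (deriv_x F) \<le> sobolev_norm (s + 1) F"
    unfolding sobolev_norm_def using assms le
    by (intro real_sqrt_le_mono infsum_mono) (auto simp: sobolev_def)
qed

lemma norm_deriv_x_le: "F \<in> sobolev 1 \<Longrightarrow> norm (deriv_x F) \<le> sobolev_norm 1 F"
  using sobolev_deriv_x(2)[of F 0] by simp

lemma deriv_x_eqI: "(\<And>l. fourier G l = \<i> * of_int l * fourier F l) \<Longrightarrow> deriv_x F = G"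
  unfolding deriv_x_eq_multiplier by (rule multiplier_eqI)

lemma deriv_x_add: "F \<in> sobolev 1 \<Longrightarrow> G \<in> sobolev 1 \<Longrightarrow> deriv_x (F + G) = deriv_x F + deriv_x G"
  and deriv_x_diff: "F \<in> sobolev 1 \<Longrightarrow> G \<in> sobolev 1 \<Longrightarrow> deriv_x (F - G) = deriv_x F - deriv_x G"
  and deriv_x_scaleR: "F \<in> sobolev 1 \<Longrightarrow> deriv_x (c *\<^sub>R F) = c *\<^sub>R deriv_x F"
  by (rule deriv_x_eqI, simp add: fourier_add fourier_diff fourier_scaleR fourier_deriv_x algebra_simps)+

text \<open>The weight 1 + l^2 splits into the squares for \<open>F\<close> and for its weak
  derivative \<open>G\<close>. This form serves products, whose derivative is found before their
  membership in H^1 is known.\<close>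

lemma sobolev_1I:
  assumes "\<And>l. fourier G l = \<i> * of_int l * fourier F l"
  shows "F \<in> sobolev 1"
proof -
  have "(1 + (real_of_int l)\<^sup>2) powr 1 * (cmod (fourier F l))\<^sup>2 = (cmod (fourier F l))\<^sup>2 + (cmod (fourier G l))\<^sup>2" for l
    using one_plus_square_pos[of l] by (simp add: assms norm_mult power_mult_distrib algebra_simps)
  then show ?thesis
    unfolding sobolev_def by (simp add: summable_on_add summable_fourier)
qed

text \<open>The symbol is purely imaginary, which makes the terms in Parseval's identity
  antisymmetric; periodicity leaves no boundary term.\<close>

lemma inner_deriv_x:
  assumes "F \<in> sobolev 1" "G \<in> sobolev 1"
  shows "inner (deriv_x F) G = - inner F (deriv_x G)"
proof (rule LIMSEQ_unique)
  show "(\<lambda>n. \<Sum>l\<in>{-int n..int n}. Re (fourier G l * cnj (fourier (deriv_x F) l))) \<longlonglongrightarrow> inner (deriv_x F) G"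
    by (rule parseval_inner)
  have "Re (fourier G l * cnj (fourier (deriv_x F) l)) = - Re (fourier (deriv_x G) l * cnj (fourier F l))" for l
    by (simp add: fourier_deriv_x assms algebra_simps)
  then show "(\<lambda>n. \<Sum>l\<in>{-int n..int n}. Re (fourier G l * cnj (fourier (deriv_x F) l))) \<longlonglongrightarrow> - inner F (deriv_x G)"
    using tendsto_minus[OF parseval_inner[of "deriv_x G" F]] by (simp only: sum_negf)
qed

section \<open>The Airy group\<close>

lemma fourier_airy: "fourier (airy t F) l = exp (\<i> * complex_of_real (t * (real_of_int l) ^ 3)) * fourier F l"
  unfolding airy_eq_multiplier
  by (rule fourier_multiplier) (auto simp: hermitian_def exp_cnj norm_mult summable_fourier)

lemma norm_airy [simp]: "norm (airy t F) = norm F"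
proof -
  have "(norm (airy t F))\<^sup>2 = (norm F)\<^sup>2"
    unfolding parseval[symmetric] by (simp add: fourier_airy norm_mult)
  then show ?thesis by simp
qed

lemma airy_airy: "airy s (airy t F) = airy (s + t) F"
  by (rule fourier_eqI) (simp add: fourier_airy exp_add[symmetric] algebra_simps)

lemma airy_0 [simp]: "airy 0 F = F"
  by (rule fourier_eqI) (simp add: fourier_airy)

lemma bounded_linear_airy: "bounded_linear (airy t)"
  by (rule bounded_linear_intro[where K = 1])
    (auto intro!: fourier_eqI simp: fourier_airy fourier_add fourier_scaleR algebra_simps)

lemmas airy_diff = linear_diff[OF bounded_linear.linear[OF bounded_linear_airy]]
  and airy_add = linear_add[OF bounded_linear.linear[OF bounded_linear_airy]]
  and airy_scaleR = linear_scale[OF bounded_linear.linear[OF bounded_linear_airy]]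

lemma inner_airy: "inner (airy t F) (airy t G) = inner F G"
proof -
  have *: "inner F G = ((norm (F + G))\<^sup>2 - (norm F)\<^sup>2 - (norm G)\<^sup>2) / 2" for F G :: torus_L2
    by (simp add: power2_norm_eq_inner inner_add_left inner_add_right inner_commute)
  show ?thesis unfolding * airy_add[symmetric] norm_airy ..
qed

text \<open>Isometry makes the approximation by trigonometric sums uniform in time, and on such a
  sum the group changes only finitely many phases, each continuous in time.\<close>

lemma continuous_on_airy: "continuous_on UNIV (\<lambda>t. airy t F)"
proof (rule uniform_limit_theorem[where F = sequentially and f = "\<lambda>n t. airy t (trig_sum n (fourier F))"])
  show "uniform_limit UNIV (\<lambda>n t. airy t (trig_sum n (fourier F))) (\<lambda>t. airy t F) sequentially"
  proof (rule uniform_limitI)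
    fix e :: real assume "e > 0"
    then have "\<forall>\<^sub>F n in sequentially. dist (trig_sum n (fourier F)) F < e"
      by (rule tendstoD[OF trig_sum_fourier_tendsto])
    then show "\<forall>\<^sub>F n in sequentially. \<forall>t\<in>UNIV. dist (airy t (trig_sum n (fourier F))) (airy t F) < e"
      by (simp add: dist_norm flip: airy_diff)
  qed
  have "continuous_on UNIV (\<lambda>t. airy t (trig_sum n (fourier F)))" for n
  proof -
    define a where "a = (\<lambda>t l. exp (\<i> * complex_of_real (t * (real_of_int l) ^ 3)) * fourier F l)"
    have a: "hermitian (a t)" for t
      unfolding a_def by (intro hermitian_mult hermitian_fourier) (simp add: hermitian_def exp_cnj)
    have "airy t (trig_sum n (fourier F)) = trig_sum n (a t)" for t
      by (rule fourier_eqI) (auto simp: fourier_airy fourier_trig_sum[OF a] fourier_trig_sum[OF hermitian_fourier], auto simp: a_def)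
    moreover have "continuous_on UNIV (\<lambda>t. trig_sum n (a t))"
      unfolding continuous_on_def
    proof
      fix t
      have herm: "hermitian (\<lambda>l. a r l - a t l)" for r
        using a by (simp add: hermitian_def)
      have diff: "trig_sum n (a r) - trig_sum n (a t) = trig_sum n (\<lambda>l. a r l - a t l)" for r
        by (rule fourier_eqI) (simp add: fourier_diff fourier_trig_sum a herm)
      have "((\<lambda>r. (norm (trig_sum n (a r) - trig_sum n (a t)))\<^sup>2) \<longlongrightarrow> (\<Sum>l\<in>{-int n..int n}. (cmod (a t l - a t l))\<^sup>2)) (at t)"
        unfolding diff norm_trig_sum[OF herm] unfolding a_def by (intro tendsto_intros)
      then have "((\<lambda>r. sqrt ((norm (trig_sum n (a r) - trig_sum n (a t)))\<^sup>2)) \<longlongrightarrow> sqrt 0) (at t)"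
        by (intro tendsto_real_sqrt) simp
      then show "((\<lambda>t. trig_sum n (a t)) \<longlongrightarrow> trig_sum n (a t)) (at t within UNIV)"
        by (simp add: tendsto_dist_iff[of _ "trig_sum n (a t)"] dist_norm)
    qed
    ultimately show ?thesis by simp
  qed
  then show "\<forall>\<^sub>F n in sequentially. continuous_on UNIV (\<lambda>t. airy t (trig_sum n (fourier F)))" by simp
qed simp

text \<open>The change of the argument is controlled by isometry, uniformly in time; the change of
  time acts on a fixed element, where strong continuity applies.\<close>

lemma continuous_on_airy_compose:
  assumes "continuous_on S g" "continuous_on S r"
  shows "continuous_on S (\<lambda>t. airy (r t) (g t))"
  unfolding continuous_on_def
proof
  fix t assume t: "t \<in> S"
  have "((\<lambda>s. airy (r s) (g s - g t)) \<longlongrightarrow> 0) (at t within S)"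
  proof (rule Lim_null_comparison)
    show "((\<lambda>s. norm (g s - g t)) \<longlongrightarrow> 0) (at t within S)"
      using assms(1) t by (intro tendsto_norm_zero LIM_zero) (auto simp: continuous_on_def)
  qed simp
  moreover have "((\<lambda>s. airy (r s) (g t)) \<longlongrightarrow> airy (r t) (g t)) (at t within S)"
    using continuous_on_compose2[OF continuous_on_airy assms(2), of "g t"] t by (auto simp: continuous_on_def)
  ultimately have "((\<lambda>s. airy (r s) (g s - g t) + airy (r s) (g t)) \<longlongrightarrow> 0 + airy (r t) (g t)) (at t within S)"
    by (rule tendsto_add)
  then show "((\<lambda>t. airy (r t) (g t)) \<longlongrightarrow> airy (r t) (g t)) (at t within S)"
    by (simp add: airy_diff)
qed

section \<open>Essentially bounded functions and products\<close>

lemma linf_norm_le_iff: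
  assumes "square_int f" "0 \<le> K"
  shows "linf_norm (abs_torus_L2 f) \<le> ennreal K \<longleftrightarrow> (AE x in torus. \<bar>f x\<bar> \<le> K)"
proof -
  have [measurable]: "f \<in> borel_measurable torus" by (rule square_int_measurable) fact
  have "linf_norm (abs_torus_L2 f) = esssup torus (\<lambda>x. ennreal \<bar>f x\<bar>)"
    using assms(1) by (simp add: linf_norm.abs_eq)
  moreover have "esssup torus (\<lambda>x. ennreal \<bar>f x\<bar>) \<le> ennreal K \<longleftrightarrow> (AE x in torus. ennreal \<bar>f x\<bar> \<le> ennreal K)"
  proof
    assume le: "esssup torus (\<lambda>x. ennreal \<bar>f x\<bar>) \<le> ennreal K"
    show "AE x in torus. ennreal \<bar>f x\<bar> \<le> ennreal K"
      using esssup_AE[of "\<lambda>x. ennreal \<bar>f x\<bar>" torus] by eventually_elim (use le order_trans in blast)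
  qed (auto intro: esssup_I)
  ultimately show ?thesis using assms(2) by (simp add: ennreal_le_iff)
qed

lemma linf_norm_add_le:
  assumes "linf_norm F \<le> ennreal K" "linf_norm G \<le> ennreal L" "0 \<le> K" "0 \<le> L"
  shows "linf_norm (F + G) \<le> ennreal (K + L)"
proof -
  obtain f where f: "F = abs_torus_L2 f" "square_int f" by (rule torus_L2_cases)
  obtain g where g: "G = abs_torus_L2 g" "square_int g" by (rule torus_L2_cases)
  have "AE x in torus. \<bar>f x\<bar> \<le> K" "AE x in torus. \<bar>g x\<bar> \<le> L"
    using assms f g by (simp_all add: linf_norm_le_iff)
  then have "AE x in torus. \<bar>f x + g x\<bar> \<le> K + L"
    by eventually_elim linarith
  then show ?thesis
    using f g assms by (simp add: add_abs_torus_L2 linf_norm_le_iff square_int_add del: ennreal_plus)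
qed

text \<open>The factor \<open>1 / sqrt (2 * pi)\<close> is at most 1 and is dropped to keep the
  later constants integers.\<close>

lemma linf_norm_mode_le: "linf_norm (mode l c) \<le> ennreal (cmod c)"
proof -
  have s: "1 \<le> sqrt (2 * pi)" using pi_gt3 by simp
  have "\<bar>mode_fun l c x\<bar> \<le> cmod c" for x
  proof -
    have "cmod c / sqrt (2 * pi) \<le> cmod c / 1" by (intro divide_left_mono s) (use s in auto)
    with abs_mode_fun_le[of l c x] show ?thesis by simp
  qed
  then show ?thesis by (simp add: mode_def linf_norm_le_iff square_int_mode_fun)
qed

lemma linf_norm_sum_mode_le:
  "finite A \<Longrightarrow> linf_norm (\<Sum>l\<in>A. mode l (a l)) \<le> ennreal (\<Sum>l\<in>A. cmod (a l))"
proof (induction A rule: finite_induct)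
  case empty
  then show ?case by (simp add: zero_torus_L2_def linf_norm_le_iff[of _ 0, simplified] square_int_zero)
next
  case (insert k A)
  then show ?case
    using linf_norm_add_le[OF linf_norm_mode_le insert.IH] by (simp add: sum_nonneg del: ennreal_plus)
qed

text \<open>L^infinity balls are closed in L^2: the part of the limit that exceeds \<open>K\<close>
  is no larger than the distance to any function bounded by \<open>K\<close>.\<close>

lemma linf_norm_lim_le:
  assumes X: "X \<longlonglongrightarrow> F" and le: "\<And>n::nat. linf_norm (X n) \<le> ennreal K" and "0 \<le> K"
  shows "linf_norm F \<le> ennreal K"
proof -
  obtain f where f: "F = abs_torus_L2 f" "square_int f" by (rule torus_L2_cases)
  have [measurable]: "f \<in> borel_measurable torus" by (rule square_int_measurable) fact
  \<comment> \<open>The excess of \<open>f\<close> over the bound \<open>K\<close>; it vanishes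
    almost everywhere exactly when the bound holds.\<close>
  define h where "h = (\<lambda>x. max 0 (\<bar>f x\<bar> - K))"
  have "\<bar>h x\<bar> \<le> \<bar>f x\<bar>" for x using assms by (auto simp: h_def)
  then have h2: "(h x)\<^sup>2 \<le> (f x)\<^sup>2" for x by (simp add: abs_le_square_iff)
  have [measurable]: "h \<in> borel_measurable torus" unfolding h_def by measurable
  have h: "square_int h"
    unfolding square_int_def
  proof
    show "integrable torus (\<lambda>x. (h x)\<^sup>2)"
      by (rule Bochner_Integration.integrable_bound[of _ "\<lambda>x. (f x)\<^sup>2"])
        (use f(2) h2 in \<open>auto simp: square_int_def\<close>)
  qed measurable
  have "norm (abs_torus_L2 h) \<le> norm (F - X n)" for n
  proof -
    obtain g where g: "X n = abs_torus_L2 g" "square_int g" by (rule torus_L2_cases)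
    have gK: "AE x in torus. \<bar>g x\<bar> \<le> K"
      using le[of n] g \<open>0 \<le> K\<close> by (simp add: linf_norm_le_iff)
    have d: "square_int (\<lambda>x. f x - g x)" by (intro square_int_diff f g)
    have "(norm (abs_torus_L2 h))\<^sup>2 = (\<integral>x. (h x)\<^sup>2 \<partial>torus)"
      unfolding power2_norm_eq_inner inner_abs_torus_L2[OF h h] by (simp add: power2_eq_square)
    also have "\<dots> \<le> (\<integral>x. (f x - g x)\<^sup>2 \<partial>torus)"
    proof (rule integral_mono_AE)
      show "AE x in torus. (h x)\<^sup>2 \<le> (f x - g x)\<^sup>2"
        using gK
      proof eventually_elim
        case (elim x)
        then have "\<bar>h x\<bar> \<le> \<bar>f x - g x\<bar>" by (auto simp: h_def)
        then show ?case by (simp add: abs_le_square_iff)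
      qed
    qed (use h d in \<open>auto simp: square_int_def\<close>)
    also have "\<dots> = (norm (F - X n))\<^sup>2"
      unfolding power2_norm_eq_inner f g diff_abs_torus_L2[OF f(2) g(2)] inner_abs_torus_L2[OF d d]
      by (simp add: power2_eq_square)
    finally show ?thesis by (rule power2_le_imp_le) simp
  qed
  moreover have "(\<lambda>n. norm (F - X n)) \<longlonglongrightarrow> norm (F - F)"
    by (intro tendsto_intros X)
  ultimately have "norm (abs_torus_L2 h) \<le> 0"
    by (intro LIMSEQ_le_const[of "\<lambda>n. norm (F - X n)"]) auto
  then have "abs_torus_L2 h = abs_torus_L2 (\<lambda>x. 0)" by (simp add: zero_torus_L2_def)
  then have "AE x in torus. h x = 0"
    by (subst (asm) abs_torus_L2_eq_iff) (auto simp: h square_int_zero)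
  then have "AE x in torus. \<bar>f x\<bar> \<le> K"
    by eventually_elim (auto simp: h_def max_def split: if_splits)
  then show ?thesis using f \<open>0 \<le> K\<close> by (simp add: linf_norm_le_iff)
qed

section \<open>Sobolev embedding of H^1 into bounded functions\<close>

text \<open>The right side is made to telescope: the two new terms are together at most
  \<open>4 / ((n + 1) * (n + 2))\<close>, and there is equality for \<open>n = 0\<close>.\<close>

lemma sum_inverse_one_plus_square_le:
  "(\<Sum>l\<in>{-int n..int n}. 1 / (1 + (real_of_int l)\<^sup>2)) \<le> 5 - 4 / (real n + 1)"
proof (induction n)
  case (Suc n)
  have "{-int (Suc n)..int (Suc n)} = insert (- int (Suc n)) (insert (int (Suc n)) {-int n..int n})" by auto
  then have "(\<Sum>l\<in>{-int (Suc n)..int (Suc n)}. 1 / (1 + (real_of_int l)\<^sup>2)) =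
    2 / (1 + (real n + 1)\<^sup>2) + (\<Sum>l\<in>{-int n..int n}. 1 / (1 + (real_of_int l)\<^sup>2))"
    by (simp add: add_ac power2_eq_square algebra_simps)
  also have "\<dots> \<le> 4 / ((real n + 1) * (real n + 2)) + (5 - 4 / (real n + 1))"
  proof (rule add_mono[OF _ Suc])
    have "2 / (1 + (real n + 1)\<^sup>2) = 4 / (2 * (1 + (real n + 1)\<^sup>2))"
      by (subst mult_divide_mult_cancel_left[of 2 2, symmetric]) simp_all
    also have "\<dots> \<le> 4 / ((real n + 1) * (real n + 2))"
    proof (rule divide_left_mono)
      have "0 < 1 + (real n + 1)\<^sup>2" by (rule add_pos_nonneg) auto
      then show "0 < 2 * (1 + (real n + 1)\<^sup>2) * ((real n + 1) * (real n + 2))" by simp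
    qed (auto simp: power2_eq_square algebra_simps)
    finally show "2 / (1 + (real n + 1)\<^sup>2) \<le> 4 / ((real n + 1) * (real n + 2))" .
  qed
  also have "\<dots> = 5 - 4 / (real (Suc n) + 1)"
  proof -
    have "4 / (x * (x + 1)) = 4 / x - 4 / (x + 1)" if "x > 0" for x :: real
      using that by (simp add: field_simps)
    from this[of "real n + 1"]
    have "4 / ((real n + 1) * (real n + 2)) = 4 / (real n + 1) - 4 / (real n + 2)"
      by (simp add: add.assoc)
    then show ?thesis by (simp add: add.commute)
  qed
  finally show ?case .
qed simp

text \<open>Cauchy--Schwarz after multiplying and dividing by the weight; the factor 3 comes from 5
  <= 3^2.\<close>

lemma sum_cmod_fourier_le:
  assumes "F \<in> sobolev 1"
  shows "(\<Sum>l\<in>{-int n..int n}. cmod (fourier F l)) \<le> 3 * sobolev_norm 1 F"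
proof -
  let ?w = "bessel_weight 1" and ?L = "{-int n..int n}"
  have w: "(1 / ?w l)\<^sup>2 = 1 / (1 + (real_of_int l)\<^sup>2)" for l
    using cmod_bessel_weight[of 1 l 1] one_plus_square_pos[of l] by (simp add: power_divide)
  have "(\<Sum>l\<in>?L. cmod (fourier F l))\<^sup>2 = (\<Sum>l\<in>?L. (1 / ?w l) * cmod (fourier (bessel 1 F) l))\<^sup>2"
  proof (intro arg_cong[where f = "\<lambda>x. x\<^sup>2"] sum.cong refl)
    show "cmod (fourier F l) = 1 / ?w l * cmod (fourier (bessel 1 F) l)" for l
      using bessel_weight_pos[of 1 l] by (simp add: fourier_bessel assms norm_mult)
  qed
  also have "\<dots> \<le> (\<Sum>l\<in>?L. (1 / ?w l)\<^sup>2) * (\<Sum>l\<in>?L. (cmod (fourier (bessel 1 F) l))\<^sup>2)"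
    by (rule Cauchy_Schwarz_ineq_sum)
  also have "\<dots> \<le> 5 * (norm (bessel 1 F))\<^sup>2"
  proof (intro mult_mono sum_fourier_le sum_nonneg)
    have "0 \<le> 4 / (real n + 1)" by simp
    with sum_inverse_one_plus_square_le[of n] show "(\<Sum>l\<in>?L. (1 / ?w l)\<^sup>2) \<le> 5"
      unfolding w by linarith
  qed auto
  also have "\<dots> \<le> (3 * sobolev_norm 1 F)\<^sup>2"
    by (simp add: norm_bessel assms power_mult_distrib)
  finally show ?thesis
    by (rule power2_le_imp_le) (simp add: sobolev_norm_nonneg)
qed

lemma linf_norm_le_sobolev_norm:
  assumes "F \<in> sobolev 1" shows "linf_norm F \<le> ennreal (3 * sobolev_norm 1 F)"
proof (rule linf_norm_lim_le[OF trig_sum_fourier_tendsto])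
  show "linf_norm (trig_sum n (fourier F)) \<le> ennreal (3 * sobolev_norm 1 F)" for n
    unfolding trig_sum_def
    by (rule order_trans[OF linf_norm_sum_mode_le ennreal_leI[OF sum_cmod_fourier_le]]) (use assms in auto)
qed (simp add: sobolev_norm_nonneg)

section \<open>Products with a bounded factor\<close>

text \<open>A bounded factor keeps the product square-integrable and so excludes the default value 0
  in the definition of \<open>\<odot>\<close>. The algebraic laws below are stated for bounded
  factors for this reason.\<close>

lemma mult_abs_torus_L2:
  assumes "square_int f" "square_int g" "AE x in torus. \<bar>g x\<bar> \<le> K"
  shows "square_int (\<lambda>x. f x * g x)" "abs_torus_L2 f \<odot> abs_torus_L2 g = abs_torus_L2 (\<lambda>x. f x * g x)"
proof -
  note [measurable] = assms(1,2)[THEN square_int_measurable]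
  show "square_int (\<lambda>x. f x * g x)"
    unfolding square_int_def
  proof
    have "AE x in torus. norm ((g x)\<^sup>2) \<le> K\<^sup>2"
      using assms(3)
    proof eventually_elim
      case (elim x)
      from power_mono[OF this, of 2] show ?case by simp
    qed
    then have "integrable torus (\<lambda>x. (f x)\<^sup>2 * (g x)\<^sup>2)"
      using assms(1) by (intro integrable_torus_mult_bounded) (auto simp: square_int_def)
    then show "integrable torus (\<lambda>x. (f x * g x)\<^sup>2)" by (simp add: power_mult_distrib)
  qed measurable
  then show "abs_torus_L2 f \<odot> abs_torus_L2 g = abs_torus_L2 (\<lambda>x. f x * g x)"
    using assms by (simp add: mult_L2.abs_eq)
qed

lemma mult_L2_commute: "F \<odot> G = G \<odot> F"
proof -
  obtain f where f: "F = abs_torus_L2 f" "square_int f" by (rule torus_L2_cases)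
  obtain g where g: "G = abs_torus_L2 g" "square_int g" by (rule torus_L2_cases)
  show ?thesis using f g by (simp add: mult_L2.abs_eq mult.commute)
qed

lemma bounded_cases:
  assumes "linf_norm G < top"
  obtains g K where "G = abs_torus_L2 g" "square_int g" "AE x in torus. \<bar>g x\<bar> \<le> K"
proof -
  obtain g where g: "G = abs_torus_L2 g" "square_int g" by (rule torus_L2_cases)
  have "linf_norm G \<le> ennreal (enn2real (linf_norm G))" using assms by simp
  then have "AE x in torus. \<bar>g x\<bar> \<le> enn2real (linf_norm G)"
    using g by (simp add: linf_norm_le_iff)
  with g show ?thesis using that by blast
qed

lemma mult_L2_add_left:
  assumes "linf_norm G < top" shows "(F + F') \<odot> G = F \<odot> G + F' \<odot> G"
proof -
  obtain f where f: "F = abs_torus_L2 f" "square_int f" by (rule torus_L2_cases)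
  obtain f' where f': "F' = abs_torus_L2 f'" "square_int f'" by (rule torus_L2_cases)
  obtain g K where g: "G = abs_torus_L2 g" "square_int g" "AE x in torus. \<bar>g x\<bar> \<le> K"
    by (rule bounded_cases[OF assms])
  note m = mult_abs_torus_L2[OF _ g(2,3)]
  show ?thesis
    using f f' g by (simp add: add_abs_torus_L2 m square_int_add distrib_right)
qed

lemma mult_L2_scaleR_left:
  assumes "linf_norm G < top" shows "(c *\<^sub>R F) \<odot> G = c *\<^sub>R (F \<odot> G)"
proof -
  obtain f where f: "F = abs_torus_L2 f" "square_int f" by (rule torus_L2_cases)
  obtain g K where g: "G = abs_torus_L2 g" "square_int g" "AE x in torus. \<bar>g x\<bar> \<le> K"
    by (rule bounded_cases[OF assms])
  note m = mult_abs_torus_L2[OF _ g(2,3)]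
  show ?thesis
    using f g by (simp add: scaleR_abs_torus_L2 m square_int_scale mult.assoc)
qed

lemma mult_L2_diff_left:
  assumes "linf_norm G < top" shows "(F - F') \<odot> G = F \<odot> G - F' \<odot> G"
  using mult_L2_add_left[OF assms, of "F - F'" F'] by (simp add: algebra_simps)

lemma mult_L2_add_right:
  assumes "linf_norm G < top" "linf_norm H < top" shows "F \<odot> (G + H) = F \<odot> G + F \<odot> H"
proof -
  obtain f where f: "F = abs_torus_L2 f" "square_int f" by (rule torus_L2_cases)
  obtain g K where g: "G = abs_torus_L2 g" "square_int g" "AE x in torus. \<bar>g x\<bar> \<le> K"
    by (rule bounded_cases[OF assms(1)])
  obtain h L where h: "H = abs_torus_L2 h" "square_int h" "AE x in torus. \<bar>h x\<bar> \<le> L"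
    by (rule bounded_cases[OF assms(2)])
  have "AE x in torus. \<bar>g x + h x\<bar> \<le> K + L"
    using g(3) h(3) by eventually_elim linarith
  note m = mult_abs_torus_L2[OF f(2) g(2,3)] mult_abs_torus_L2[OF f(2) h(2,3)]
    mult_abs_torus_L2[OF f(2) square_int_add[OF g(2) h(2)] this]
  show ?thesis
    using f g h by (simp add: add_abs_torus_L2 m distrib_left)
qed

lemma norm_mult_L2_le:
  assumes "linf_norm G \<le> ennreal K" "0 \<le> K" shows "norm (F \<odot> G) \<le> norm F * K"
proof -
  obtain f where f: "F = abs_torus_L2 f" "square_int f" by (rule torus_L2_cases)
  obtain g where g: "G = abs_torus_L2 g" "square_int g" by (rule torus_L2_cases)
  have gK: "AE x in torus. \<bar>g x\<bar> \<le> K" using assms g by (simp add: linf_norm_le_iff)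
  note m = mult_abs_torus_L2[OF f(2) g(2) gK]
  have "(norm (F \<odot> G))\<^sup>2 = (\<integral>x. (f x * g x)\<^sup>2 \<partial>torus)"
    unfolding power2_norm_eq_inner f g m(2) inner_abs_torus_L2[OF m(1) m(1)] by (simp add: power2_eq_square)
  also have "\<dots> \<le> (\<integral>x. K\<^sup>2 * (f x)\<^sup>2 \<partial>torus)"
  proof (rule integral_mono_AE)
    show "AE x in torus. (f x * g x)\<^sup>2 \<le> K\<^sup>2 * (f x)\<^sup>2"
      using gK
    proof eventually_elim
      case (elim x)
      from power_mono[OF this, of 2] have "(g x)\<^sup>2 \<le> K\<^sup>2" by simp
      then show ?case by (simp add: power_mult_distrib mult.commute[of "K\<^sup>2"] mult_left_mono)
    qed
  qed (use m f in \<open>auto simp: square_int_def\<close>)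
  also have "\<dots> = K\<^sup>2 * (norm F)\<^sup>2"
    unfolding power2_norm_eq_inner f inner_abs_torus_L2[OF f(2) f(2)] by (simp add: power2_eq_square)
  also have "\<dots> = (norm F * K)\<^sup>2" by (simp add: power_mult_distrib)
  finally show ?thesis by (rule power2_le_imp_le) (simp add: assms)
qed

text \<open>Multiplication by a bounded real function is self-adjoint; with integration by parts
  this yields the cancellation in the energy estimate.\<close>

lemma inner_mult_L2:
  assumes "linf_norm G < top" shows "inner (F \<odot> G) H = inner F (H \<odot> G)"
proof -
  obtain f where f: "F = abs_torus_L2 f" "square_int f" by (rule torus_L2_cases)
  obtain h where h: "H = abs_torus_L2 h" "square_int h" by (rule torus_L2_cases)
  obtain g K where g: "G = abs_torus_L2 g" "square_int g" "AE x in torus. \<bar>g x\<bar> \<le> K"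
    by (rule bounded_cases[OF assms])
  note m = mult_abs_torus_L2[OF _ g(2,3)]
  show ?thesis
    using f g h by (simp add: m inner_abs_torus_L2 mult.assoc mult.left_commute[of "g _"] mult.commute[of "g _"])
qed

lemma linf_norm_finite: "F \<in> sobolev 1 \<Longrightarrow> linf_norm F < top"
  by (rule order_le_less_trans[OF linf_norm_le_sobolev_norm]) auto

lemma norm_mult_sobolev_le:
  "G \<in> sobolev 1 \<Longrightarrow> norm (F \<odot> G) \<le> norm F * (3 * sobolev_norm 1 G)"
  by (intro norm_mult_L2_le linf_norm_le_sobolev_norm) (auto simp: sobolev_norm_nonneg)

section \<open>The product rule\<close>

lemma linf_norm_mode_finite: "linf_norm (mode l c) < top"
  by (rule order_le_less_trans[OF linf_norm_mode_le]) simp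

text \<open>A mode is half the sum of an exponential and its conjugate, which shift the frequency by
  \<open>j\<close> in opposite directions.\<close>

lemma fourier_mult_mode:
  "fourier (F \<odot> mode j c) k =
    (c * fourier F (k - j) + cnj c * fourier F (k + j)) / (2 * complex_of_real (sqrt (2 * pi)))"
proof -
  obtain f where f: "F = abs_torus_L2 f" "square_int f" by (rule torus_L2_cases)
  have "AE x in torus. \<bar>mode_fun j c x\<bar> \<le> cmod c / sqrt (2 * pi)" by (simp add: abs_mode_fun_le)
  note m = mult_abs_torus_L2[OF f(2) square_int_mode_fun this]
  define q where "q = 2 * complex_of_real (sqrt (2 * pi))"
  note int = integrable_fourier_integral[OF square_int_integrable[OF f(2)]]
  have "complex_of_real (f x * mode_fun j c x) * exp (- (\<i> * of_int k * complex_of_real x)) =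
     c / q * (complex_of_real (f x) * exp (- (\<i> * of_int (k - j) * complex_of_real x))) +
     cnj c / q * (complex_of_real (f x) * exp (- (\<i> * of_int (k + j) * complex_of_real x)))" for x
  proof -
    have Re: "complex_of_real (Re z) = (z + cnj z) / 2" for z
      by (simp add: complex_eq_iff)
    have *: "complex_of_real (mode_fun j c x) =
      (c * exp (\<i> * of_int j * complex_of_real x) + cnj c * exp (- (\<i> * of_int j * complex_of_real x))) / q"
      unfolding mode_fun_def of_real_divide Re by (simp add: exp_cnj q_def)
    have "exp (- (\<i> * of_int (k - j) * complex_of_real x)) =
        exp (\<i> * of_int j * complex_of_real x) * exp (- (\<i> * of_int k * complex_of_real x))"
      "exp (- (\<i> * of_int (k + j) * complex_of_real x)) =
        exp (- (\<i> * of_int j * complex_of_real x)) * exp (- (\<i> * of_int k * complex_of_real x))"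
      unfolding exp_add[symmetric] by (rule arg_cong[of _ _ exp], simp add: algebra_simps)+
    then show ?thesis
      by (simp only: of_real_mult *) (simp add: add_divide_distrib distrib_left distrib_right mult_ac)
  qed
  then have "fourier_integral (\<lambda>x. f x * mode_fun j c x) k =
      c / q * fourier_integral f (k - j) + cnj c / q * fourier_integral f (k + j)"
    unfolding fourier_integral_def using int[of "k - j"] int[of "k + j"]
    by (simp del: of_int_diff of_int_add of_real_mult)
  then show ?thesis
    unfolding f(1) mode_def m(2) fourier_abs[OF m(1)] fourier_abs[OF f(2)] q_def[symmetric]
    by (simp add: add_divide_distrib distrib_left mult_ac)
qed

lemma mult_sum_mode:
  "finite A \<Longrightarrow> F \<odot> (\<Sum>l\<in>A. mode l (a l)) = (\<Sum>l\<in>A. F \<odot> mode l (a l))"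
proof (induction A rule: finite_induct)
  case empty
  have "norm (F \<odot> 0) \<le> norm F * 0"
    by (rule norm_mult_L2_le) (simp_all add: zero_torus_L2_def linf_norm_le_iff[of _ 0, simplified] square_int_zero)
  then show ?case by simp
next
  case (insert k A)
  have "linf_norm (\<Sum>l\<in>A. mode l (a l)) < top"
    by (rule order_le_less_trans[OF linf_norm_sum_mode_le[OF insert(1)]]) simp
  then show ?case using insert by (simp add: mult_L2_add_right linf_norm_mode_finite)
qed

text \<open>Mode by mode this is k = (k - j) + j, and k = (k + j) - j for the conjugate part. The
  left side carries the symbol of the derivative instead of \<open>deriv_x\<close>, as the product
  is not yet known to lie in H^1.\<close>

lemma fourier_mult_trig_sum:
  assumes "F \<in> sobolev 1"
  shows "\<i> * of_int k * fourier (F \<odot> trig_sum n a) k =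
    fourier (deriv_x F \<odot> trig_sum n a) k + fourier (F \<odot> trig_sum n (\<lambda>l. \<i> * of_int l * a l)) k"
proof -
  have "\<i> * of_int k * fourier (F \<odot> mode j c) k =
      fourier (deriv_x F \<odot> mode j c) k + fourier (F \<odot> mode j (\<i> * of_int j * c)) k" for j c
    unfolding fourier_mult_mode
    by (simp add: fourier_deriv_x assms add_divide_distrib[symmetric] algebra_simps)
  then show ?thesis
    by (simp add: trig_sum_def mult_sum_mode fourier_sum sum_distrib_left sum.distrib)
qed

lemma sobolev_trig_sum:
  assumes "hermitian a" shows "trig_sum n a \<in> sobolev s"
proof (rule sobolevI(1))
  have "hermitian (\<lambda>l. complex_of_real (bessel_weight s l) * a l)"
    using assms by (simp add: hermitian_def bessel_weight_def)
  then show "fourier (trig_sum n (\<lambda>l. complex_of_real (bessel_weight s l) * a l)) l =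
      complex_of_real (bessel_weight s l) * fourier (trig_sum n a) l" for l
    using assms by (simp add: fourier_trig_sum)
qed

text \<open>Truncation of frequencies commutes with the Bessel potential, so convergence in H^s is
  convergence in L^2 for the potential.\<close>

lemma sobolev_norm_diff_trig_sum_tendsto:
  assumes "F \<in> sobolev s"
  shows "(\<lambda>n. sobolev_norm s (F - trig_sum n (fourier F))) \<longlonglongrightarrow> 0"
proof -
  have "bessel s (F - trig_sum n (fourier F)) = bessel s F - trig_sum n (fourier (bessel s F))" for n
    by (rule sobolevI)
      (simp add: fourier_diff fourier_trig_sum[OF hermitian_fourier] fourier_bessel[OF assms] algebra_simps)
  then have eq: "sobolev_norm s (F - trig_sum n (fourier F)) = norm (bessel s F - trig_sum n (fourier (bessel s F)))" for n
    using norm_bessel[OF sobolev_diff[OF assms sobolev_trig_sum[OF hermitian_fourier]]] by metis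
  have "(\<lambda>n. norm (bessel s F - trig_sum n (fourier (bessel s F)))) \<longlonglongrightarrow> norm (bessel s F - bessel s F)"
    by (intro tendsto_intros trig_sum_fourier_tendsto)
  then show ?thesis by (simp add: eq)
qed

text \<open>The coefficient identity for trigonometric \<open>G\<close> passes to the limit. It
  exhibits an L^2 function with the coefficients of a derivative, which gives membership in H^1 and
  the formula together.\<close>

lemma
  assumes F: "F \<in> sobolev 1" and G: "G \<in> sobolev 1"
  shows sobolev_mult: "F \<odot> G \<in> sobolev 1"
    and deriv_x_mult: "deriv_x (F \<odot> G) = deriv_x F \<odot> G + F \<odot> deriv_x G"
proof -
  define X where "X = (\<lambda>n. trig_sum n (fourier G))"
  have X: "X n \<in> sobolev 1" for n unfolding X_def by (intro sobolev_trig_sum hermitian_fourier)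
  \<comment> \<open>Here \<open>H\<close> is only in L^2, to allow \<open>deriv_x F\<close>; the
    convergence of \<open>X n\<close> in H^1, hence uniformly, compensates.\<close>
  have lim: "(\<lambda>n. H \<odot> X n) \<longlonglongrightarrow> H \<odot> G" for H
  proof (rule LIM_zero_cancel, rule Lim_null_comparison)
    have "norm (H \<odot> X n - H \<odot> G) \<le> norm H * (3 * sobolev_norm 1 (G - X n))" for n
    proof -
      have "H \<odot> G = H \<odot> (G - X n) + H \<odot> X n"
        using mult_L2_add_right[of "G - X n" "X n" H] linf_norm_finite[OF X, of n]
          linf_norm_finite[OF sobolev_diff[OF G X], of n] by simp
      then have "norm (H \<odot> X n - H \<odot> G) = norm (H \<odot> (G - X n))" by simp
      also have "\<dots> \<le> norm H * (3 * sobolev_norm 1 (G - X n))"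
        by (intro norm_mult_sobolev_le sobolev_diff G X)
      finally show ?thesis .
    qed
    then show "\<forall>\<^sub>F n in sequentially. norm (H \<odot> X n - H \<odot> G) \<le> norm H * (3 * sobolev_norm 1 (G - X n))"
      by simp
    have "(\<lambda>n. norm H * (3 * sobolev_norm 1 (G - X n))) \<longlonglongrightarrow> norm H * (3 * 0)"
      unfolding X_def by (intro tendsto_intros sobolev_norm_diff_trig_sum_tendsto G)
    then show "(\<lambda>n. norm H * (3 * sobolev_norm 1 (G - X n))) \<longlonglongrightarrow> 0" by simp
  qed
  define Y where "Y = (\<lambda>n. trig_sum n (fourier (deriv_x G)))"
  \<comment> \<open>The roles are exchanged: \<open>Y n\<close> converges only in L^2, and
    \<open>F\<close> is the bounded factor.\<close>
  have lim': "(\<lambda>n. F \<odot> Y n) \<longlonglongrightarrow> F \<odot> deriv_x G"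
  proof (rule LIM_zero_cancel, rule Lim_null_comparison)
    have "norm (F \<odot> Y n - F \<odot> deriv_x G) \<le> norm (Y n - deriv_x G) * (3 * sobolev_norm 1 F)" for n
      using norm_mult_sobolev_le[OF F, of "Y n - deriv_x G"]
      by (simp add: mult_L2_diff_left linf_norm_finite F mult_L2_commute[of F])
    then show "\<forall>\<^sub>F n in sequentially. norm (F \<odot> Y n - F \<odot> deriv_x G) \<le> norm (Y n - deriv_x G) * (3 * sobolev_norm 1 F)"
      by simp
    have "(\<lambda>n. norm (Y n - deriv_x G) * (3 * sobolev_norm 1 F)) \<longlonglongrightarrow> norm (deriv_x G - deriv_x G) * (3 * sobolev_norm 1 F)"
      unfolding Y_def by (intro tendsto_intros trig_sum_fourier_tendsto)
    then show "(\<lambda>n. norm (Y n - deriv_x G) * (3 * sobolev_norm 1 F)) \<longlonglongrightarrow> 0" by simp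
  qed
  have "fourier (deriv_x F \<odot> G + F \<odot> deriv_x G) k = \<i> * of_int k * fourier (F \<odot> G) k" for k
  proof (rule LIMSEQ_unique)
    have "fourier (deriv_x G) = (\<lambda>l. \<i> * of_int l * fourier G l)"
      by (simp add: fun_eq_iff fourier_deriv_x G)
    then have "\<i> * of_int k * fourier (F \<odot> X n) k = fourier (deriv_x F \<odot> X n + F \<odot> Y n) k" for n
      by (simp add: X_def Y_def fourier_mult_trig_sum F fourier_add)
    moreover have "(\<lambda>n. \<i> * of_int k * fourier (F \<odot> X n) k) \<longlonglongrightarrow> \<i> * of_int k * fourier (F \<odot> G) k"
      by (intro tendsto_mult tendsto_const tendsto_fourier lim)
    ultimately show "(\<lambda>n. fourier (deriv_x F \<odot> X n + F \<odot> Y n) k) \<longlonglongrightarrow> \<i> * of_int k * fourier (F \<odot> G) k"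
      by simp
    show "(\<lambda>n. fourier (deriv_x F \<odot> X n + F \<odot> Y n) k) \<longlonglongrightarrow> fourier (deriv_x F \<odot> G + F \<odot> deriv_x G) k"
      by (intro tendsto_fourier tendsto_add lim lim')
  qed
  then show "F \<odot> G \<in> sobolev 1" "deriv_x (F \<odot> G) = deriv_x F \<odot> G + F \<odot> deriv_x G"
    by (auto intro: sobolev_1I deriv_x_eqI)
qed

text \<open>Each term of the product rule pairs an L^2 derivative with a factor bounded through the
  embedding constant 3, whence 6 = 3 + 3.\<close>

lemma norm_deriv_x_mult_le:
  assumes F: "F \<in> sobolev 1" and G: "G \<in> sobolev 1"
  shows "norm (deriv_x (F \<odot> G)) \<le> 6 * sobolev_norm 1 F * sobolev_norm 1 G"
proof -
  have "norm (deriv_x F \<odot> G) \<le> norm (deriv_x F) * (3 * sobolev_norm 1 G)"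
    by (rule norm_mult_sobolev_le[OF G])
  also have "\<dots> \<le> sobolev_norm 1 F * (3 * sobolev_norm 1 G)"
    by (intro mult_right_mono norm_deriv_x_le F) (simp add: sobolev_norm_nonneg)
  finally have 1: "norm (deriv_x F \<odot> G) \<le> sobolev_norm 1 F * (3 * sobolev_norm 1 G)" .
  have "norm (F \<odot> deriv_x G) \<le> norm (deriv_x G) * (3 * sobolev_norm 1 F)"
    unfolding mult_L2_commute[of F] by (rule norm_mult_sobolev_le[OF F])
  also have "\<dots> \<le> sobolev_norm 1 G * (3 * sobolev_norm 1 F)"
    by (intro mult_right_mono norm_deriv_x_le G) (simp add: sobolev_norm_nonneg)
  finally have 2: "norm (F \<odot> deriv_x G) \<le> sobolev_norm 1 G * (3 * sobolev_norm 1 F)" .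
  show ?thesis
    unfolding deriv_x_mult[OF F G] using norm_triangle_ineq[of "deriv_x F \<odot> G" "F \<odot> deriv_x G"] 1 2
    by (simp add: algebra_simps)
qed

text \<open>The derivative of the second factor disappears: \<open>\<integral> v (\<psi> v)' = \<integral> \<psi>' v\<^sup>2 / 2\<close>.\<close>

lemma inner_deriv_x_mult_le:
  assumes \<psi>: "\<psi> \<in> sobolev 1" and v: "v \<in> sobolev 1"
    and A: "linf_norm (deriv_x \<psi>) \<le> ennreal A" "0 \<le> A"
  shows "2 * inner v (deriv_x (\<psi> \<odot> v)) \<le> A * (norm v)\<^sup>2"
proof -
  have "inner v (deriv_x (\<psi> \<odot> v)) = inner v (v \<odot> deriv_x \<psi>) + inner v (deriv_x v \<odot> \<psi>)"
    by (simp add: deriv_x_mult \<psi> v inner_add_right mult_L2_commute)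
  moreover have "inner v (deriv_x (\<psi> \<odot> v)) = - inner (deriv_x v) (v \<odot> \<psi>)"
    using inner_deriv_x[OF v sobolev_mult[OF \<psi> v]] by (simp add: mult_L2_commute)
  moreover have "inner (deriv_x v) (v \<odot> \<psi>) = inner v (deriv_x v \<odot> \<psi>)"
    using inner_mult_L2[OF linf_norm_finite[OF \<psi>], of "deriv_x v" v] by (simp add: inner_commute)
  \<comment> \<open>Adding the two expressions for the same inner product cancels the terms that
    contain \<open>deriv_x v\<close>.\<close>
  ultimately have "2 * inner v (deriv_x (\<psi> \<odot> v)) = inner v (v \<odot> deriv_x \<psi>)" by linarith
  also have "\<dots> \<le> norm v * norm (v \<odot> deriv_x \<psi>)" by (rule norm_cauchy_schwarz)
  also have "\<dots> \<le> norm v * (norm v * A)" by (intro mult_left_mono norm_mult_L2_le A) auto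
  finally show ?thesis by (simp add: power2_eq_square mult_ac)
qed

section \<open>Paths in Sobolev spaces\<close>

lemma tendsto_sobolev_norm_iff:
  assumes "\<And>t. t \<in> S \<Longrightarrow> f t \<in> sobolev s" "t \<in> S"
  shows "((\<lambda>r. sobolev_norm s (f r - f t)) \<longlongrightarrow> 0) (at t within S) \<longleftrightarrow>
     ((\<lambda>r. bessel s (f r)) \<longlongrightarrow> bessel s (f t)) (at t within S)"
proof -
  have "((\<lambda>r. bessel s (f r)) \<longlongrightarrow> bessel s (f t)) (at t within S) \<longleftrightarrow>
      ((\<lambda>r. dist (bessel s (f r)) (bessel s (f t))) \<longlongrightarrow> 0) (at t within S)"
    by (rule tendsto_dist_iff)
  also have "\<dots> \<longleftrightarrow> ((\<lambda>r. sobolev_norm s (f r - f t)) \<longlongrightarrow> 0) (at t within S)"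
  proof (rule filterlim_cong[OF refl refl])
    show "\<forall>\<^sub>F r in at t within S. dist (bessel s (f r)) (bessel s (f t)) = sobolev_norm s (f r - f t)"
      unfolding eventually_at_filter
      by (rule eventuallyI)
        (auto simp: dist_norm assms norm_bessel sobolev_diff simp flip: bessel_diff)
  qed
  finally show ?thesis ..
qed

text \<open>The Bessel potential turns continuity in H^s into ordinary continuity of a path in
  \<open>torus_L2\<close>.\<close>

lemma sobolev_continuous_iff:
  "sobolev_continuous s T f \<longleftrightarrow> (\<forall>t\<in>{0..T}. f t \<in> sobolev s) \<and> continuous_on {0..T} (\<lambda>t. bessel s (f t))"
  unfolding sobolev_continuous_def continuous_on_def
  using tendsto_sobolev_norm_iff[of "{0..T}" f s] by blast

lemma sobolev_continuousD: "sobolev_continuous s T f \<Longrightarrow> t \<in> {0..T} \<Longrightarrow> f t \<in> sobolev s"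
  by (simp add: sobolev_continuous_def)

lemma sobolev_continuous_diff:
  assumes "sobolev_continuous s T f" "sobolev_continuous s T g"
  shows "sobolev_continuous s T (\<lambda>t. f t - g t)"
proof -
  have "continuous_on {0..T} (\<lambda>t. bessel s (f t) - bessel s (g t))"
    using assms by (intro continuous_on_diff) (auto simp: sobolev_continuous_iff)
  then have "continuous_on {0..T} (\<lambda>t. bessel s (f t - g t))"
    by (rule continuous_on_cong[THEN iffD1, rotated -1])
      (use assms in \<open>auto simp: sobolev_continuous_iff bessel_diff\<close>)
  then show ?thesis using assms by (auto simp: sobolev_continuous_iff sobolev_diff)
qed

lemma sobolev_continuous_scaleR:
  assumes "sobolev_continuous s T f"
  shows "sobolev_continuous s T (\<lambda>t. c *\<^sub>R f t)"
proof -
  have "continuous_on {0..T} (\<lambda>t. c *\<^sub>R bessel s (f t))"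
    using assms by (intro continuous_intros) (auto simp: sobolev_continuous_iff)
  then have "continuous_on {0..T} (\<lambda>t. bessel s (c *\<^sub>R f t))"
    by (rule continuous_on_cong[THEN iffD1, rotated -1])
      (use assms in \<open>auto simp: sobolev_continuous_iff bessel_scaleR\<close>)
  then show ?thesis using assms by (auto simp: sobolev_continuous_iff sobolev_scaleR)
qed

lemma sobolev_continuous_mono:
  assumes "sobolev_continuous s T f" "r \<le> s"
  shows "sobolev_continuous r T f"
  unfolding sobolev_continuous_def
proof (intro ballI conjI)
  fix t assume t: "t \<in> {0..T}"
  show "f t \<in> sobolev r" by (intro sobolev_mono(1)[OF assms(2)] sobolev_continuousD[OF assms(1) t])
  show "((\<lambda>q. sobolev_norm r (f q - f t)) \<longlongrightarrow> 0) (at t within {0..T})"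
  proof (rule Lim_null_comparison)
    show "\<forall>\<^sub>F q in at t within {0..T}. norm (sobolev_norm r (f q - f t)) \<le> sobolev_norm s (f q - f t)"
      unfolding eventually_at_filter
      by (rule eventuallyI)
        (auto simp: sobolev_norm_nonneg intro!: sobolev_mono(2)[OF assms(2)] sobolev_diff
          sobolev_continuousD[OF assms(1)] t[simplified])
    show "((\<lambda>q. sobolev_norm s (f q - f t)) \<longlongrightarrow> 0) (at t within {0..T})"
      using assms(1) t by (simp add: sobolev_continuous_def)
  qed
qed

lemma continuous_on_sobolev_norm:
  assumes "sobolev_continuous s T f" shows "continuous_on {0..T} (\<lambda>t. sobolev_norm s (f t))"
proof -
  have "continuous_on {0..T} (\<lambda>t. norm (bessel s (f t)))"
    using assms by (intro continuous_intros) (auto simp: sobolev_continuous_iff)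
  then show ?thesis
    by (rule continuous_on_cong[THEN iffD1, rotated -1])
      (use assms in \<open>auto simp: sobolev_continuous_iff norm_bessel\<close>)
qed

lemma sobolev_continuous_imp_continuous_on:
  assumes "sobolev_continuous s T f" "0 \<le> s" shows "continuous_on {0..T} f"
  using sobolev_continuous_mono[OF assms]
  by (auto simp: sobolev_continuous_def continuous_on_def tendsto_dist_iff[of f] dist_norm)

text \<open>The map is bilinear and bounded from H^1 times H^1 to L^2, so an increment splits into
  one increment per factor. The continuity makes all time integrals in the equations exist.\<close>

lemma continuous_on_deriv_x_mult:
  assumes f: "sobolev_continuous 1 T f" and g: "sobolev_continuous 1 T g"
  shows "continuous_on {0..T} (\<lambda>t. deriv_x (f t \<odot> g t))"
  unfolding continuous_on_def
proof
  fix t assume t: "t \<in> {0..T}"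
  note F = sobolev_continuousD[OF f] and G = sobolev_continuousD[OF g]
  have le: "norm (deriv_x (f r \<odot> g r) - deriv_x (f t \<odot> g t)) \<le>
      6 * sobolev_norm 1 (f r - f t) * sobolev_norm 1 (g r) + 6 * sobolev_norm 1 (f t) * sobolev_norm 1 (g r - g t)"
    if r: "r \<in> {0..T}" for r
  proof -
    have d: "f r - f t \<in> sobolev 1" "g r - g t \<in> sobolev 1"
      using F G r t by (auto intro: sobolev_diff)
    have "f r \<odot> g r - f t \<odot> g t = (f r - f t) \<odot> g r + f t \<odot> (g r - g t)"
      using mult_L2_diff_left[OF linf_norm_finite[OF G[OF r]], of "f r" "f t"]
        mult_L2_diff_left[OF linf_norm_finite[OF F[OF t]], of "g r" "g t"]
      by (simp add: mult_L2_commute[of "f t"])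
    then have "deriv_x (f r \<odot> g r) - deriv_x (f t \<odot> g t) =
        deriv_x ((f r - f t) \<odot> g r) + deriv_x (f t \<odot> (g r - g t))"
      using F G r t d by (simp add: sobolev_mult flip: deriv_x_diff deriv_x_add)
    also have "norm \<dots> \<le> norm (deriv_x ((f r - f t) \<odot> g r)) + norm (deriv_x (f t \<odot> (g r - g t)))"
      by (rule norm_triangle_ineq)
    also have "\<dots> \<le> 6 * sobolev_norm 1 (f r - f t) * sobolev_norm 1 (g r) + 6 * sobolev_norm 1 (f t) * sobolev_norm 1 (g r - g t)"
      by (intro add_mono norm_deriv_x_mult_le d F G r t)
    finally show ?thesis .
  qed
  have "((\<lambda>r. deriv_x (f r \<odot> g r) - deriv_x (f t \<odot> g t)) \<longlongrightarrow> 0) (at t within {0..T})"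
  proof (rule Lim_null_comparison)
    show "\<forall>\<^sub>F r in at t within {0..T}. norm (deriv_x (f r \<odot> g r) - deriv_x (f t \<odot> g t)) \<le>
      6 * sobolev_norm 1 (f r - f t) * sobolev_norm 1 (g r) + 6 * sobolev_norm 1 (f t) * sobolev_norm 1 (g r - g t)"
      unfolding eventually_at_filter by (rule eventuallyI) (use le in auto)
    have "((\<lambda>r. 6 * sobolev_norm 1 (f r - f t) * sobolev_norm 1 (g r) + 6 * sobolev_norm 1 (f t) * sobolev_norm 1 (g r - g t))
       \<longlongrightarrow> 6 * 0 * sobolev_norm 1 (g t) + 6 * sobolev_norm 1 (f t) * 0) (at t within {0..T})"
      using f g t continuous_on_sobolev_norm[OF g]
      by (intro tendsto_intros) (auto simp: sobolev_continuous_def continuous_on_def)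
    then show "((\<lambda>r. 6 * sobolev_norm 1 (f r - f t) * sobolev_norm 1 (g r) + 6 * sobolev_norm 1 (f t) * sobolev_norm 1 (g r - g t))
       \<longlongrightarrow> 0) (at t within {0..T})" by simp
  qed
  then show "((\<lambda>t. deriv_x (f t \<odot> g t)) \<longlongrightarrow> deriv_x (f t \<odot> g t)) (at t within {0..T})"
    by (rule LIM_zero_cancel)
qed

text \<open>The derivative of an H^2 path stays in a bounded subset of H^1 by compactness of the
  time interval, and H^1 embeds into bounded functions.\<close>

lemma bounded_linf_norm_deriv_x:
  assumes "sobolev_continuous 2 T \<psi>"
  obtains K where "0 \<le> K" "\<And>t. t \<in> {0..T} \<Longrightarrow> linf_norm (deriv_x (\<psi> t)) \<le> ennreal K"
proof -
  have "compact ((\<lambda>t. sobolev_norm 2 (\<psi> t)) ` {0..T})"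
    by (intro compact_continuous_image continuous_on_sobolev_norm assms) auto
  then obtain B where B: "\<And>t. t \<in> {0..T} \<Longrightarrow> norm (sobolev_norm 2 (\<psi> t)) \<le> B"
    using compact_imp_bounded bounded_iff by (metis image_eqI)
  have "linf_norm (deriv_x (\<psi> t)) \<le> ennreal (3 * \<bar>B\<bar>)" if t: "t \<in> {0..T}" for t
  proof -
    have \<psi>: "\<psi> t \<in> sobolev (1 + 1)" using sobolev_continuousD[OF assms t] by simp
    have "linf_norm (deriv_x (\<psi> t)) \<le> ennreal (3 * sobolev_norm 1 (deriv_x (\<psi> t)))"
      by (rule linf_norm_le_sobolev_norm[OF sobolev_deriv_x(1)[OF \<psi>]]) simp
    also have "\<dots> \<le> ennreal (3 * \<bar>B\<bar>)"
      using sobolev_deriv_x(2)[OF \<psi>] B[OF t] by (intro ennreal_leI) auto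
    finally show ?thesis .
  qed
  then show ?thesis using that[of "3 * \<bar>B\<bar>"] by simp
qed

section \<open>Energy estimate for mild solutions\<close>

text \<open>By the group law \<open>airy t\<close> leaves the integral. The remaining integrand does
  not depend on \<open>t\<close>, so the fundamental theorem of calculus applies to it.\<close>

lemma airy_convolution:
  assumes g: "continuous_on {0..T} g" and t: "t \<in> {0..T}"
  shows "(\<lambda>s. airy (t - s) (g s)) integrable_on {0..t}"
    and "integral {0..t} (\<lambda>s. airy (t - s) (g s)) = airy t (integral {0..t} (\<lambda>s. airy (- s) (g s)))"
proof -
  have g': "continuous_on {0..t} g" using t by (intro continuous_on_subset[OF g]) auto
  show "(\<lambda>s. airy (t - s) (g s)) integrable_on {0..t}"
    by (intro integrable_continuous_real continuous_on_airy_compose g' continuous_intros)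
  have "(\<lambda>s. airy (- s) (g s)) integrable_on {0..t}"
    by (intro integrable_continuous_real continuous_on_airy_compose g' continuous_intros)
  from integral_linear[OF this bounded_linear_airy[of t]]
  show "integral {0..t} (\<lambda>s. airy (t - s) (g s)) = airy t (integral {0..t} (\<lambda>s. airy (- s) (g s)))"
    by (simp add: o_def airy_airy)
qed

lemma continuous_on_airy_convolution:
  assumes g: "continuous_on {0..T} g"
  shows "continuous_on {0..T} (\<lambda>t. integral {0..t} (\<lambda>s. airy (t - s) (g s)))"
proof -
  have "continuous_on {0..T} (\<lambda>s. airy (- s) (g s))"
    by (intro continuous_on_airy_compose g continuous_intros)
  then have "continuous_on {0..T} (\<lambda>t. integral {0..t} (\<lambda>s. airy (- s) (g s)))"
    by (intro indefinite_integral_continuous_1 integrable_continuous_real)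
  then have "continuous_on {0..T} (\<lambda>t. airy t (integral {0..t} (\<lambda>s. airy (- s) (g s))))"
    by (intro continuous_on_airy_compose continuous_intros)
  then show ?thesis
    by (rule continuous_on_cong[THEN iffD1, rotated -1]) (simp_all add: airy_convolution(2)[OF g])
qed

text \<open>Undoing the group gives a path \<open>y\<close> with the same norm as \<open>v\<close>
  and with an ordinary derivative in L^2, from which the generator has disappeared. Gronwall's
  argument then applies to its squared norm.\<close>

lemma mild_energy_estimate:
  assumes g: "continuous_on {0..T} g" and b: "continuous_on {0..T} b" "\<And>s. s \<in> {0..T} \<Longrightarrow> 0 \<le> b s"
    and v: "\<And>t. t \<in> {0..T} \<Longrightarrow> v t = integral {0..t} (\<lambda>s. airy (t - s) (g s))"
    and le: "\<And>s. s \<in> {0..T} \<Longrightarrow> 2 * inner (v s) (g s) \<le> \<kappa> * (norm (v s))\<^sup>2 + b s"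
    and "0 \<le> \<kappa>" and t: "t \<in> {0..T}"
  shows "(norm (v t))\<^sup>2 \<le> exp (\<kappa> * T) * integral {0..t} b"
proof -
  define h where "h = (\<lambda>s. airy (- s) (g s))"
  define y where "y = (\<lambda>t. integral {0..t} h)"
  have h: "continuous_on {0..T} h"
    unfolding h_def by (intro continuous_on_airy_compose g continuous_intros)
  have vy: "v s = airy s (y s)" if "s \<in> {0..T}" for s
    unfolding y_def h_def airy_convolution(2)[OF g that, symmetric] by (rule v[OF that])
  \<comment> \<open>The squared norm with Gronwall's integrating factor, less the accumulated
    source; it is shown to be nonincreasing.\<close>
  define \<Phi> where "\<Phi> = (\<lambda>s. exp (- \<kappa> * s) * inner (y s) (y s) - integral {0..s} b)"
  have D: "(\<Phi> has_real_derivative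
      exp (- \<kappa> * s) * (2 * inner (y s) (h s) - \<kappa> * inner (y s) (y s)) - b s) (at s within {0..T})"
    if s: "s \<in> {0..T}" for s
  proof -
    have dy: "(y has_vector_derivative h s) (at s within {0..T})"
      unfolding y_def by (rule integral_has_vector_derivative[OF h s])
    have "((\<lambda>s. inner (y s) (y s)) has_real_derivative 2 * inner (y s) (h s)) (at s within {0..T})"
      unfolding has_field_derivative_def
      by (rule derivative_eq_intros dy[unfolded has_vector_derivative_def] refl)+
        (auto simp: fun_eq_iff inner_commute)
    moreover have "((\<lambda>s. integral {0..s} b) has_real_derivative b s) (at s within {0..T})"
      unfolding has_real_derivative_iff_has_vector_derivative
      by (rule integral_has_vector_derivative[OF b(1) s])
    moreover have "((\<lambda>s. exp (- \<kappa> * s)) has_real_derivative - \<kappa> * exp (- \<kappa> * s)) (at s within {0..T})"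
      by (auto intro!: derivative_eq_intros)
    ultimately show ?thesis
      unfolding \<Phi>_def by (auto intro!: derivative_eq_intros simp: algebra_simps)
  qed
  have "\<Phi> t \<le> \<Phi> 0"
  proof (rule DERIV_nonpos_imp_decreasing_open[where f = \<Phi> and a = 0 and b = t])
    show "continuous_on {0..t} \<Phi>"
    proof (rule continuous_on_subset)
      show "continuous_on {0..T} \<Phi>"
        using D by (meson DERIV_continuous continuous_on_eq_continuous_within)
    qed (use t in auto)
    fix s assume s: "0 < s" "s < t"
    then have sT: "s \<in> {0..T}" "at s within {0..T} = at s"
      using t by (auto intro!: at_within_Icc_at)
    have "inner (y s) (h s) = inner (v s) (g s)" "inner (y s) (y s) = (norm (v s))\<^sup>2"
      using inner_airy[of s "y s" "h s"] by (simp_all add: vy[OF sT(1)] h_def airy_airy power2_norm_eq_inner inner_airy)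
    then have "2 * inner (y s) (h s) - \<kappa> * inner (y s) (y s) \<le> b s"
      using le[OF sT(1)] by simp
    then have "exp (- \<kappa> * s) * (2 * inner (y s) (h s) - \<kappa> * inner (y s) (y s)) \<le> exp (- \<kappa> * s) * b s"
      by (intro mult_left_mono) auto
    \<comment> \<open>Discarding the decaying factor here leaves the plain integral of
      \<open>b\<close>; this uses that \<open>\<kappa>\<close>, \<open>s\<close> and
      \<open>b s\<close> are nonnegative.\<close>
    also have "\<dots> \<le> 1 * b s"
      using s \<open>0 \<le> \<kappa>\<close> by (intro mult_right_mono b(2) sT) auto
    finally show "\<exists>y. DERIV \<Phi> s :> y \<and> y \<le> 0" using D[OF sT(1)] unfolding sT(2) by auto
  qed (use t in auto)
  also have "\<Phi> 0 = 0" by (simp add: \<Phi>_def y_def)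
  finally have "exp (- \<kappa> * t) * inner (y t) (y t) \<le> integral {0..t} b" by (simp add: \<Phi>_def)
  then have "exp (\<kappa> * t) * (exp (- \<kappa> * t) * inner (y t) (y t)) \<le> exp (\<kappa> * t) * integral {0..t} b"
    by (intro mult_left_mono) auto
  then have "(norm (v t))\<^sup>2 \<le> exp (\<kappa> * t) * integral {0..t} b"
    by (simp add: vy[OF t] power2_norm_eq_inner inner_airy mult.assoc[symmetric] exp_add[symmetric])
  also have "\<dots> \<le> exp (\<kappa> * T) * integral {0..t} b"
    using t \<open>0 \<le> \<kappa>\<close> b
    by (intro mult_right_mono integral_nonneg integrable_continuous_real continuous_on_subset[OF b(1)])
      (auto intro!: mult_left_mono)
  finally show ?thesis .
qed

section \<open>Riemann sums\<close>

lemma riemann_sums_tendsto: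
  fixes h :: "real \<Rightarrow> real"
  assumes h: "continuous_on {0..t} h" and t: "0 \<le> t"
  shows "(\<lambda>n. t / real n * (\<Sum>i<n. h (t * real i / real n))) \<longlonglongrightarrow> integral {0..t} h"
proof (rule LIMSEQ_I)
  fix e :: real assume e: "e > 0"
  \<comment> \<open>The local errors add up to \<open>t * \<eta>\<close>, which is below
    \<open>e\<close> even for \<open>t = 0\<close>.\<close>
  define \<eta> where "\<eta> = e / (t + 1)"
  have \<eta>: "\<eta> > 0" using e t by (simp add: \<eta>_def)
  have "uniformly_continuous_on {0..t} h" by (rule compact_uniformly_continuous[OF h]) simp
  then obtain \<delta> where \<delta>: "\<delta> > 0" "\<And>x y. x \<in> {0..t} \<Longrightarrow> y \<in> {0..t} \<Longrightarrow> dist y x < \<delta> \<Longrightarrow> dist (h y) (h x) < \<eta>"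
    using \<eta> unfolding uniformly_continuous_on_def by metis
  obtain N where N: "t / \<delta> < real N" using reals_Archimedean2 by blast
  have "norm (t / real n * (\<Sum>i<n. h (t * real i / real n)) - integral {0..t} h) < e" if n: "n \<ge> Suc N" for n
  proof -
    define q where "q = t / real n"
    have q: "0 \<le> q" "q * real n = t" using t n by (auto simp: q_def)
    have "t / \<delta> < real n" using N n by linarith
    then have "q < \<delta>" using \<delta>(1) n by (simp add: q_def field_simps)
    have "\<bar>integral {0..q * real k} h - q * (\<Sum>i<k. h (q * real i))\<bar> \<le> real k * q * \<eta>" if "k \<le> n" for k
      using that
    proof (induction k)
      case (Suc k)
      have kn: "q * real (Suc k) \<le> t" unfolding q(2)[symmetric] using Suc q by (intro mult_left_mono) auto
      have k: "0 \<le> q * real k" "q * real k \<le> q * real (Suc k)" using q by (auto simp: algebra_simps)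
      have int: "h integrable_on {a..b}" if "0 \<le> a" "b \<le> t" for a b
        by (intro integrable_continuous_real continuous_on_subset[OF h]) (use that in auto)
      have "integral {0..q * real (Suc k)} h = integral {0..q * real k} h + integral {q * real k..q * real (Suc k)} h"
        by (intro Henstock_Kurzweil_Integration.integral_combine[symmetric] k int kn) simp
      moreover have "\<bar>integral {q * real k..q * real (Suc k)} h - q * h (q * real k)\<bar> \<le> q * \<eta>"
      proof -
        have "((\<lambda>x. h x - h (q * real k)) has_integral
            integral {q * real k..q * real (Suc k)} h - q * h (q * real k)) {q * real k..q * real (Suc k)}"
          using has_integral_diff[OF integrable_integral[OF int] has_integral_const_real, of "q * real k" "q * real (Suc k)" "h (q * real k)"] k kn
          by (simp add: algebra_simps)
        then have "norm (integral {q * real k..q * real (Suc k)} h - q * h (q * real k)) \<le>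
            \<eta> * measure lborel {q * real k..q * real (Suc k)}"
        proof (rule has_integral_bound_real[OF _ finite.emptyI, rotated])
          fix x assume x: "x \<in> {q * real k..q * real (Suc k)} - {}"
          then have "dist x (q * real k) < \<delta>" using \<open>q < \<delta>\<close> by (auto simp: dist_real_def algebra_simps)
          then have "dist (h x) (h (q * real k)) < \<eta>" using x k kn by (intro \<delta>) auto
          then show "norm (h x - h (q * real k)) \<le> \<eta>" by (simp add: dist_norm)
        qed (use \<eta> in auto)
        then show ?thesis using k by (simp add: algebra_simps)
      qed
      moreover have "\<bar>integral {0..q * real k} h - q * (\<Sum>i<k. h (q * real i))\<bar> \<le> real k * q * \<eta>"
        using Suc by simp
      ultimately show ?case by (simp add: algebra_simps)
    qed simp
    from this[of n] have "\<bar>integral {0..t} h - q * (\<Sum>i<n. h (q * real i))\<bar> \<le> t * \<eta>"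
      unfolding q(2) by (simp add: q(2)[symmetric] mult.commute)
    also have "t * \<eta> < e" using e t by (simp add: \<eta>_def field_simps)
    finally show ?thesis by (simp add: q_def abs_minus_commute)
  qed
  then show "\<exists>no. \<forall>n\<ge>no. norm (t / real n * (\<Sum>i<n. h (t * real i / real n)) - integral {0..t} h) < e" by blast
qed

text \<open>Jensen's inequality for a uniform average; it bounds moments of Riemann sums
  independently of the number of nodes.\<close>

lemma power_mean_le:
  fixes h :: "nat \<Rightarrow> real"
  assumes "\<And>i. 0 \<le> h i" "n > 0"
  shows "((\<Sum>i<n. h i) / real n) ^ p \<le> (\<Sum>i<n. h i ^ p) / real n"
proof -
  have "convex_on {0::real..} (\<lambda>x. x ^ p)"
    using convex_power_odd convex_on_subset[OF convex_power_even] by (cases "even p") auto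
  then have "(\<Sum>i<n. (1 / real n) *\<^sub>R h i) ^ p \<le> (\<Sum>i<n. (1 / real n) * h i ^ p)"
    using assms by (intro convex_on_sum) auto
  then show ?thesis by (simp add: sum_divide_distrib)
qed

section \<open>Moments\<close>

text \<open>The norm is not continuous on L^2, but its square is, up to conversion, a supremum of
  continuous partial sums.\<close>

lemma borel_measurable_sobolev_norm [measurable]: "sobolev_norm s \<in> borel_measurable borel"
proof -
  define c where "c = (\<lambda>F l. (1 + (real_of_int l)\<^sup>2) powr s * (cmod (fourier F l))\<^sup>2)"
  define S where "S = (\<lambda>n F. \<Sum>l\<in>{-int n..int n}. c F l)"
  have c: "c F l \<ge> 0" for F l by (simp add: c_def)
  have "continuous_on UNIV (S n)" for n
    unfolding S_def c_def[abs_def]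
    by (intro continuous_intros bounded_linear.continuous_on[OF bounded_linear_fourier])
  then have [measurable]: "S n \<in> borel_measurable borel" for n
    by (rule borel_measurable_continuous_onI)
  have inc: "incseq (\<lambda>n. ennreal (S n F))" for F
    unfolding S_def by (intro monoI ennreal_leI sum_mono2) (auto simp: c)
  have "infsum (c F) UNIV = enn2real (SUP n. ennreal (S n F))" for F
  proof (cases "c F summable_on UNIV")
    case True
    then have "(\<lambda>n. S n F) \<longlonglongrightarrow> infsum (c F) UNIV"
      unfolding S_def by (intro has_sum_imp_LIMSEQ_int has_sum_infsum)
    then have "(\<lambda>n. ennreal (S n F)) \<longlonglongrightarrow> ennreal (infsum (c F) UNIV)" by (rule tendsto_ennrealI)
    then have "(SUP n. ennreal (S n F)) = ennreal (infsum (c F) UNIV)"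
      by (rule LIMSEQ_unique[OF LIMSEQ_SUP[OF inc]])
    then show ?thesis by (simp add: infsum_nonneg c)
  next
    case False
    have "(SUP n. ennreal (S n F)) = top"
    proof (rule ccontr)
      define X where "X = (SUP n. ennreal (S n F))"
      assume "(SUP n. ennreal (S n F)) \<noteq> top"
      then have "ennreal (enn2real X) = X" by (simp add: X_def[symmetric] less_top)
      moreover have "ennreal (S n F) \<le> X" for n unfolding X_def by (rule SUP_upper) simp
      ultimately have "S n F \<le> enn2real X" for n by (metis ennreal_le_iff enn2real_nonneg)
      then have "c F summable_on UNIV" unfolding S_def by (intro summable_on_int_bounded[OF c])
      with False show False ..
    qed
    \<comment> \<open>Outside H^s the default values agree: a divergent \<open>infsum\<close> is 0,
      and so is \<open>enn2real top\<close>.\<close>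
    then show ?thesis by (simp only: infsum_not_exists[OF False] enn2real_top)
  qed
  then have "sobolev_norm s = (\<lambda>F. sqrt (enn2real (SUP n. ennreal (S n F))))"
    by (simp add: fun_eq_iff sobolev_norm_def c_def)
  also have "\<dots> \<in> borel_measurable borel" by measurable
  finally show ?thesis .
qed

text \<open>With its converse below, this trades \<open>Lp_norm\<close> for a bound on a moment, so
  that roots and the infinite case stay out of the main argument.\<close>

lemma Lp_norm_leI:
  assumes "q > 0" "0 \<le> c" "(\<integral>\<^sup>+\<omega>. ennreal (N (Y \<omega>) ^ q) \<partial>M) \<le> ennreal (c ^ q)"
  shows "Lp_norm M q N Y \<le> ennreal c"
proof -
  let ?I = "\<integral>\<^sup>+\<omega>. ennreal (N (Y \<omega>) ^ q) \<partial>M"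
  have "?I \<noteq> \<infinity>" using assms(3) by (metis ennreal_neq_top infinity_ennreal_def top_unique)
  moreover have "root q (enn2real ?I) \<le> root q (c ^ q)"
    using assms enn2real_mono[OF assms(3)] by (simp add: real_root_le_iff)
  ultimately show ?thesis
    using assms by (simp add: Lp_norm_def Let_def real_root_power_cancel ennreal_leI)
qed

lemma Lp_norm_leD:
  assumes "q > 0" "0 \<le> c" "Lp_norm M q N Y \<le> ennreal c"
  shows "(\<integral>\<^sup>+\<omega>. ennreal (N (Y \<omega>) ^ q) \<partial>M) \<le> ennreal (c ^ q)"
proof -
  let ?I = "\<integral>\<^sup>+\<omega>. ennreal (N (Y \<omega>) ^ q) \<partial>M"
  have I: "?I \<noteq> \<infinity>" using assms(3) by (auto simp: Lp_norm_def Let_def top_unique split: if_splits)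
  then have "root q (enn2real ?I) \<le> c"
    using assms by (simp add: Lp_norm_def Let_def ennreal_le_iff)
  then have "root q (enn2real ?I) ^ q \<le> c ^ q"
    using assms by (intro power_mono) auto
  then have "enn2real ?I \<le> c ^ q" using assms by simp
  then show ?thesis
    using I by (metis ennreal_enn2real ennreal_leI infinity_ennreal_def less_top)
qed

text \<open>Fatou's lemma for Riemann sums replaces Tonelli's theorem, which would require joint
  measurability in \<open>(s, \<omega>)\<close>.\<close>

lemma nn_integral_power_integral_le:
  fixes h :: "real \<Rightarrow> 'w \<Rightarrow> real"
  assumes meas: "\<And>s. s \<in> {0..t} \<Longrightarrow> h s \<in> borel_measurable M"
    and nonneg: "\<And>s \<omega>. 0 \<le> h s \<omega>"
    and cont: "AE \<omega> in M. continuous_on {0..t} (\<lambda>s. h s \<omega>)"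
    and bound: "\<And>s. s \<in> {0..t} \<Longrightarrow> (\<integral>\<^sup>+\<omega>. ennreal (h s \<omega> ^ p) \<partial>M) \<le> ennreal K"
    and "0 \<le> t" "0 \<le> K"
  shows "(\<integral>\<^sup>+\<omega>. ennreal (integral {0..t} (\<lambda>s. h s \<omega>) ^ p) \<partial>M) \<le> ennreal (t ^ p * K)"
proof -
  \<comment> \<open>The majorant that Jensen's inequality gives for the \<open>p\<close>-th power of
    the Riemann sum; its expectation involves only moments at single times.\<close>
  define R where "R = (\<lambda>n \<omega>. t ^ p * ((\<Sum>i<n. h (t * real i / real n) \<omega> ^ p) / real n))"
  have mem: "t * real i / real n \<in> {0..t}" if "i < n" for i n :: nat
  proof -
    have "t * (real i / real n) \<le> t * 1" using that \<open>0 \<le> t\<close> by (intro mult_left_mono) auto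
    then show ?thesis using \<open>0 \<le> t\<close> by simp
  qed
  have [measurable]: "R n \<in> borel_measurable M" for n
    unfolding R_def
    by (intro borel_measurable_times borel_measurable_const borel_measurable_divide borel_measurable_sum
        borel_measurable_power meas mem) auto
  have R: "(\<integral>\<^sup>+\<omega>. ennreal (R n \<omega>) \<partial>M) \<le> ennreal (t ^ p * K)" for n
  proof (cases "n = 0")
    case True
    then show ?thesis by (simp add: R_def)
  next
    case False
    have "(\<integral>\<^sup>+\<omega>. ennreal (R n \<omega>) \<partial>M) =
        (\<integral>\<^sup>+\<omega>. ennreal (t ^ p / real n) * (\<Sum>i<n. ennreal (h (t * real i / real n) \<omega> ^ p)) \<partial>M)"
      using \<open>0 \<le> t\<close> nonneg
      by (intro nn_integral_cong) (simp add: R_def sum_ennreal ennreal_mult[symmetric] sum_nonneg)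
    also have "\<dots> = ennreal (t ^ p / real n) * (\<Sum>i<n. \<integral>\<^sup>+\<omega>. ennreal (h (t * real i / real n) \<omega> ^ p) \<partial>M)"
      using meas[OF mem]
      by (subst nn_integral_cmult, force, subst nn_integral_sum) auto
    also have "\<dots> \<le> ennreal (t ^ p / real n) * (\<Sum>i<n. ennreal K)"
      by (intro mult_left_mono sum_mono bound mem) auto
    also have "\<dots> = ennreal (t ^ p * K)"
      using False \<open>0 \<le> t\<close> \<open>0 \<le> K\<close> by (simp add: sum_ennreal ennreal_mult[symmetric] ennreal_of_nat_eq_real_of_nat)
    finally show ?thesis .
  qed
  have "(\<integral>\<^sup>+\<omega>. ennreal (integral {0..t} (\<lambda>s. h s \<omega>) ^ p) \<partial>M) \<le> (\<integral>\<^sup>+\<omega>. liminf (\<lambda>n. ennreal (R n \<omega>)) \<partial>M)"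
  proof (rule nn_integral_mono_AE)
    show "AE \<omega> in M. ennreal (integral {0..t} (\<lambda>s. h s \<omega>) ^ p) \<le> liminf (\<lambda>n. ennreal (R n \<omega>))"
      using cont
    proof eventually_elim
      case (elim \<omega>)
      let ?S = "\<lambda>n. t / real n * (\<Sum>i<n. h (t * real i / real n) \<omega>)"
      have "(\<lambda>n. ennreal (?S n ^ p)) \<longlonglongrightarrow> ennreal (integral {0..t} (\<lambda>s. h s \<omega>) ^ p)"
        by (intro tendsto_ennrealI tendsto_power riemann_sums_tendsto elim \<open>0 \<le> t\<close>)
      then have "ennreal (integral {0..t} (\<lambda>s. h s \<omega>) ^ p) = liminf (\<lambda>n. ennreal (?S n ^ p))"
        by (intro lim_imp_Liminf[symmetric]) auto
      also have "\<dots> \<le> liminf (\<lambda>n. ennreal (R n \<omega>))"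
      proof (rule Liminf_mono)
        show "\<forall>\<^sub>F n in sequentially. ennreal (?S n ^ p) \<le> ennreal (R n \<omega>)"
          using eventually_gt_at_top[of 0]
        proof eventually_elim
          case (elim n)
          have "?S n ^ p = t ^ p * ((\<Sum>i<n. h (t * real i / real n) \<omega>) / real n) ^ p"
            by (simp add: power_mult_distrib power_divide)
          also have "\<dots> \<le> R n \<omega>"
            unfolding R_def using elim \<open>0 \<le> t\<close> nonneg by (intro mult_left_mono power_mean_le) auto
          finally show ?case by (rule ennreal_leI)
        qed
      qed
      finally show ?case .
    qed
  qed
  also have "\<dots> \<le> liminf (\<lambda>n. \<integral>\<^sup>+\<omega>. ennreal (R n \<omega>) \<partial>M)"
    by (rule nn_integral_liminf) measurable
  also have "\<dots> \<le> ennreal (t ^ p * K)"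
    by (rule Liminf_le) (use R in auto)
  finally show ?thesis .
qed

section \<open>The fluctuation equation\<close>

text \<open>The nonlinearity is quadratic, so this expansion is exact. Divided by
  \<open>\<epsilon>\<close>, its linear part is the drift of the linearized equation and the rest is
  of order \<open>\<epsilon>\<close>.\<close>

lemma deriv_x_square_diff:
  assumes \<psi>: "\<psi> \<in> sobolev 1" and w: "w \<in> sobolev 1"
  shows "deriv_x ((\<psi> + \<epsilon> *\<^sub>R w) \<odot> (\<psi> + \<epsilon> *\<^sub>R w)) - deriv_x (\<psi> \<odot> \<psi>) =
    (2 * \<epsilon>) *\<^sub>R deriv_x (\<psi> \<odot> w) + \<epsilon>\<^sup>2 *\<^sub>R deriv_x (w \<odot> w)"
proof -
  note fin = linf_norm_finite
  have ew: "\<epsilon> *\<^sub>R w \<in> sobolev 1" by (rule sobolev_scaleR[OF w])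
  have scale: "F \<odot> (\<epsilon> *\<^sub>R w) = \<epsilon> *\<^sub>R (F \<odot> w)" if "F \<in> sobolev 1" for F
    using mult_L2_scaleR_left[OF fin[OF that], of \<epsilon> w] by (simp add: mult_L2_commute[of F])
  have "(\<psi> + \<epsilon> *\<^sub>R w) \<odot> (\<psi> + \<epsilon> *\<^sub>R w) =
      \<psi> \<odot> \<psi> + (2 * \<epsilon>) *\<^sub>R (\<psi> \<odot> w) + \<epsilon>\<^sup>2 *\<^sub>R (w \<odot> w)"
    using \<psi> w ew
    by (simp add: mult_L2_add_right fin mult_L2_add_left scale sobolev_scaleR
        mult_L2_scaleR_left mult_L2_commute[of w \<psi>] power2_eq_square scaleR_2[symmetric])
  then show ?thesis
    using \<psi> w by (simp add: deriv_x_add deriv_x_scaleR sobolev_add sobolev_scaleR sobolev_mult)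
qed

text \<open>The part of the argument for one fixed outcome. The noise \<open>Z\<close> enters with
  no regularity in time and is known only at the times in \<open>D\<close>; all that matters is that
  it is the same in both equations.\<close>

lemma fluctuation_pathwise_estimate:
  fixes u chi \<psi> Z :: "real \<Rightarrow> torus_L2"
  assumes "0 < \<epsilon>" "0 \<le> \<mu>"
    and u: "sobolev_continuous 1 T u" and chi: "sobolev_continuous 1 T chi"
    and \<psi>: "kdv_solution 2 T \<mu> \<xi> \<psi>"
    and D: "D \<subseteq> {0..T}" "{0..T} \<subseteq> closure D"
    and u_eq: "\<And>t. t \<in> D \<Longrightarrow> u t = airy t \<xi> +
        \<mu> *\<^sub>R integral {0..t} (\<lambda>s. airy (t - s) (deriv_x (u s \<odot> u s))) + \<epsilon> *\<^sub>R Z t"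
    and chi_eq: "\<And>t. t \<in> D \<Longrightarrow> chi t =
        (2 * \<mu>) *\<^sub>R integral {0..t} (\<lambda>s. airy (t - s) (deriv_x (\<psi> s \<odot> chi s))) + Z t"
    and A: "\<And>t. t \<in> {0..T} \<Longrightarrow> linf_norm (deriv_x (\<psi> t)) \<le> ennreal A" "0 \<le> A"
    and t: "t \<in> {0..T}"
  defines "w \<equiv> \<lambda>t. (1 / \<epsilon>) *\<^sub>R (u t - \<psi> t)"
  shows "(norm (w t - chi t))\<^sup>2 \<le>
    exp ((2 * \<mu> * A + 1) * T) * (36 * \<mu>\<^sup>2 * \<epsilon>\<^sup>2) * integral {0..t} (\<lambda>s. sobolev_norm 1 (w s) ^ 4)"
proof -
  have \<psi>c: "sobolev_continuous 1 T \<psi>" and \<psi>_eq: "\<And>t. t \<in> {0..T} \<Longrightarrow> \<psi> t = airy t \<xi> +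
        \<mu> *\<^sub>R integral {0..t} (\<lambda>s. airy (t - s) (deriv_x (\<psi> s \<odot> \<psi> s)))"
    using \<psi> by (auto simp: kdv_solution_def intro: sobolev_continuous_mono)
  have w: "sobolev_continuous 1 T w"
    unfolding w_def by (intro sobolev_continuous_scaleR sobolev_continuous_diff u \<psi>c)
  define v where "v = (\<lambda>t. w t - chi t)"
  have v: "sobolev_continuous 1 T v"
    unfolding v_def by (intro sobolev_continuous_diff w chi)
  define gu where "gu = (\<lambda>s. deriv_x (u s \<odot> u s))"
  define g\<psi> where "g\<psi> = (\<lambda>s. deriv_x (\<psi> s \<odot> \<psi> s))"
  define gc where "gc = (\<lambda>s. deriv_x (\<psi> s \<odot> chi s))"
  note g_defs = gu_def g\<psi>_def gc_def
  have gc: "continuous_on {0..T} gu" "continuous_on {0..T} g\<psi>" "continuous_on {0..T} gc"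
    unfolding g_defs by (intro continuous_on_deriv_x_mult u \<psi>c chi)+
  \<comment> \<open>The integrand exactly as it arises from subtracting the three equations; it is
    rewritten in terms of \<open>v\<close> and \<open>w\<close> only once the integral equation is
    established.\<close>
  define g where "g = (\<lambda>s. (\<mu> / \<epsilon>) *\<^sub>R (gu s - g\<psi> s) - (2 * \<mu>) *\<^sub>R gc s)"
  have g: "continuous_on {0..T} g"
    unfolding g_def by (intro continuous_intros gc)
  have vD: "v r = integral {0..r} (\<lambda>s. airy (r - s) (g s))" if r: "r \<in> D" for r
  proof -
    have rT: "r \<in> {0..T}" using D r by auto
    note int = airy_convolution(1)[OF _ rT]
    have *: "integral {0..r} (\<lambda>s. airy (r - s) (g s)) =
        (\<mu> / \<epsilon>) *\<^sub>R (integral {0..r} (\<lambda>s. airy (r - s) (gu s)) - integral {0..r} (\<lambda>s. airy (r - s) (g\<psi> s)))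
        - (2 * \<mu>) *\<^sub>R integral {0..r} (\<lambda>s. airy (r - s) (gc s))"
      unfolding g_def airy_diff airy_scaleR
      by (intro integral_unique has_integral_diff has_integral_cmul integrable_integral int gc)
    have "v r = (1 / \<epsilon>) *\<^sub>R ((airy r \<xi> + \<mu> *\<^sub>R integral {0..r} (\<lambda>s. airy (r - s) (gu s)) + \<epsilon> *\<^sub>R Z r) -
        (airy r \<xi> + \<mu> *\<^sub>R integral {0..r} (\<lambda>s. airy (r - s) (g\<psi> s)))) -
        ((2 * \<mu>) *\<^sub>R integral {0..r} (\<lambda>s. airy (r - s) (gc s)) + Z r)"
      unfolding v_def w_def g_defs u_eq[OF r, symmetric] \<psi>_eq[OF rT, symmetric] chi_eq[OF r, symmetric] ..
    also have "\<dots> = integral {0..r} (\<lambda>s. airy (r - s) (g s))"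
      unfolding * using \<open>0 < \<epsilon>\<close> by (simp add: algebra_simps)
    finally show ?thesis .
  qed
  have vT: "v r = integral {0..r} (\<lambda>s. airy (r - s) (g s))" if r: "r \<in> {0..T}" for r
  proof -
    have cl: "closure D = {0..T}" using D by (simp add: closure_minimal subset_antisym)
    \<comment> \<open>With \<open>Z\<close> gone both terms are continuous in time, so their
      equality extends from the dense set.\<close>
    have "v r - integral {0..r} (\<lambda>s. airy (r - s) (g s)) = 0"
    proof (rule continuous_constant_on_closure[of D])
      show "continuous_on (closure D) (\<lambda>r. v r - integral {0..r} (\<lambda>s. airy (r - s) (g s)))"
        unfolding cl
        by (intro continuous_on_diff continuous_on_airy_convolution g sobolev_continuous_imp_continuous_on[OF v]) simp
    qed (use vD r cl in auto)
    then show ?thesis by simp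
  qed
  \<comment> \<open>The linear part of the expansion and the linearized drift combine into the
    product of \<open>\<psi>\<close> and \<open>v\<close>, and one power of
    \<open>\<epsilon>\<close> survives in front of the quadratic remainder.\<close>
  have g_eq: "g s = (2 * \<mu>) *\<^sub>R deriv_x (\<psi> s \<odot> v s) + (\<mu> * \<epsilon>) *\<^sub>R deriv_x (w s \<odot> w s)"
    if s: "s \<in> {0..T}" for s
  proof -
    note H = sobolev_continuousD[OF \<psi>c s] sobolev_continuousD[OF w s] sobolev_continuousD[OF chi s]
    have us: "u s = \<psi> s + \<epsilon> *\<^sub>R w s" using \<open>0 < \<epsilon>\<close> by (simp add: w_def)
    have d1: "gu s - g\<psi> s = (2 * \<epsilon>) *\<^sub>R deriv_x (\<psi> s \<odot> w s) + \<epsilon>\<^sup>2 *\<^sub>R deriv_x (w s \<odot> w s)"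
      unfolding gu_def g\<psi>_def us by (rule deriv_x_square_diff[OF H(1,2)])
    have d2: "gc s = deriv_x (\<psi> s \<odot> w s) - deriv_x (\<psi> s \<odot> v s)"
    proof -
      have "\<psi> s \<odot> v s = \<psi> s \<odot> w s - \<psi> s \<odot> chi s"
        unfolding v_def mult_L2_commute[of "\<psi> s"] by (rule mult_L2_diff_left[OF linf_norm_finite[OF H(1)]])
      then show ?thesis using H by (simp add: gc_def deriv_x_diff sobolev_mult)
    qed
    show ?thesis
      unfolding g_def d1 d2 using \<open>0 < \<epsilon>\<close> by (simp add: power2_eq_square algebra_simps)
  qed
  have "(norm (v t))\<^sup>2 \<le> exp ((2 * \<mu> * A + 1) * T) *
      integral {0..t} (\<lambda>s. 36 * \<mu>\<^sup>2 * \<epsilon>\<^sup>2 * sobolev_norm 1 (w s) ^ 4)"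
  proof (rule mild_energy_estimate[OF g _ _ vT _ _ t])
    show "continuous_on {0..T} (\<lambda>s. 36 * \<mu>\<^sup>2 * \<epsilon>\<^sup>2 * sobolev_norm 1 (w s) ^ 4)"
      by (intro continuous_intros continuous_on_sobolev_norm w)
    show "2 * inner (v s) (g s) \<le> (2 * \<mu> * A + 1) * (norm (v s))\<^sup>2 + 36 * \<mu>\<^sup>2 * \<epsilon>\<^sup>2 * sobolev_norm 1 (w s) ^ 4"
      if s: "s \<in> {0..T}" for s
    proof -
      note H = sobolev_continuousD[OF \<psi>c s] sobolev_continuousD[OF w s] sobolev_continuousD[OF v s]
      have 1: "2 * inner (v s) (deriv_x (\<psi> s \<odot> v s)) \<le> A * (norm (v s))\<^sup>2"
        by (rule inner_deriv_x_mult_le[OF H(1,3) A(1)[OF s] A(2)])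
      \<comment> \<open>Young's inequality against this quantity yields its square, the source term,
        and adds 1 to the Gronwall rate.\<close>
      let ?b = "6 * \<mu> * \<epsilon> * (sobolev_norm 1 (w s))\<^sup>2"
      have "inner (v s) (deriv_x (w s \<odot> w s)) \<le> norm (v s) * norm (deriv_x (w s \<odot> w s))"
        by (rule norm_cauchy_schwarz)
      also have "\<dots> \<le> norm (v s) * (6 * sobolev_norm 1 (w s) * sobolev_norm 1 (w s))"
        by (intro mult_left_mono norm_deriv_x_mult_le H) simp
      finally have "2 * (\<mu> * \<epsilon>) * inner (v s) (deriv_x (w s \<odot> w s)) \<le>
          2 * (\<mu> * \<epsilon>) * (norm (v s) * (6 * sobolev_norm 1 (w s) * sobolev_norm 1 (w s)))"
        using assms(1,2) by (intro mult_left_mono) auto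
      also have "\<dots> = 2 * norm (v s) * ?b" by (simp add: power2_eq_square)
      also have "\<dots> \<le> (norm (v s))\<^sup>2 + ?b\<^sup>2" by (rule sum_squares_bound)
      also have "?b\<^sup>2 = 36 * \<mu>\<^sup>2 * \<epsilon>\<^sup>2 * sobolev_norm 1 (w s) ^ 4"
        by (simp add: power_mult_distrib flip: power_mult)
      finally have 2: "2 * (\<mu> * \<epsilon>) * inner (v s) (deriv_x (w s \<odot> w s)) \<le>
          (norm (v s))\<^sup>2 + 36 * \<mu>\<^sup>2 * \<epsilon>\<^sup>2 * sobolev_norm 1 (w s) ^ 4" .
      have "2 * inner (v s) (g s) =
          2 * \<mu> * (2 * inner (v s) (deriv_x (\<psi> s \<odot> v s))) + 2 * (\<mu> * \<epsilon>) * inner (v s) (deriv_x (w s \<odot> w s))"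
        by (simp add: g_eq[OF s] inner_add_right)
      also have "\<dots> \<le> 2 * \<mu> * (A * (norm (v s))\<^sup>2) + ((norm (v s))\<^sup>2 + 36 * \<mu>\<^sup>2 * \<epsilon>\<^sup>2 * sobolev_norm 1 (w s) ^ 4)"
        using assms(2) by (intro add_mono mult_left_mono 1 2) auto
      finally show ?thesis by (simp add: algebra_simps)
    qed
  qed (use assms(2) A(2) in auto)
  then show ?thesis by (simp add: v_def mult.assoc)
qed

section \<open>From the pathwise estimate to moments, uniformly in the noise amplitude\<close>

theorem proposition3p3:
  fixes T \<mu> :: real and p :: nat
  assumes "T > 0" and "\<mu> > 0" and "p \<ge> 1"
  shows "\<forall>(q::real) (A::ennreal) (D::ennreal) (B::ennreal). B < \<infinity> \<longrightarrow>
    (\<exists>C>0. \<forall>(M::'w measure) F \<beta> e Q R \<xi> u \<psi> chi.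
       complete_filtered_prob_space M F \<longrightarrow>
       orthonormal_basis e \<longrightarrow>
       cylindrical_wiener M F \<beta> \<longrightarrow>
       nonneg_selfadjoint Q \<longrightarrow> is_operator_sqrt R Q \<longrightarrow>
       hilbert_schmidt e 1 R \<longrightarrow>
       \<xi> \<in> sobolev 2 \<longrightarrow>
       (\<forall>\<epsilon>\<in>{0<..<1}. stoch_kdv_mild_solution M F \<beta> e R T \<mu> \<epsilon> \<xi> (u \<epsilon>)) \<longrightarrow>
       kdv_solution 2 T \<mu> \<xi> \<psi> \<longrightarrow>
       linearized_mild_solution M F \<beta> e R T \<mu> \<psi> chi \<longrightarrow>
       hs_norm e 1 R = q \<longrightarrow>
       (SUP t\<in>{0..T}. linf_norm (deriv_x (\<psi> t))) = A \<longrightarrow>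
       (SUP t\<in>{0..T}. Lp_norm M (4 * p) (sobolev_norm 1) (chi t)) = D \<longrightarrow>
       (SUP \<epsilon>\<in>{0<..<1}. SUP t\<in>{0..T}.
          Lp_norm M (8 * p) (sobolev_norm 1) (fluctuation \<epsilon> (u \<epsilon>) \<psi> t)) = B \<longrightarrow>
       (\<forall>\<epsilon>\<in>{0<..<1}.
          (SUP t\<in>{0..T}. Lp_norm M (2 * p) norm
             (\<lambda>\<omega>. fluctuation \<epsilon> (u \<epsilon>) \<psi> t \<omega> - chi t \<omega>)) \<le> ennreal (C * \<epsilon>)))"
proof (intro allI impI)
  fix q :: real and A D B :: ennreal
  assume "B < \<infinity>"
  \<comment> \<open>For infinite \<open>A\<close> this is 0. That is harmless, since every
    admissible \<open>\<psi>\<close> is continuous in H^2 and forces \<open>A\<close> to be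
    finite.\<close>
  define A' where "A' = enn2real A"
  define B' where "B' = enn2real B"
  have B': "B = ennreal B'" "0 \<le> B'" using \<open>B < \<infinity>\<close> by (simp_all add: B'_def)
  define c where "c = exp ((2 * \<mu> * A' + 1) * T) * (36 * \<mu>\<^sup>2)"
  \<comment> \<open>Bounds the moment of order \<open>4 * p\<close> of the H^1 norm through the one
    of order \<open>8 * p\<close>, by means of x <= 1 + x^2.\<close>
  define K where "K = 1 + B' ^ (8 * p)"
  \<comment> \<open>The summand 1 gives \<open>C \<ge> 1\<close>, so that
    \<open>C \<le> C ^ (2 * p)\<close> and the root of order \<open>2 * p\<close> need not be
    taken.\<close>
  define C where "C = 1 + c ^ p * T ^ p * K"
  have nonneg: "0 \<le> A'" "0 \<le> c" "0 \<le> K" by (simp_all add: A'_def c_def K_def B')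
  then have C: "1 \<le> C" using \<open>T > 0\<close> by (simp add: C_def)
  show "\<exists>C>0. \<forall>(M::'w measure) F \<beta> e Q R \<xi> u \<psi> chi.
       complete_filtered_prob_space M F \<longrightarrow>
       orthonormal_basis e \<longrightarrow>
       cylindrical_wiener M F \<beta> \<longrightarrow>
       nonneg_selfadjoint Q \<longrightarrow> is_operator_sqrt R Q \<longrightarrow>
       hilbert_schmidt e 1 R \<longrightarrow>
       \<xi> \<in> sobolev 2 \<longrightarrow>
       (\<forall>\<epsilon>\<in>{0<..<1}. stoch_kdv_mild_solution M F \<beta> e R T \<mu> \<epsilon> \<xi> (u \<epsilon>)) \<longrightarrow>
       kdv_solution 2 T \<mu> \<xi> \<psi> \<longrightarrow>
       linearized_mild_solution M F \<beta> e R T \<mu> \<psi> chi \<longrightarrow>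
       hs_norm e 1 R = q \<longrightarrow>
       (SUP t\<in>{0..T}. linf_norm (deriv_x (\<psi> t))) = A \<longrightarrow>
       (SUP t\<in>{0..T}. Lp_norm M (4 * p) (sobolev_norm 1) (chi t)) = D \<longrightarrow>
       (SUP \<epsilon>\<in>{0<..<1}. SUP t\<in>{0..T}.
          Lp_norm M (8 * p) (sobolev_norm 1) (fluctuation \<epsilon> (u \<epsilon>) \<psi> t)) = B \<longrightarrow>
       (\<forall>\<epsilon>\<in>{0<..<1}.
          (SUP t\<in>{0..T}. Lp_norm M (2 * p) norm
             (\<lambda>\<omega>. fluctuation \<epsilon> (u \<epsilon>) \<psi> t \<omega> - chi t \<omega>)) \<le> ennreal (C * \<epsilon>))"
  proof (intro exI[of _ C] conjI allI impI ballI SUP_least)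
    show "0 < C" using C by simp
    fix M :: "'w measure" and F \<beta> e Q R \<xi> u \<psi> chi and \<epsilon> t :: real
    assume M: "complete_filtered_prob_space M F"
      and u_sol: "\<forall>\<epsilon>\<in>{0<..<1}. stoch_kdv_mild_solution M F \<beta> e R T \<mu> \<epsilon> \<xi> (u \<epsilon>)"
      and \<psi>: "kdv_solution 2 T \<mu> \<xi> \<psi>"
      and chi: "linearized_mild_solution M F \<beta> e R T \<mu> \<psi> chi"
      and A: "(SUP t\<in>{0..T}. linf_norm (deriv_x (\<psi> t))) = A"
      and B: "(SUP \<epsilon>\<in>{0<..<1}. SUP t\<in>{0..T}.
          Lp_norm M (8 * p) (sobolev_norm 1) (fluctuation \<epsilon> (u \<epsilon>) \<psi> t)) = B"
      and \<epsilon>: "\<epsilon> \<in> {0<..<1}" and t: "t \<in> {0..T}"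
    interpret prob_space M using M by (simp add: complete_filtered_prob_space_def)
    have u: "stoch_kdv_mild_solution M F \<beta> e R T \<mu> \<epsilon> \<xi> (u \<epsilon>)" using u_sol \<epsilon> by blast
    have \<psi>2: "sobolev_continuous 2 T \<psi>" using \<psi> by (simp add: kdv_solution_def)

    have A'_le: "linf_norm (deriv_x (\<psi> s)) \<le> ennreal A'" if s: "s \<in> {0..T}" for s
    proof -
      obtain L where L: "\<And>s. s \<in> {0..T} \<Longrightarrow> linf_norm (deriv_x (\<psi> s)) \<le> ennreal L"
        using bounded_linf_norm_deriv_x[OF \<psi>2] by blast
      then have "A \<le> ennreal L" unfolding A[symmetric] by (rule SUP_least)
      then have "A < top" by (rule order_le_less_trans) simp
      then have A'_eq: "ennreal A' = A" by (simp add: A'_def)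
      show ?thesis unfolding A'_eq A[symmetric] by (rule SUP_upper[OF s])
    qed

    define w where "w = (\<lambda>s \<omega>. fluctuation \<epsilon> (u \<epsilon>) \<psi> s \<omega>)"
    define h where "h = (\<lambda>s \<omega>. sobolev_norm 1 (w s \<omega>) ^ 4)"

    have "(\<integral>\<^sup>+\<omega>. ennreal (h s \<omega> ^ p) \<partial>M) \<le> ennreal K" and h_meas: "h s \<in> borel_measurable M"
      if s: "s \<in> {0..T}" for s
    proof -
      have "u \<epsilon> s \<in> borel_measurable (F s)" using u s by (simp add: stoch_kdv_mild_solution_def)
      moreover have "space (F s) = space M" "sets (F s) \<subseteq> sets M"
        using M by (auto simp: complete_filtered_prob_space_def filtration_def)
      ultimately have "u \<epsilon> s \<in> borel_measurable M"
        using measurable_mono[of borel borel "F s" M] by auto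
      moreover have "(\<lambda>x. (1 / \<epsilon>) *\<^sub>R (x - \<psi> s)) \<in> borel_measurable borel"
        by (intro borel_measurable_continuous_onI continuous_intros)
      ultimately have "(\<lambda>\<omega>. (1 / \<epsilon>) *\<^sub>R (u \<epsilon> s \<omega> - \<psi> s)) \<in> borel_measurable M"
        by (rule measurable_compose)
      then have [measurable]: "w s \<in> borel_measurable M" by (simp add: w_def fluctuation_def[abs_def])
      show "h s \<in> borel_measurable M" unfolding h_def by measurable
      have "Lp_norm M (8 * p) (sobolev_norm 1) (w s) \<le> ennreal B'"
        unfolding B'(1)[symmetric] B[symmetric] w_def using \<epsilon> s by (intro SUP_upper2[OF \<epsilon>] SUP_upper)
      then have "(\<integral>\<^sup>+\<omega>. ennreal (sobolev_norm 1 (w s \<omega>) ^ (8 * p)) \<partial>M) \<le> ennreal (B' ^ (8 * p))"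
        by (intro Lp_norm_leD) (use assms(3) B' in auto)
      moreover have "(\<integral>\<^sup>+\<omega>. ennreal (h s \<omega> ^ p) \<partial>M) \<le>
          (\<integral>\<^sup>+\<omega>. 1 + ennreal (sobolev_norm 1 (w s \<omega>) ^ (8 * p)) \<partial>M)"
      proof (rule nn_integral_mono)
        fix \<omega>
        have "x \<le> 1 + x\<^sup>2" if "0 \<le> x" for x :: real
          using sum_squares_bound[of x 1] that by simp
        from this[of "h s \<omega> ^ p"] have "h s \<omega> ^ p \<le> 1 + sobolev_norm 1 (w s \<omega>) ^ (8 * p)"
          by (simp add: h_def sobolev_norm_nonneg power_mult[symmetric] mult.commute mult.left_commute)
        then have "ennreal (h s \<omega> ^ p) \<le> ennreal (1 + sobolev_norm 1 (w s \<omega>) ^ (8 * p))"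
          by (rule ennreal_leI)
        then show "ennreal (h s \<omega> ^ p) \<le> 1 + ennreal (sobolev_norm 1 (w s \<omega>) ^ (8 * p))"
          by (simp add: sobolev_norm_nonneg)
      qed
      moreover have "\<dots> = 1 + (\<integral>\<^sup>+\<omega>. ennreal (sobolev_norm 1 (w s \<omega>) ^ (8 * p)) \<partial>M)"
        by (subst nn_integral_add) (auto simp: emeasure_space_1)
      ultimately show "(\<integral>\<^sup>+\<omega>. ennreal (h s \<omega> ^ p) \<partial>M) \<le> ennreal K"
        using B' by (auto simp: K_def intro: order_trans add_left_mono)
    qed
    note h_moment = this(1)

    \<comment> \<open>From here on \<open>D\<close> is a set of times, not the bound for the moments
      of \<open>chi\<close>. Countability merges the null sets of the individual times into
      one.\<close>
    obtain D where D: "countable D" "D \<subseteq> {0..T}" "{0..T} \<subseteq> closure D" by (rule separable)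
    have AE: "AE \<omega> in M. sobolev_continuous 1 T (\<lambda>s. w s \<omega>) \<and> (norm (w t \<omega> - chi t \<omega>))\<^sup>2 \<le>
        c * \<epsilon>\<^sup>2 * integral {0..t} (\<lambda>s. h s \<omega>)"
    proof -
      \<comment> \<open>Both equations refer to this same fixed version of the integral, so
        subtracting \<open>\<epsilon>\<close> times one value from \<open>\<epsilon>\<close> times
        the other leaves exactly zero.\<close>
      let ?Z = "\<lambda>s \<omega>. stoch_integral M \<beta> e s (\<lambda>r f. airy (s - r) (R f)) \<omega>"
      have "AE \<omega> in M. sobolev_continuous 1 T (\<lambda>s. u \<epsilon> s \<omega>)" "AE \<omega> in M. sobolev_continuous 1 T (\<lambda>s. chi s \<omega>)"
        using u chi by (auto simp: stoch_kdv_mild_solution_def linearized_mild_solution_def)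
      moreover have "AE \<omega> in M. \<forall>s\<in>D. u \<epsilon> s \<omega> = airy s \<xi> +
        \<mu> *\<^sub>R integral {0..s} (\<lambda>r. airy (s - r) (deriv_x (u \<epsilon> r \<omega> \<odot> u \<epsilon> r \<omega>))) + \<epsilon> *\<^sub>R ?Z s \<omega>"
        by (rule AE_ball_countable'[OF _ D(1)])
          (use u D(2) in \<open>unfold stoch_kdv_mild_solution_def, blast\<close>)
      moreover have "AE \<omega> in M. \<forall>s\<in>D. chi s \<omega> =
        (2 * \<mu>) *\<^sub>R integral {0..s} (\<lambda>r. airy (s - r) (deriv_x (\<psi> r \<odot> chi r \<omega>))) + ?Z s \<omega>"
        by (rule AE_ball_countable'[OF _ D(1)])
          (use chi D(2) in \<open>unfold linearized_mild_solution_def, blast\<close>)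
      ultimately show ?thesis
      proof eventually_elim
        case (elim \<omega>)
        have "sobolev_continuous 1 T (\<lambda>s. w s \<omega>)"
          unfolding w_def fluctuation_def
          by (intro sobolev_continuous_scaleR sobolev_continuous_diff elim sobolev_continuous_mono[OF \<psi>2]) simp
        moreover have "(norm (w t \<omega> - chi t \<omega>))\<^sup>2 \<le> exp ((2 * \<mu> * A' + 1) * T) * (36 * \<mu>\<^sup>2 * \<epsilon>\<^sup>2) *
            integral {0..t} (\<lambda>s. sobolev_norm 1 (w s \<omega>) ^ 4)"
          unfolding w_def fluctuation_def
          by (rule fluctuation_pathwise_estimate[where Z = "\<lambda>s. ?Z s \<omega>", OF _ _ elim(1,2) \<psi> D(2,3) _ _ A'_le nonneg(1) t])
            (use \<epsilon> assms(2) elim(3,4) in auto)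
        ultimately show ?case by (simp add: h_def c_def mult_ac)
      qed
    qed

    have "Lp_norm M (2 * p) norm (\<lambda>\<omega>. w t \<omega> - chi t \<omega>) \<le> ennreal (C * \<epsilon>)"
    proof (rule Lp_norm_leI)
      have "(\<integral>\<^sup>+\<omega>. ennreal (norm (w t \<omega> - chi t \<omega>) ^ (2 * p)) \<partial>M) \<le>
          (\<integral>\<^sup>+\<omega>. ennreal (integral {0..t} (\<lambda>s. c * \<epsilon>\<^sup>2 * h s \<omega>) ^ p) \<partial>M)"
      proof (rule nn_integral_mono_AE)
        show "AE \<omega> in M. ennreal (norm (w t \<omega> - chi t \<omega>) ^ (2 * p)) \<le>
            ennreal (integral {0..t} (\<lambda>s. c * \<epsilon>\<^sup>2 * h s \<omega>) ^ p)"
          using AE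
        proof eventually_elim
          case (elim \<omega>)
          then have "((norm (w t \<omega> - chi t \<omega>))\<^sup>2) ^ p \<le> (c * \<epsilon>\<^sup>2 * integral {0..t} (\<lambda>s. h s \<omega>)) ^ p"
            by (intro power_mono) auto
          then show ?case
            by (intro ennreal_leI) (simp add: power_mult)
        qed
      qed
      also have "\<dots> \<le> ennreal (t ^ p * ((c * \<epsilon>\<^sup>2) ^ p * K))"
      proof (rule nn_integral_power_integral_le)
        fix s assume "s \<in> {0..t}"
        then have s: "s \<in> {0..T}" using t by auto
        note [measurable] = h_meas[OF s]
        show "(\<lambda>\<omega>. c * \<epsilon>\<^sup>2 * h s \<omega>) \<in> borel_measurable M" by measurable
        have "(\<integral>\<^sup>+\<omega>. ennreal ((c * \<epsilon>\<^sup>2 * h s \<omega>) ^ p) \<partial>M) =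
            ennreal ((c * \<epsilon>\<^sup>2) ^ p) * (\<integral>\<^sup>+\<omega>. ennreal (h s \<omega> ^ p) \<partial>M)"
          using nonneg by (subst nn_integral_cmult[symmetric]) (auto simp: power_mult_distrib ennreal_mult')
        also have "\<dots> \<le> ennreal ((c * \<epsilon>\<^sup>2) ^ p) * ennreal K"
          by (intro mult_left_mono h_moment s) simp
        finally show "(\<integral>\<^sup>+\<omega>. ennreal ((c * \<epsilon>\<^sup>2 * h s \<omega>) ^ p) \<partial>M) \<le> ennreal ((c * \<epsilon>\<^sup>2) ^ p * K)"
          using nonneg by (simp add: ennreal_mult')
      next
        show "AE \<omega> in M. continuous_on {0..t} (\<lambda>s. c * \<epsilon>\<^sup>2 * h s \<omega>)"
          using AE
        proof eventually_elim
          case (elim \<omega>)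
          then have "continuous_on {0..T} (\<lambda>s. c * \<epsilon>\<^sup>2 * h s \<omega>)"
            unfolding h_def by (intro continuous_intros continuous_on_sobolev_norm) blast
          then show ?case by (rule continuous_on_subset) (use t in auto)
        qed
      qed (use nonneg t in \<open>auto simp: h_def\<close>)
      also have "\<dots> \<le> ennreal ((C * \<epsilon>) ^ (2 * p))"
      proof -
        have "t ^ p * ((c * \<epsilon>\<^sup>2) ^ p * K) \<le> T ^ p * ((c * \<epsilon>\<^sup>2) ^ p * K)"
          using t nonneg by (intro mult_right_mono power_mono) auto
        also have "\<dots> = (c ^ p * T ^ p * K) * \<epsilon> ^ (2 * p)"
          by (simp add: power_mult_distrib power_mult)
        also have "\<dots> \<le> C ^ (2 * p) * \<epsilon> ^ (2 * p)"
        proof (rule mult_right_mono)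
          have "c ^ p * T ^ p * K \<le> C ^ 1" by (simp add: C_def)
          also have "\<dots> \<le> C ^ (2 * p)" using C assms(3) by (intro power_increasing) auto
          finally show "c ^ p * T ^ p * K \<le> C ^ (2 * p)" .
        qed (use \<epsilon> in auto)
        finally show ?thesis
          by (simp add: power_mult_distrib ennreal_leI)
      qed
      finally show "(\<integral>\<^sup>+\<omega>. ennreal (norm (w t \<omega> - chi t \<omega>) ^ (2 * p)) \<partial>M) \<le> ennreal ((C * \<epsilon>) ^ (2 * p))" .
    qed (use assms(3) C \<epsilon> in auto)
    then show "Lp_norm M (2 * p) norm (\<lambda>\<omega>. fluctuation \<epsilon> (u \<epsilon>) \<psi> t \<omega> - chi t \<omega>) \<le> ennreal (C * \<epsilon>)"
      by (simp add: w_def)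
  qed
qed

end
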